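(* Consider the partially observed Markov decision process with state space $\mathbb{X}$, standard Borel observation space $\mathbb{Y}$, action space $\mathbb{U}$, transition kernel $\mathcal{T}$, observation channel $Q$ and stage-wise cost $c:\mathbb{X}\times\mathbb{U}\to\mathbb{R}$ described in the context. Assume: (1) $\mathbb{U}$ is compact and $(\mathbb{X},d)$ is a compact metric space with diameter $D=\sup_{x,y\in\mathbb{X}}d(x,y)$. (2) $\mathcal{T}(\cdot\mid x,u)$ is continuous in total variation in $(x,u)$: whenever $(x_n,u_n)\to(x,u)$, $\mathcal{T}(\cdot\mid x_n,u_n)\to\mathcal{T}(\cdot\mid x,u)$ in total variation. (3) There exists $\alpha\in\mathbb{R}^+$ such that $\|\mathcal{T}(\cdot\mid x,u)-\mathcal{T}(\cdot\mid x',u)\|_{TV}\le\alpha\, d(x,x')$ for all $x,x'\in\mathbb{X}$, $u\in\mathbb{U}$. (4) There exists $K_1\in\mathbb{R}^+$ such that $|c(x,u)-c(x',u)|\le K_1 d(x,x')$ for all $x,x'\in\mathbb{X}$, $u\in\mathbb{U}$. (5) $c$ is continuous (and thus bounded). (6) $K_2:=\dfrac{\alpha D(3-2\delta(Q))}{2}<1$, where $\delta(Q)$ is the Dobrushin coefficient of $Q$. Then a solution to the average cost optimality equation exists: there are measurable functions $h:\mathcal{Z}\to\mathbb{R}$ and $\gamma^*:\mathcal{Z}\to\mathbb{U}$ and a constant $\rho^*\in\mathbb{R}$ such that for all $z\in\mathcal{Z}$ $$h(z)+\rho^*=\inf_{u\in\mathbb{U}}\Big\{\tilde c(z,u)+\int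 h(z_1)\,\eta(dz_1\mid z,u)\Big\}=\tilde c(z,\gamma^*(z))+\int h(z_1)\,\eta(dz_1\mid z,\gamma^*(z)).$$ Consequently there exists an optimal control policy for the average cost criterion, and the optimal average cost $J^*$ is constant, i.e. the same for every initial state distribution in $\mathcal{Z}$.
   Context: POMDP. $\mathcal{T}$ is a stochastic kernel from $\mathbb{X}\times\mathbb{U}$ to $\mathbb{X}$ and $Q$ is a stochastic kernel from $\mathbb{X}$ to $\mathbb{Y}$. The initial state $X_0$ has distribution (prior) $\mu$, $Y_t$ given $X_t$ (and the past) has law $Q(\cdot\mid X_t)$, and $X_t$ given the past $(X,Y,U)_{[0,t-1]}$ has law $\mathcal{T}(\cdot\mid X_{t-1},U_{t-1})$. An admissible policy $\gamma=\{\gamma_t\}_{t\ge0}$ chooses $U_t=\gamma_t(I_t)\in\mathbb{U}$ measurably from the information $I_t=\{Y_{[0,t]},U_{[0,t-1]}\}$, $I_0=\{Y_0\}$; $\Gamma$ is the set of admissible policies and $E_\mu^\gamma$ the corresponding expectation. Average cost: $J(\mu,\gamma)=\limsup_{n\to\infty}\frac1n E_\mu^\gamma\big[\sum_{t=0}^{n-1}c(X_t,U_t)\big]$, and $J^*(\mu)=\inf_{\gamma\in\Gamma}J(\mu,\gamma)$. A policy is optimal if it attains this infimum. Belief MDP. $\mathcal{Z}=\mathcal{P}(\mathbb{X})$ is the space of Borel probability measures on $\mathbb{X}$ with the weak convergence topology. The belief (filter) process $z_n(\cdot)=P\{X_n\in\cdot\mid y_0,\dots,y_n,u_0,\dots,u_{n-1}\}$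 is a completely observed controlled Markov process on $\mathcal{Z}$ with transition kernel $$\eta(\cdot\mid z,u)=\int_{\mathbb{Y}}1_{\{F(z,u,y)\in\cdot\}}P(dy\mid z,u),$$ where $P(\cdot\mid z,u)=\Pr\{Y_{n+1}\in\cdot\mid Z_n=z,U_n=u\}$ and $F(z,u,y)=\Pr\{X_{n+1}\in\cdot\mid Z_n=z,U_n=u,Y_{n+1}=y\}$. The belief cost is $\tilde c(z,u)=\int_{\mathbb{X}}c(x,u)\,z(dx)$. Conventions. $\|\mu-\nu\|_{TV}=2\sup_{B}|\mu(B)-\nu(B)|=\sup_{\|f\|_\infty\le1}|\int f\,d\mu-\int f\,d\nu|$. For a stochastic kernel $K:S_1\to\mathcal{P}(S_2)$ the Dobrushin coefficient is $\delta(K)=\inf\sum_{i=1}^n\min(K(x,A_i),K(y,A_i))$, the infimum being over all $x,y\in S_1$ and all finite (measurable) partitions $\{A_i\}_{i=1}^n$ of $S_2$. *)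

theory Defs
  imports "HOL-Probability.Probability"
begin

section \<open>Measure-theoretic notions\<close>

definition standard_borel :: "'a measure \<Rightarrow> bool" where
  "standard_borel M \<longleftrightarrow>
     (\<exists>S. topspace S = space M \<and> completely_metrizable_space S \<and> second_countable S \<and>
          sets M = sigma_sets (space M) {W. openin S W})"

definition tv_norm_diff :: "'a measure \<Rightarrow> 'a measure \<Rightarrow> real" where
  "tv_norm_diff \<mu> \<nu> = 2 * (SUP B\<in>sets \<mu>. \<bar>measure \<mu> B - measure \<nu> B\<bar>)"

text \<open>The blocks of \<^const>\<open>partition_on\<close> are nonempty; empty blocks would contribute nothing
  to the sum.\<close>

definition dobrushin :: "'b measure \<Rightarrow> ('a \<Rightarrow> 'b measure) \<Rightarrow> real" where
  "dobrushin M K =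
     Inf {(\<Sum>A\<in>\<A>. min (measure (K x) A) (measure (K y) A)) | x y \<A>.
            finite \<A> \<and> \<A> \<subseteq> sets M \<and> partition_on (space M) \<A>}"


section \<open>The space of beliefs\<close>

definition beliefs :: "'x::topological_space measure set" where
  "beliefs = {z. prob_space z \<and> sets z = sets borel}"

definition weak_topology :: "'x::topological_space measure topology" where
  "weak_topology = topology_generated_by
     {{z \<in> beliefs. (\<integral>x. f x \<partial>z) \<in> V} | (f :: 'x \<Rightarrow> real) V.
        continuous_on UNIV f \<and> bounded (range f) \<and> open V}"

definition belief_algebra :: "'x::topological_space measure measure" where
  "belief_algebra = sigma beliefs {W. openin weak_topology W}"


section \<open>The partially observed model\<close>

text \<open>
  The state space and the action space are types with their Borel sigma-algebras, the
  observation space is the measurable space \<open>Y\<close>. When the state and action types are assumed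
  compact metric, the sort \<^class>\<open>polish_space\<close> is no further restriction. A path \<open>\<omega>\<close> lists the
  triples \<open>(X\<^sub>t, Y\<^sub>t, U\<^sub>t)\<close>.
\<close>

type_synonym ('x, 'y, 'u) path = "nat \<Rightarrow> 'x \<times> 'y \<times> 'u"
type_synonym ('y, 'u) policy = "nat \<Rightarrow> (nat \<Rightarrow> 'y) \<times> (nat \<Rightarrow> 'u) \<Rightarrow> 'u"

definition state_at :: "nat \<Rightarrow> ('x, 'y, 'u) path \<Rightarrow> 'x" where
  "state_at t \<omega> = fst (\<omega> t)"

definition obs_at :: "nat \<Rightarrow> ('x, 'y, 'u) path \<Rightarrow> 'y" where
  "obs_at t \<omega> = fst (snd (\<omega> t))"

definition action_at :: "nat \<Rightarrow> ('x, 'y, 'u) path \<Rightarrow> 'u" where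
  "action_at t \<omega> = snd (snd (\<omega> t))"

definition admissible :: "'y measure \<Rightarrow> ('y, 'u::topological_space) policy set" where
  "admissible Y = {\<gamma>. \<forall>t. \<gamma> t \<in> PiM {..t} (\<lambda>_. Y) \<Otimes>\<^sub>M PiM {..<t} (\<lambda>_. borel) \<rightarrow>\<^sub>M borel}"

text \<open>The information \<open>I\<^sub>t\<close>, where \<open>\<omega>\<close> is only read before time \<open>t\<close> and \<open>y\<close> is the
  observation at time \<open>t\<close>.\<close>

definition information ::
    "nat \<Rightarrow> ('x, 'y, 'u) path \<Rightarrow> 'y \<Rightarrow> (nat \<Rightarrow> 'y) \<times> (nat \<Rightarrow> 'u)" where
  "information t \<omega> y =
     (\<lambda>i\<in>{..t}. if i < t then obs_at i \<omega> else y, \<lambda>i\<in>{..<t}. action_at i \<omega>)"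

definition stage_algebra ::
    "'y measure \<Rightarrow> ('x::topological_space \<times> 'y \<times> 'u::topological_space) measure" where
  "stage_algebra Y = borel \<Otimes>\<^sub>M Y \<Otimes>\<^sub>M borel"

text \<open>The conditional law of \<open>(X\<^sub>t, Y\<^sub>t, U\<^sub>t)\<close> given the path before time \<open>t\<close>.\<close>

definition stage_law ::
    "'y measure \<Rightarrow> ('x::topological_space \<times> 'u::topological_space \<Rightarrow> 'x measure) \<Rightarrow>
     ('x \<Rightarrow> 'y measure) \<Rightarrow> 'x measure \<Rightarrow> ('y, 'u) policy \<Rightarrow>
     nat \<Rightarrow> ('x, 'y, 'u) path \<Rightarrow> ('x \<times> 'y \<times> 'u) measure" where
  "stage_law Y T Q \<mu> \<gamma> t \<omega> =
     (if t = 0 then \<mu> else T (state_at (t - 1) \<omega>, action_at (t - 1) \<omega>)) \<bind>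
       (\<lambda>x. Q x \<bind> (\<lambda>y. return (stage_algebra Y) (x, y, \<gamma> t (information t \<omega> y))))"

text \<open>The Ionescu-Tulcea measure of the kernels \<^const>\<open>stage_law\<close> on infinite paths.\<close>

definition path_measure ::
    "'y measure \<Rightarrow> ('x::topological_space \<times> 'u::topological_space \<Rightarrow> 'x measure) \<Rightarrow>
     ('x \<Rightarrow> 'y measure) \<Rightarrow> 'x measure \<Rightarrow> ('y, 'u) policy \<Rightarrow> ('x, 'y, 'u) path measure" where
  "path_measure Y T Q \<mu> \<gamma> =
     projective_family.lim UNIV
       (Ionescu_Tulcea.CI (stage_law Y T Q \<mu> \<gamma>) (\<lambda>_. stage_algebra Y)) (\<lambda>_. stage_algebra Y)"

definition average_cost ::
    "'y measure \<Rightarrow> ('x::topological_space \<times> 'u::topological_space \<Rightarrow> 'x measure) \<Rightarrow>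
     ('x \<Rightarrow> 'y measure) \<Rightarrow> ('x \<Rightarrow> 'u \<Rightarrow> real) \<Rightarrow> 'x measure \<Rightarrow> ('y, 'u) policy \<Rightarrow> ereal" where
  "average_cost Y T Q c \<mu> \<gamma> =
     limsup (\<lambda>n. ereal (1 / real n *
       (\<integral>\<omega>. (\<Sum>t<n. c (state_at t \<omega>) (action_at t \<omega>)) \<partial>path_measure Y T Q \<mu> \<gamma>)))"

definition optimal_average_cost ::
    "'y measure \<Rightarrow> ('x::topological_space \<times> 'u::topological_space \<Rightarrow> 'x measure) \<Rightarrow>
     ('x \<Rightarrow> 'y measure) \<Rightarrow> ('x \<Rightarrow> 'u \<Rightarrow> real) \<Rightarrow> 'x measure \<Rightarrow> ereal" where
  "optimal_average_cost Y T Q c \<mu> = (INF \<gamma>\<in>admissible Y. average_cost Y T Q c \<mu> \<gamma>)"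

definition optimal_policy ::
    "'y measure \<Rightarrow> ('x::topological_space \<times> 'u::topological_space \<Rightarrow> 'x measure) \<Rightarrow>
     ('x \<Rightarrow> 'y measure) \<Rightarrow> ('x \<Rightarrow> 'u \<Rightarrow> real) \<Rightarrow> 'x measure \<Rightarrow> ('y, 'u) policy \<Rightarrow> bool" where
  "optimal_policy Y T Q c \<mu> \<gamma> \<longleftrightarrow>
     \<gamma> \<in> admissible Y \<and> average_cost Y T Q c \<mu> \<gamma> = optimal_average_cost Y T Q c \<mu>"


section \<open>The belief MDP\<close>

text \<open>The laws of \<open>X\<^sub>n\<^sub>+\<^sub>1\<close>, of \<open>(X\<^sub>n\<^sub>+\<^sub>1, Y\<^sub>n\<^sub>+\<^sub>1)\<close> and of \<open>Y\<^sub>n\<^sub>+\<^sub>1\<close> given belief \<open>z\<close> and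
  action \<open>u\<close> at time \<open>n\<close>.\<close>

definition next_state_law ::
    "('x \<times> 'u \<Rightarrow> 'x measure) \<Rightarrow> 'x measure \<Rightarrow> 'u \<Rightarrow> 'x measure" where
  "next_state_law T z u = z \<bind> (\<lambda>x. T (x, u))"

definition next_joint_law ::
    "'y measure \<Rightarrow> ('x::topological_space \<times> 'u \<Rightarrow> 'x measure) \<Rightarrow> ('x \<Rightarrow> 'y measure) \<Rightarrow>
     'x measure \<Rightarrow> 'u \<Rightarrow> ('x \<times> 'y) measure" where
  "next_joint_law Y T Q z u =
     next_state_law T z u \<bind> (\<lambda>x. Q x \<bind> (\<lambda>y. return (borel \<Otimes>\<^sub>M Y) (x, y)))"

definition next_obs_law ::
    "('x \<times> 'u \<Rightarrow> 'x measure) \<Rightarrow> ('x \<Rightarrow> 'y measure) \<Rightarrow> 'x measure \<Rightarrow> 'u \<Rightarrow> 'y measure" where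
  "next_obs_law T Q z u = next_state_law T z u \<bind> Q"

text \<open>\<open>F z u y\<close> is a jointly measurable version of the conditional law of \<open>X\<^sub>n\<^sub>+\<^sub>1\<close> given
  \<open>Z\<^sub>n = z\<close>, \<open>U\<^sub>n = u\<close>, \<open>Y\<^sub>n\<^sub>+\<^sub>1 = y\<close>. It is unique up to null sets of \<open>next_obs_law T Q z u\<close>,
  so the kernel \<open>belief_kernel\<close> below does not depend on the version chosen.\<close>

definition filter_version ::
    "'y measure \<Rightarrow> ('x::topological_space \<times> 'u::topological_space \<Rightarrow> 'x measure) \<Rightarrow>
     ('x \<Rightarrow> 'y measure) \<Rightarrow> ('x measure \<Rightarrow> 'u \<Rightarrow> 'y \<Rightarrow> 'x measure) \<Rightarrow> bool" where
  "filter_version Y T Q F \<longleftrightarrow>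
     (\<lambda>(z, u, y). F z u y) \<in> belief_algebra \<Otimes>\<^sub>M borel \<Otimes>\<^sub>M Y \<rightarrow>\<^sub>M belief_algebra \<and>
     (\<forall>z\<in>beliefs. \<forall>u. \<forall>A\<in>sets borel. \<forall>B\<in>sets Y.
        emeasure (next_joint_law Y T Q z u) (A \<times> B) =
          (\<integral>\<^sup>+y\<in>B. emeasure (F z u y) A \<partial>next_obs_law T Q z u))"

definition belief_update ::
    "'y measure \<Rightarrow> ('x::topological_space \<times> 'u::topological_space \<Rightarrow> 'x measure) \<Rightarrow>
     ('x \<Rightarrow> 'y measure) \<Rightarrow> 'x measure \<Rightarrow> 'u \<Rightarrow> 'y \<Rightarrow> 'x measure" where
  "belief_update Y T Q = (SOME F. filter_version Y T Q F)"

definition belief_kernel ::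
    "'y measure \<Rightarrow> ('x::topological_space \<times> 'u::topological_space \<Rightarrow> 'x measure) \<Rightarrow>
     ('x \<Rightarrow> 'y measure) \<Rightarrow> 'x measure \<Rightarrow> 'u \<Rightarrow> 'x measure measure" where
  "belief_kernel Y T Q z u = distr (next_obs_law T Q z u) belief_algebra (belief_update Y T Q z u)"

definition belief_cost :: "('x \<Rightarrow> 'u \<Rightarrow> real) \<Rightarrow> 'x measure \<Rightarrow> 'u \<Rightarrow> real" where
  "belief_cost c z u = (\<integral>x. c x u \<partial>z)"

text \<open>The infimum is taken in \<^typ>\<open>ereal\<close> and integrability is required explicitly because
  infima of unbounded sets of reals and integrals of non-integrable functions have
  arbitrary values.\<close>

definition acoe_solution ::
    "'y measure \<Rightarrow> ('x::topological_space \<times> 'u::topological_space \<Rightarrow> 'x measure) \<Rightarrow>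
     ('x \<Rightarrow> 'y measure) \<Rightarrow> ('x \<Rightarrow> 'u \<Rightarrow> real) \<Rightarrow>
     ('x measure \<Rightarrow> real) \<Rightarrow> ('x measure \<Rightarrow> 'u) \<Rightarrow> real \<Rightarrow> bool" where
  "acoe_solution Y T Q c h g \<rho> \<longleftrightarrow>
     h \<in> belief_algebra \<rightarrow>\<^sub>M borel \<and> g \<in> belief_algebra \<rightarrow>\<^sub>M borel \<and>
     (\<forall>z\<in>beliefs. \<forall>u. integrable (belief_kernel Y T Q z u) h) \<and>
     (\<forall>z\<in>beliefs.
        ereal (h z + \<rho>) =
          (INF u. ereal (belief_cost c z u + (\<integral>z'. h z' \<partial>belief_kernel Y T Q z u))) \<and>
        h z + \<rho> = belief_cost c z (g z) + (\<integral>z'. h z' \<partial>belief_kernel Y T Q z (g z)))"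

end

theory Submission
  imports Defs
begin

text \<open>
  All laws \<open>T(\<cdot>|x, u)\<close> have densities with respect to one probability measure, so a single
  disintegration of it along \<open>Q\<close> turns the filter into Bayes' formula. With the Kantorovich
  metric on beliefs, this formula shows that the belief kernel maps \<open>L\<close>-Lipschitz functions to
  \<open>K\<^sub>2 L\<close>-Lipschitz functions of the belief. Hence the Bellman operator preserves the set
  of \<open>K\<^sub>1 / (1 - K\<^sub>2)\<close>-Lipschitz functions, discounted value iteration yields approximate solutions of the
  optimality equation in it, and these have a uniformly convergent subsequence. Finally, given the
  information \<open>I\<^sub>t\<close>, the state is distributed according to the filter, whatever the policy;
  the equation then telescopes along the path and gives the lower bound \<open>\<rho>\<close> for every policy,
  with equality for a measurable minimizer.
\<close>

section \<open>Disintegration over Polish state spaces\<close>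

text \<open>\<open>belief_kernel\<close> is built from an arbitrarily chosen version of the filter,
  so nothing is known about it pointwise in the observation. The obstacle is to exhibit one version
  that is jointly measurable in belief, action and observation and explicit enough for estimates.
  Disintegrating each predicted law separately would give neither property; posteriors relative to a
  single dominating measure give both, and every other version agrees with them almost surely.

  The constant \<open>K\<^sub>2\<close> is a product of three losses. Two predicted laws under the
  same action differ in L1 by at most \<alpha> times the Kantorovich distance of the beliefs. A
  Lipschitz function, centred at its midpoint, is bounded by half of its constant times the
  diameter. The last factor is due to Bayes' formula and to averaging over the observation. If the
  product is below 1, the recursion L -> K1 + L K2 of Lipschitz constants has a finite fixed point,
  which bounds all discounted iterates whatever the discount factor.

  The initial distribution may be singular to the dominating measure, so the filter along a path
  starts from a disintegration of its own.\<close>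

definition ternary_code :: "(nat \<Rightarrow> bool) \<Rightarrow> real" where
  "ternary_code b = (\<Sum>n. of_bool (b n) * (1/3)^Suc n)"

primrec ternary_shift :: "nat \<Rightarrow> real \<Rightarrow> real" where
  "ternary_shift 0 t = t"
| "ternary_shift (Suc n) t = 3 * ternary_shift n t - of_bool (1 \<le> 3 * ternary_shift n t)"

lemma summable_ternary: "summable (\<lambda>n. of_bool (b n) * (1/3::real)^Suc n)"
  by (rule summable_comparison_test[of _ "\<lambda>n. (1/3)^Suc n"])
     (auto simp: summable_mult intro!: exI[of _ 0] summable_geometric)

lemma ternary_code_bounds: "0 \<le> ternary_code b" "ternary_code b \<le> 1/2"
proof -
  show "0 \<le> ternary_code b"
    unfolding ternary_code_def by (intro suminf_nonneg summable_ternary) auto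
  have "ternary_code b \<le> (\<Sum>n. (1/3) * (1/3)^n)"
    unfolding ternary_code_def
    by (intro suminf_le summable_ternary summable_mult summable_geometric) auto
  also have "\<dots> = 1/2" by (subst suminf_mult) (auto simp: suminf_geometric)
  finally show "ternary_code b \<le> 1/2" .
qed

lemma ternary_code_unfold: "3 * ternary_code b = of_bool (b 0) + ternary_code (\<lambda>n. b (Suc n))"
proof -
  have "ternary_code b = of_bool (b 0) * (1/3) + (\<Sum>n. of_bool (b (Suc n)) * (1/3)^Suc (Suc n))"
    unfolding ternary_code_def using suminf_split_head[OF summable_ternary[of b]] by simp
  also have "(\<Sum>n. of_bool (b (Suc n)) * (1/3)^Suc (Suc n)) = (\<Sum>n. (1/3::real) * (of_bool (b (Suc n)) * (1/3)^Suc n))"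
    by (simp add: mult_ac)
  also have "\<dots> = (1/3) * ternary_code (\<lambda>n. b (Suc n))"
    unfolding ternary_code_def by (rule suminf_mult[OF summable_ternary])
  finally show ?thesis by simp
qed

text \<open>Digits 0 and 1 in base 3 leave a tail of at most 1/2 after the leading digit, so that
  digit can be read off the real number. In base 2 the tail can reach 1 and two digit sequences can
  share a code.\<close>

lemma ternary_digit: "1 \<le> 3 * ternary_code b \<longleftrightarrow> b 0"
  using ternary_code_unfold[of b] ternary_code_bounds[of "\<lambda>n. b (Suc n)"] by (cases "b 0") auto

lemma ternary_shift_code: "ternary_shift n (ternary_code b) = ternary_code (\<lambda>i. b (n + i))"
proof (induction n)
  case (Suc n)
  show ?case
    unfolding ternary_shift.simps Suc.IH ternary_digit by (simp add: ternary_code_unfold)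
qed simp

lemma measurable_ternary_shift [measurable]: "ternary_shift n \<in> borel_measurable borel"
  by (induction n) simp_all

text \<open>A point is coded by the answers to the questions whether the k-th point of a dense
  sequence lies within (1/2)^n of it. Decoding takes, for each n, the first k answered by yes, and
  then the limit. Through this code a disintegration over the real line is carried over to the state
  space.\<close>

lemma polish_borel_retract_of_real:
  obtains s :: "'x::polish_space \<Rightarrow> real" and r :: "real \<Rightarrow> 'x"
  where "s \<in> borel_measurable borel" "r \<in> borel_measurable borel"
    "\<And>x. r (s x) = x" "\<And>x. 0 \<le> s x" "\<And>x. s x < 1"
proof -
  obtain D :: "'x set" where D: "countable D" "\<And>X. open X \<Longrightarrow> X \<noteq> {} \<Longrightarrow> \<exists>d\<in>D. d \<in> X"
    using countable_dense_exists by metis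
  then have "D \<noteq> {}" using D(2)[of UNIV] by auto
  define a where "a = from_nat_into D"
  have a: "\<exists>k. dist x (a k) < e" if "0 < e" for x e
  proof -
    have "ball x e \<noteq> {}" using that by simp
    then obtain d where "d \<in> D" "d \<in> ball x e" using D(2)[of "ball x e"] by auto
    then show ?thesis using from_nat_into_surj[OF D(1)] by (auto simp: a_def)
  qed
  define b where "b x i = (case prod_decode i of (n, k) \<Rightarrow> dist x (a k) < (1/2)^n)" for x i
  define s where "s x = ternary_code (b x)" for x
  define k where "k n t = (LEAST k. 1 \<le> 3 * ternary_shift (prod_encode (n, k)) t)" for n t
  \<comment> \<open>Numbers that code no point may give a sequence without limit. Replacing it by
    the constant \<open>a 0\<close> makes \<open>g n t\<close> converge for every t, so that
    \<open>r\<close> is a limit of measurable functions everywhere.\<close>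
  define g where "g n t = (if Cauchy (\<lambda>n. a (k n t)) then a (k n t) else a 0)" for n t
  define r where "r t = lim (\<lambda>n. g n t)" for t
  have k[measurable]: "k n \<in> borel \<rightarrow>\<^sub>M count_space UNIV" for n
    unfolding k_def by measurable
  have ak[measurable]: "(\<lambda>t. a (k n t)) \<in> borel_measurable borel" for n
    by (rule measurable_compose[OF k]) simp
  have g[measurable]: "g n \<in> borel_measurable borel" for n
    unfolding g_def by measurable
  have conv: "(\<lambda>n. g n t) \<longlonglongrightarrow> r t" for t
    unfolding r_def
    by (rule convergent_LIMSEQ_iff[THEN iffD1, OF Cauchy_convergent]) (cases "Cauchy (\<lambda>n. a (k n t))"; simp add: g_def convergent_Cauchy convergent_const)
  have "s \<in> borel_measurable borel"
  proof -
    have "(\<lambda>x. b x i) \<in> borel \<rightarrow>\<^sub>M count_space UNIV" for i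
      unfolding b_def by (cases "prod_decode i") simp
    then show ?thesis unfolding s_def ternary_code_def by measurable
  qed
  moreover have "r \<in> borel_measurable borel"
    by (rule borel_measurable_LIMSEQ_metric[OF g conv])
  moreover have "r (s x) = x" for x
  proof -
    have k1: "dist x (a (k n (s x))) < (1/2)^n" for n
    proof -
      have "1 \<le> 3 * ternary_shift (prod_encode (n, j)) (s x) \<longleftrightarrow> dist x (a j) < (1/2)^n" for j
        unfolding s_def ternary_shift_code ternary_digit by (simp add: b_def)
      then have "k n (s x) = (LEAST j. dist x (a j) < (1/2)^n)" by (simp add: k_def)
      moreover obtain j where "dist x (a j) < (1/2)^n" using a[of "(1/2)^n" x] by auto
      ultimately show ?thesis using LeastI[of "\<lambda>j. dist x (a j) < (1/2)^n" j] by simp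
    qed
    have lim: "(\<lambda>n. a (k n (s x))) \<longlonglongrightarrow> x"
      by (rule tendsto_dist_iff[THEN iffD2], rule tendsto_sandwich[of "\<lambda>_. 0" _ _ "\<lambda>n. (1/2::real)^n"])
         (use k1 in \<open>auto intro!: always_eventually less_imp_le simp: dist_commute LIMSEQ_power_zero\<close>)
    then have "Cauchy (\<lambda>n. a (k n (s x)))" by (rule LIMSEQ_imp_Cauchy)
    then have "(\<lambda>n. a (k n (s x))) \<longlonglongrightarrow> r (s x)" using conv[of "s x"] by (simp add: g_def)
    then show ?thesis using lim LIMSEQ_unique by blast
  qed
  moreover have "0 \<le> s x" "s x < 1" for x
    using ternary_code_bounds[of "b x"] by (auto simp: s_def)
  ultimately show ?thesis using that by blast
qed

text \<open>Right continuity and monotonicity of this infimum hold for every \<open>g\<close>, which spares a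
  discussion of null sets in the construction of conditional distribution functions.\<close>

lemma real_distribution_INF_rat:
  fixes g :: "real \<Rightarrow> real"
  assumes g: "\<And>r. 0 \<le> g r" "\<And>r. g r \<le> 1" "\<And>r. r < 0 \<Longrightarrow> g r = 0" "\<And>r. 1 \<le> r \<Longrightarrow> g r = 1"
  defines "F \<equiv> \<lambda>t. INF r\<in>{r\<in>\<rat>. t < r}. g r"
  shows "prob_space (interval_measure F)" "\<And>t. emeasure (interval_measure F) {..t} = ennreal (F t)"
proof -
  have ne: "{r\<in>\<rat>. t < r} \<noteq> {}" for t :: real
    using Rats_dense_in_real[of t "t+1"] by auto
  have bdd: "bdd_below (g ` A)" for A using g(1) by (auto intro!: bdd_belowI[of _ 0])
  have F_le: "F t \<le> g r" if "r \<in> \<rat>" "t < r" for t r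
    unfolding F_def by (rule cINF_lower[OF bdd]) (use that in auto)
  have F0: "0 \<le> F t" for t
    unfolding F_def by (rule cINF_greatest[OF ne]) (use g in auto)
  have F1: "F t = 1" if "1 \<le> t" for t
    unfolding F_def using ne[of t] that by (subst INF_cong[OF refl, where D="\<lambda>_. 1"]) (auto intro!: g)
  have Fneg: "F t = 0" if "t < 0" for t
    using F0[of t] F_le[of _ t] g(3) Rats_dense_in_real[OF that] by (metis order_antisym)
  have mono: "F x \<le> F y" if "x \<le> y" for x y
    unfolding F_def by (rule cINF_superset_mono[OF ne bdd]) (use that in auto)
  have rc: "continuous (at_right a) F" for a
    unfolding continuous_within
  proof (rule order_tendstoI)
    fix l assume "l < F a"
    then have "l < F x" if "a < x" for x using mono[of a x] that by linarith
    then show "eventually (\<lambda>x. l < F x) (at_right a)" 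
      by (auto simp: eventually_at_right_field intro!: exI[of _ "a+1"])
  next
    fix u assume "F a < u"
    then obtain r where r: "r \<in> \<rat>" "a < r" "g r < u"
      unfolding F_def using cINF_less_iff[OF ne bdd] by auto
    then have "F x < u" if "x < r" for x using F_le[of r x] that by linarith
    then show "eventually (\<lambda>x. F x < u) (at_right a)"
      using r by (auto simp: eventually_at_right_field intro!: exI[of _ r])
  qed
  have bot: "(F \<longlongrightarrow> 0) at_bot"
    by (rule tendsto_eventually) (use eventually_gt_at_bot[of "0"] Fneg in \<open>auto simp: eventually_at_bot_linorder intro!: exI[of _ "-1"]\<close>)
  have top: "(F \<longlongrightarrow> 1) at_top"
    by (rule tendsto_eventually) (use F1 in \<open>auto simp: eventually_at_top_linorder\<close>)
  interpret R: real_distribution "interval_measure F"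
    by (rule real_distribution_interval_measure[OF mono rc bot top])
  show "prob_space (interval_measure F)" by unfold_locales
  show "emeasure (interval_measure F) {..t} = ennreal (F t)" for t
    using cdf_interval_measure[OF mono rc bot] by (metis R.emeasure_eq_measure cdf_def2)
qed

text \<open>For fixed A, the law of the observation on the event that \<open>s x\<close> lies in A
  is absolutely continuous with respect to the law \<open>m\<close> of the observation; its density
  is a version of the conditional probability of A. The versions for rational half-lines are
  assembled into a distribution function for every y, and half-lines determine all Borel
  sets.\<close>

lemma disintegration_real:
  fixes lam :: "'x measure" and s :: "'x \<Rightarrow> real"
  assumes "prob_space lam"
    and Q[measurable]: "Q \<in> lam \<rightarrow>\<^sub>M prob_algebra Y"
    and s[measurable]: "s \<in> borel_measurable lam" and s01: "\<And>x. 0 \<le> s x" "\<And>x. s x < 1"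
  obtains \<kappa> where "\<kappa> \<in> Y \<rightarrow>\<^sub>M prob_algebra borel"
    "\<And>A B. A \<in> sets borel \<Longrightarrow> B \<in> sets Y \<Longrightarrow>
      (\<integral>\<^sup>+x. indicator A (s x) * emeasure (Q x) B \<partial>lam) = (\<integral>\<^sup>+y. emeasure (\<kappa> y) A * indicator B y \<partial>(lam \<bind> Q))"
proof -
  interpret lam: prob_space lam by fact
  have Q'[measurable]: "Q \<in> lam \<rightarrow>\<^sub>M subprob_algebra Y" by (rule measurable_prob_algebraD[OF Q])
  have QB[measurable]: "(\<lambda>x. emeasure (Q x) B) \<in> borel_measurable lam" if "B \<in> sets Y" for B
    using that by measurable
  have Q1: "emeasure (Q x) B \<le> 1" if "x \<in> space lam" for x B
    using measurable_space[OF Q that] by (auto simp: space_prob_algebra intro: prob_space.measure_le_1)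
  define m where "m = lam \<bind> Q"
  have sets_m[measurable_cong, simp]: "sets m = sets Y"
    unfolding m_def by (rule sets_bind'[OF _ Q]) (auto simp: space_prob_algebra \<open>prob_space lam\<close>)
  interpret m: prob_space m
    unfolding m_def by (rule prob_space_bind'[OF _ Q]) (auto simp: space_prob_algebra \<open>prob_space lam\<close>)
  have em: "emeasure m B = (\<integral>\<^sup>+x. emeasure (Q x) B \<partial>lam)" if "B \<in> sets Y" for B
    unfolding m_def by (rule emeasure_bind[OF lam.not_empty Q' that])
  define N where "N A = density lam (indicator (s -` A \<inter> space lam)) \<bind> Q" for A
  have [measurable]: "s -` A \<inter> space lam \<in> sets lam" if "A \<in> sets borel" for A using that by measurable
  have sets_N[measurable_cong, simp]: "sets (N A) = sets Y" for A
    unfolding N_def using Q' lam.not_empty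
    by (intro sets_bind) (auto simp: sets_kernel[OF Q'])
  have N: "emeasure (N A) B = (\<integral>\<^sup>+x. indicator A (s x) * emeasure (Q x) B \<partial>lam)"
    if "A \<in> sets borel" "B \<in> sets Y" for A B
  proof -
    have "emeasure (N A) B = (\<integral>\<^sup>+x. emeasure (Q x) B \<partial>density lam (indicator (s -` A \<inter> space lam)))"
      unfolding N_def by (rule emeasure_bind) (use lam.not_empty Q' that in auto)
    also have "\<dots> = (\<integral>\<^sup>+x. indicator A (s x) * emeasure (Q x) B \<partial>lam)"
      using that by (subst nn_integral_density) (auto intro!: nn_integral_cong split: split_indicator)
    finally show ?thesis .
  qed
  have ac: "absolutely_continuous m (N A)" if "A \<in> sets borel" for A
    unfolding absolutely_continuous_def
  proof
    fix B assume "B \<in> null_sets m"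
    then have "B \<in> sets Y" "emeasure m B = 0" by auto
    then have B: "B \<in> sets Y" "(\<integral>\<^sup>+x. emeasure (Q x) B \<partial>lam) = 0" using em by simp_all
    have "emeasure (N A) B \<le> (\<integral>\<^sup>+x. emeasure (Q x) B \<partial>lam)"
      unfolding N[OF that B(1)] by (rule nn_integral_mono) (auto split: split_indicator)
    then show "B \<in> null_sets (N A)" using B by (auto simp: null_sets_def)
  qed
  define G where "G A = RN_deriv m (N A)" for A
  have G[measurable]: "G A \<in> borel_measurable Y" for A
    using borel_measurable_RN_deriv[of m "N A"] by (simp add: G_def measurable_cong_sets[OF sets_m refl])
  have dG: "density m (G A) = N A" if "A \<in> sets borel" for A
    unfolding G_def by (rule m.density_RN_deriv[OF ac[OF that]]) simp
  have GN: "(\<integral>\<^sup>+y. G A y * indicator B y \<partial>m) = emeasure (N A) B" if "A \<in> sets borel" "B \<in> sets Y" for A B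
    using that by (simp add: dG[symmetric] emeasure_density)
  \<comment> \<open>By additivity \<open>G A + G (A' - A)\<close> is a density of
    \<open>N A'\<close> as well, and densities are unique almost everywhere.\<close>
  have Gmono: "AE y in m. G A y \<le> G A' y" if A[measurable]: "A \<in> sets borel" "A' \<in> sets borel" and "A \<subseteq> A'" for A A'
  proof -
    have "density m (\<lambda>y. G A y + G (A' - A) y) = N A'"
    proof (rule measure_eqI)
      fix B assume "B \<in> sets (density m (\<lambda>y. G A y + G (A' - A) y))"
      then have [measurable]: "B \<in> sets Y" by simp
      have "emeasure (density m (\<lambda>y. G A y + G (A' - A) y)) B = emeasure (N A) B + emeasure (N (A' - A)) B"
        by (simp add: emeasure_density distrib_right nn_integral_add GN)
      also have "\<dots> = emeasure (N A') B"
        unfolding N[OF A(1) \<open>B \<in> sets Y\<close>] N[OF A(2) \<open>B \<in> sets Y\<close>] N[OF sets.Diff[OF A(2,1)] \<open>B \<in> sets Y\<close>]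
        using \<open>A \<subseteq> A'\<close>
        by (subst nn_integral_add[symmetric]) (auto intro!: nn_integral_cong split: split_indicator)
      finally show "emeasure (density m (\<lambda>y. G A y + G (A' - A) y)) B = emeasure (N A') B" .
    qed simp
    then have "AE y in m. G A y + G (A' - A) y = G A' y"
      unfolding G_def[of A'] by (intro m.RN_deriv_unique) auto
    then show ?thesis by (rule AE_mp) (intro AE_I2 impI, metis le_iff_add)
  qed
  have GU: "AE y in m. 1 = G UNIV y"
    unfolding G_def by (rule m.RN_deriv_unique) (auto intro!: measure_eqI simp: density_1 N em)
  have G0: "AE y in m. 0 = G {} y"
    unfolding G_def by (rule m.RN_deriv_unique) (auto intro!: measure_eqI simp: N emeasure_density)
  \<comment> \<open>The values below 0 and from 1 on are fixed by hand, which agrees with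
    \<open>G\<close> almost everywhere because \<open>s\<close> lies in [0, 1). With them the
    infimum over rationals is a distribution function for every y without exception.\<close>
  define g where "g y r = (if r < 0 then 0 else if 1 \<le> r then 1 else min 1 (enn2real (G {..r} y)))" for y and r :: real
  have gmeas[measurable]: "(\<lambda>y. g y r) \<in> borel_measurable Y" for r unfolding g_def by measurable
  have gG: "AE y in m. ennreal (g y r) = G {..r} y" for r
  proof -
    have N_eq: "N {..r} = N A" if "A \<in> sets borel" "\<And>x. s x \<in> A \<longleftrightarrow> s x \<le> r" for A
      unfolding N_def by (rule arg_cong[where f="\<lambda>X. density lam (indicator X) \<bind> Q"]) (use that in auto)
    consider "r < 0" | "1 \<le> r" | "0 \<le> r" "r < 1" by linarith
    then show ?thesis
    proof cases
      case 1
      have "N {..r} = N {}" by (rule N_eq) (use 1 s01 in \<open>auto simp: not_le intro: less_le_trans\<close>)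
      then have "G {..r} = G {}" by (simp add: G_def)
      then show ?thesis using G0 1 by (simp add: g_def)
    next
      case 2
      have "N {..r} = N UNIV" by (rule N_eq) (use 2 s01 in \<open>auto intro: less_imp_le less_le_trans\<close>)
      then have "G {..r} = G UNIV" by (simp add: G_def)
      then show ?thesis using GU 2 by (simp add: g_def)
    next
      case 3
      have "AE y in m. G {..r} y \<le> G UNIV y" by (rule Gmono) auto
      then show ?thesis using GU
      proof eventually_elim
        case (elim y)
        then have "G {..r} y \<le> 1" by simp
        then show ?case using 3 by (cases "G {..r} y") (auto simp: g_def min_def top_unique)
      qed
    qed
  qed
  define F where "F y t = (INF r\<in>{r\<in>\<rat>. t < r}. g y r)" for y t
  have g01: "0 \<le> g y r" "g y r \<le> 1" "r < 0 \<Longrightarrow> g y r = 0" "1 \<le> r \<Longrightarrow> g y r = 1" for y r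
    by (auto simp: g_def)
  note Fdist = real_distribution_INF_rat[of "g _", OF g01, folded F_def]
  have ne: "{r\<in>\<rat>. t < r} \<noteq> {}" for t :: real
    using Rats_dense_in_real[of t "t+1"] by auto
  have cnt: "countable {r\<in>\<rat>. t < r}" for t :: real
    by (rule countable_subset[OF _ countable_rat]) auto
  have bdd: "bdd_below (g y ` A)" for y A using g01 by (auto intro!: bdd_belowI[of _ 0])
  have Fmeas[measurable]: "(\<lambda>y. F y t) \<in> borel_measurable Y" for t
    unfolding F_def by (rule borel_measurable_cINF[OF cnt]) (auto intro: bdd)
  \<comment> \<open>The upper bound compares \<open>F y t\<close> with a rational in (t, t +
    1/(n+1)) and lets n grow. For the lower bound, almost everywhere all the countably many
    \<open>g y r\<close> with r > t dominate \<open>G {..t} y\<close>.\<close>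
  have FN: "(\<integral>\<^sup>+y. ennreal (F y t) * indicator B y \<partial>m) = emeasure (N {..t}) B" if B[measurable]: "B \<in> sets Y" for t B
  proof (rule antisym)
    \<comment> \<open>For fixed B the mass of B under \<open>N A\<close>, as a function of A, is the
      finite measure \<open>nu\<close> pushed along \<open>s\<close>; this provides continuity from
      above in t.\<close>
    define nu where "nu = density lam (\<lambda>x. emeasure (Q x) B)"
    have [simp, measurable_cong]: "sets nu = sets lam" by (simp add: nu_def)
    have Nnu: "emeasure (N A) B = emeasure nu (s -` A \<inter> space lam)" if "A \<in> sets borel" for A
      using that by (auto simp: N nu_def emeasure_density intro!: nn_integral_cong split: split_indicator)
    have "(\<integral>\<^sup>+y. ennreal (F y t) * indicator B y \<partial>m) \<le> emeasure (N {..t + 1 / Suc n}) B" for n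
    proof -
      obtain r where r: "r \<in> \<rat>" "t < r" "r < t + 1 / Suc n"
        using Rats_dense_in_real[of t "t + 1 / Suc n"] by auto
      have "(\<integral>\<^sup>+y. ennreal (F y t) * indicator B y \<partial>m) \<le> (\<integral>\<^sup>+y. ennreal (g y r) * indicator B y \<partial>m)"
        by (intro nn_integral_mono mult_right_mono ennreal_leI) (auto simp: F_def intro!: cINF_lower[OF bdd] r)
      also have "\<dots> = (\<integral>\<^sup>+y. G {..r} y * indicator B y \<partial>m)"
        by (rule nn_integral_cong_AE) (use gG[of r] in auto)
      also have "\<dots> = emeasure nu (s -` {..r} \<inter> space lam)" using Nnu[of "{..r}"] by (simp add: GN)
      also have "\<dots> \<le> emeasure nu (s -` {..t + 1 / Suc n} \<inter> space lam)"
        by (rule emeasure_mono) (use r in auto)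
      also have "\<dots> = emeasure (N {..t + 1 / Suc n}) B" by (simp add: Nnu)
      finally show ?thesis .
    qed
    moreover have "(\<lambda>n. emeasure (N {..t + 1 / Suc n}) B) \<longlonglongrightarrow> emeasure (N {..t}) B"
    proof -
      have fin: "emeasure nu A \<noteq> \<infinity>" if "A \<in> sets lam" for A
      proof -
        have "emeasure nu A = (\<integral>\<^sup>+x. emeasure (Q x) B * indicator A x \<partial>lam)"
          using that by (simp add: nu_def emeasure_density)
        also have "\<dots> \<le> (\<integral>\<^sup>+x. 1 \<partial>lam)"
          by (rule nn_integral_mono) (auto intro!: Q1 split: split_indicator)
        finally show ?thesis using lam.emeasure_space_1 by (auto simp: top_unique)
      qed
      have "(\<lambda>n. emeasure nu (s -` {..t + 1 / Suc n} \<inter> space lam)) \<longlonglongrightarrow>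
              emeasure nu (\<Inter>n. s -` {..t + 1 / Suc n} \<inter> space lam)"
      proof (rule Lim_emeasure_decseq)
        have "t + 1 / Suc n \<le> t + 1 / Suc m" if "m \<le> n" for m n
          using that by (simp add: frac_le)
        then show "decseq (\<lambda>n. s -` {..t + 1 / Suc n} \<inter> space lam)"
          unfolding decseq_def by (fastforce intro: order_trans)
        show "emeasure nu (s -` {..t + 1 / Suc n} \<inter> space lam) \<noteq> \<infinity>" for n
          by (rule fin) measurable
      qed auto
      also have "(\<Inter>n. s -` {..t + 1 / Suc n} \<inter> space lam) = s -` {..t} \<inter> space lam"
      proof -
        have "s x \<le> t" if "\<forall>n. s x \<le> t + 1 / Suc n" for x
        proof (rule field_le_epsilon)
          fix e :: real assume "0 < e"
          then obtain n where "1 / Suc n < e" by (metis nat_approx_posE)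
          then show "s x \<le> t + e" using that[rule_format, of n] by linarith
        qed
        moreover have "s x \<le> t + 1 / Suc n" if "s x \<le> t" for x n
          using that by (smt (verit) divide_nonneg_pos of_nat_0_less_iff zero_less_Suc)
        ultimately show ?thesis by auto
      qed
      finally show ?thesis by (simp add: Nnu)
    qed
    ultimately show "(\<integral>\<^sup>+y. ennreal (F y t) * indicator B y \<partial>m) \<le> emeasure (N {..t}) B"
      by (intro LIMSEQ_le_const) auto
  next
    have "AE y in m. \<forall>r\<in>{r\<in>\<rat>. t < r}. G {..t} y \<le> ennreal (g y r)"
    proof (rule AE_ball_countable'[OF _ cnt])
      fix r assume "r \<in> {r\<in>\<rat>. t < r}"
      then have "AE y in m. G {..t} y \<le> G {..r} y" by (intro Gmono) auto
      then show "AE y in m. G {..t} y \<le> ennreal (g y r)" using gG[of r] by eventually_elim simp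
    qed
    then have "AE y in m. G {..t} y \<le> ennreal (F y t)"
    proof eventually_elim
      case (elim y)
      then have fin: "G {..t} y < top" using ne[of t]
        by (metis (no_types, lifting) ennreal_less_top ex_in_conv le_less_trans)
      have "enn2real (G {..t} y) \<le> g y r" if "r \<in> {r\<in>\<rat>. t < r}" for r
        using elim that g01(1)[of y r] by (metis enn2real_mono enn2real_ennreal ennreal_less_top)
      then have "enn2real (G {..t} y) \<le> F y t" unfolding F_def by (rule cINF_greatest[OF ne])
      then show ?case using fin by (metis ennreal_enn2real ennreal_leI)
    qed
    then have "(\<integral>\<^sup>+y. G {..t} y * indicator B y \<partial>m) \<le> (\<integral>\<^sup>+y. ennreal (F y t) * indicator B y \<partial>m)"
      by (intro nn_integral_mono_AE) (auto elim!: eventually_mono intro: mult_right_mono)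
    then show "emeasure (N {..t}) B \<le> (\<integral>\<^sup>+y. ennreal (F y t) * indicator B y \<partial>m)" by (simp add: GN)
  qed
  define \<kappa> where "\<kappa> y = interval_measure (F y)" for y
  have \<kappa>[measurable]: "\<kappa> \<in> Y \<rightarrow>\<^sub>M prob_algebra borel"
  proof (rule measurable_prob_algebra_generated[where G="range (\<lambda>t::real. {..t})" and \<Omega>=UNIV])
    show "sets borel = sigma_sets UNIV (range (\<lambda>t::real. {..t}))"
      by (metis borel_eq_atMost sets_measure_of top_greatest Pow_UNIV)
    show "Int_stable (range (\<lambda>t::real. {..t}))" by (auto simp: Int_stable_def)
    fix A assume "A \<in> range (\<lambda>t::real. {..t})"
    then obtain t where [simp]: "A = {..t}" by auto
    have "(\<lambda>y. ennreal (F y t)) \<in> borel_measurable Y" by measurable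
    then show "(\<lambda>y. emeasure (\<kappa> y) A) \<in> borel_measurable Y" by (simp add: \<kappa>_def Fdist)
  qed (auto simp: \<kappa>_def Fdist)
  have "(\<integral>\<^sup>+x. indicator A (s x) * emeasure (Q x) B \<partial>lam) = (\<integral>\<^sup>+y. emeasure (\<kappa> y) A * indicator B y \<partial>m)"
    if A: "A \<in> sets borel" and B[measurable]: "B \<in> sets Y" for A B
  proof -
    \<comment> \<open>As functions of A both sides are finite measures, so agreement on half-lines
      suffices.\<close>
    define M1 where "M1 = distr (density lam (\<lambda>x. emeasure (Q x) B)) borel s"
    define M2 where "M2 = density m (indicator B) \<bind> \<kappa>"
    have \<kappa>'[measurable]: "\<kappa> \<in> Y \<rightarrow>\<^sub>M subprob_algebra borel" by (rule measurable_prob_algebraD[OF \<kappa>])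
    have [simp]: "sets M2 = sets borel" unfolding M2_def
      by (rule sets_bind) (use m.not_empty in \<open>auto simp: sets_kernel[OF \<kappa>'] sets_eq_imp_space_eq[OF sets_m]\<close>)
    have M1: "emeasure M1 A = (\<integral>\<^sup>+x. indicator A (s x) * emeasure (Q x) B \<partial>lam)" if [measurable]: "A \<in> sets borel" for A
      by (auto simp: M1_def emeasure_distr emeasure_density mult.commute intro!: nn_integral_cong split: split_indicator)
    have M2: "emeasure M2 A = (\<integral>\<^sup>+y. emeasure (\<kappa> y) A * indicator B y \<partial>m)" if [measurable]: "A \<in> sets borel" for A
    proof -
      have "emeasure M2 A = (\<integral>\<^sup>+y. emeasure (\<kappa> y) A \<partial>density m (indicator B))"
        unfolding M2_def by (rule emeasure_bind[where N=borel]) (use m.not_empty that in auto)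
      also have "\<dots> = (\<integral>\<^sup>+y. emeasure (\<kappa> y) A * indicator B y \<partial>m)"
        by (subst nn_integral_density) (auto simp: mult.commute)
      finally show ?thesis .
    qed
    have eq: "emeasure M1 {..t} = emeasure M2 {..t}" for t
      using FN[OF B, of t] by (simp add: M1 M2 N \<kappa>_def Fdist)
    have "M1 = M2"
    proof (rule measure_eqI_generator_eq[where E="range (\<lambda>t::real. {..t})" and \<Omega>=UNIV and A="\<lambda>n. {..real n}"])
      show "Int_stable (range (\<lambda>t::real. {..t}))" by (auto simp: Int_stable_def)
      have "sets borel = sigma_sets UNIV (range (\<lambda>t::real. {..t}))"
        by (metis borel_eq_atMost sets_measure_of top_greatest Pow_UNIV)
      then show "sets M1 = sigma_sets UNIV (range (\<lambda>t::real. {..t}))" "sets M2 = sigma_sets UNIV (range (\<lambda>t::real. {..t}))"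
        by (simp_all add: M1_def)
      show "(\<Union>i. {..real i}) = UNIV" using real_arch_simple by auto
      show "emeasure M1 {..real i} \<noteq> \<infinity>" for i
      proof -
        have "emeasure M1 {..real i} = (\<integral>\<^sup>+x. indicator {..real i} (s x) * emeasure (Q x) B \<partial>lam)"
          by (rule M1) simp
        also have "\<dots> \<le> (\<integral>\<^sup>+x. 1 \<partial>lam)"
          by (rule nn_integral_mono) (auto intro!: Q1 split: split_indicator)
        finally show ?thesis using lam.emeasure_space_1 by (auto simp: top_unique)
      qed
    qed (use eq in auto)
    then show ?thesis using M1[OF A] M2[OF A] by simp
  qed
  then show ?thesis using that[OF \<kappa>] unfolding m_def by blast
qed

text \<open>Pushing the conditional laws of the code \<open>s x\<close> forward along the decoder
  \<open>r\<close> gives those of x, because \<open>r (s x) = x\<close>.\<close>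

theorem disintegration:
  fixes lam :: "'x::polish_space measure"
  assumes lam: "lam \<in> space (prob_algebra borel)" and Q: "Q \<in> borel \<rightarrow>\<^sub>M prob_algebra Y"
  obtains \<kappa> where "\<kappa> \<in> Y \<rightarrow>\<^sub>M prob_algebra borel"
    "\<And>A B. A \<in> sets borel \<Longrightarrow> B \<in> sets Y \<Longrightarrow>
      (\<integral>\<^sup>+x. indicator A x * emeasure (Q x) B \<partial>lam) = (\<integral>\<^sup>+y. emeasure (\<kappa> y) A * indicator B y \<partial>(lam \<bind> Q))"
proof -
  obtain s :: "'x \<Rightarrow> real" and r where s[measurable]: "s \<in> borel_measurable borel" and r[measurable]: "r \<in> borel_measurable borel"
    and rs: "\<And>x. r (s x) = x" and s01: "\<And>x. 0 \<le> s x" "\<And>x. s x < 1"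
    using polish_borel_retract_of_real by metis
  have sets_lam: "sets lam = sets borel" and "prob_space lam" using lam by (auto simp: space_prob_algebra)
  obtain \<kappa>0 where \<kappa>0[measurable]: "\<kappa>0 \<in> Y \<rightarrow>\<^sub>M prob_algebra borel"
    and eq: "\<And>A B. A \<in> sets borel \<Longrightarrow> B \<in> sets Y \<Longrightarrow>
      (\<integral>\<^sup>+x. indicator A (s x) * emeasure (Q x) B \<partial>lam) = (\<integral>\<^sup>+y. emeasure (\<kappa>0 y) A * indicator B y \<partial>(lam \<bind> Q))"
    by (rule disintegration_real[OF \<open>prob_space lam\<close>, of Q Y s])
       (use Q s s01 in \<open>auto simp: measurable_cong_sets[OF sets_lam refl]\<close>)
  have m: "sets (lam \<bind> Q) = sets Y" by (rule sets_bind'[OF lam Q])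
  show ?thesis
  proof (rule that[of "\<lambda>y. distr (\<kappa>0 y) borel r"])
    show "(\<lambda>y. distr (\<kappa>0 y) borel r) \<in> Y \<rightarrow>\<^sub>M prob_algebra borel" by measurable
    fix A :: "'x set" and B assume A[measurable]: "A \<in> sets borel" and B: "B \<in> sets Y"
    have "r -` A \<in> sets borel" using measurable_sets[OF r A] by simp
    from eq[OF this B] have "(\<integral>\<^sup>+x. indicator A x * emeasure (Q x) B \<partial>lam) =
        (\<integral>\<^sup>+y. emeasure (\<kappa>0 y) (r -` A) * indicator B y \<partial>(lam \<bind> Q))"
      by (simp add: indicator_vimage rs)
    also have "\<dots> = (\<integral>\<^sup>+y. emeasure (distr (\<kappa>0 y) borel r) A * indicator B y \<partial>(lam \<bind> Q))"
    proof (intro nn_integral_cong)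
      fix y assume "y \<in> space (lam \<bind> Q)"
      then have "y \<in> space Y" using sets_eq_imp_space_eq[OF m] by simp
      then have "sets (\<kappa>0 y) = sets borel" using measurable_space[OF \<kappa>0] by (auto simp: space_prob_algebra)
      then show "emeasure (\<kappa>0 y) (r -` A) * indicator B y = emeasure (distr (\<kappa>0 y) borel r) A * indicator B y"
        using r by (subst emeasure_distr)
          (simp_all add: measurable_cong_sets[of "\<kappa>0 y" borel, OF _ refl] sets_eq_imp_space_eq[of "\<kappa>0 y" borel])
    qed
    finally show "(\<integral>\<^sup>+x. indicator A x * emeasure (Q x) B \<partial>lam) = (\<integral>\<^sup>+y. emeasure (distr (\<kappa>0 y) borel r) A * indicator B y \<partial>(lam \<bind> Q))" .
  qed
qed

section \<open>The Kantorovich metric on beliefs\<close>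

text \<open>Centring at the middle of the range halves the sup bound. The contraction estimate uses
  this three times: for Lipschitz test functions, for the function of the belief, and for the
  observation channel evaluated at a set.\<close>

lemma exists_midpoint:
  fixes h :: "'a \<Rightarrow> real"
  assumes "\<And>a b. a \<in> A \<Longrightarrow> b \<in> A \<Longrightarrow> \<bar>h a - h b\<bar> \<le> d"
  shows "\<exists>c. \<forall>a\<in>A. \<bar>h a - c\<bar> \<le> d / 2"
proof (cases "A = {}")
  case False
  then obtain a0 where a0: "a0 \<in> A" by auto
  have bdd: "bdd_above (h ` A)" "bdd_below (h ` A)"
    using assms[OF _ a0] by (auto intro!: bdd_aboveI[of _ "h a0 + d"] bdd_belowI[of _ "h a0 - d"] simp: abs_le_iff) (smt (verit))+
  have ne: "h ` A \<noteq> {}" using False by auto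
  have "h a - d \<le> Inf (h ` A)" if "a \<in> A" for a
    by (rule cINF_greatest[OF False]) (use assms[OF that] in \<open>auto simp: abs_le_iff\<close>, (smt (verit))+)
  then have "Sup (h ` A) \<le> Inf (h ` A) + d"
    by (intro cSUP_least[OF False]) (smt (verit))
  moreover have "Inf (h ` A) \<le> h a" "h a \<le> Sup (h ` A)" if "a \<in> A" for a
    using that bdd by (auto intro: cINF_lower cSUP_upper)
  ultimately show ?thesis
    by (intro exI[of _ "(Sup (h ` A) + Inf (h ` A)) / 2"]) (auto simp: abs_le_iff field_simps, (smt (verit))+)
qed simp

text \<open>Turns a quantisation with finitely many values into a finite net.\<close>

lemma finite_image_representatives:
  assumes "finite (q ` A)"
  obtains N where "finite N" "N \<subseteq> A" "\<And>a. a \<in> A \<Longrightarrow> \<exists>b\<in>N. q b = q a"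
  using finite_subset_image[OF assms, of q A] by (metis imageE imageI subset_refl)

lemma finite_floor_image:
  fixes f :: "'a \<Rightarrow> real"
  assumes "\<And>a. a \<in> A \<Longrightarrow> \<bar>f a\<bar> \<le> B" "0 < e"
  shows "finite ((\<lambda>a. \<lfloor>f a / e\<rfloor>) ` A)"
proof (rule finite_subset)
  show "(\<lambda>a. \<lfloor>f a / e\<rfloor>) ` A \<subseteq> {\<lfloor>- B / e\<rfloor>..\<lfloor>B / e\<rfloor>}"
  proof safe
    fix a assume "a \<in> A"
    then have "- B / e \<le> f a / e" "f a / e \<le> B / e"
      using assms(1)[of a] \<open>0 < e\<close> by (intro divide_right_mono; simp add: abs_le_iff)+
    then show "\<lfloor>f a / e\<rfloor> \<in> {\<lfloor>- B / e\<rfloor>..\<lfloor>B / e\<rfloor>}" by (auto intro: floor_mono)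
  qed
qed simp

lemma floor_eq_imp_close:
  fixes a b e :: real
  assumes "\<lfloor>a / e\<rfloor> = \<lfloor>b / e\<rfloor>" "0 < e"
  shows "\<bar>a - b\<bar> \<le> e"
proof -
  have "\<bar>a / e - b / e\<bar> \<le> 1" using assms(1) by linarith
  then have "\<bar>(a - b) / e\<bar> \<le> 1" by (simp add: diff_divide_distrib)
  then show ?thesis using \<open>0 < e\<close> by (simp add: abs_divide)
qed

section \<open>Beliefs and their integrals\<close>

lemma beliefs_eq: "beliefs = space (prob_algebra borel)"
  by (auto simp: beliefs_def space_prob_algebra)

lemma beliefsD:
  assumes "z \<in> beliefs"
  shows "prob_space z" "sets z = sets borel" "space z = UNIV"
  using assms sets_eq_imp_space_eq[of z borel] by (auto simp: beliefs_def)

lemma belief_integrable: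
  fixes f :: "'x::topological_space \<Rightarrow> real"
  assumes z: "z \<in> beliefs" and f: "f \<in> borel_measurable borel" and b: "\<And>x. \<bar>f x\<bar> \<le> B"
  shows "integrable z f"
proof -
  interpret prob_space z by (rule beliefsD[OF z])
  show ?thesis using f b
    by (intro integrable_const_bound[of _ B]) (auto simp: measurable_cong_sets[OF beliefsD(2)[OF z] refl])
qed

text \<open>The additive constant is carried along because finitely many functions can approximate
  all 1-Lipschitz ones only up to constants.\<close>

lemma belief_integral_close:
  fixes f :: "'x::topological_space \<Rightarrow> real"
  assumes z: "z \<in> beliefs" and f: "integrable z f" and g: "integrable z g" and b: "\<And>x. \<bar>f x - (g x + c)\<bar> \<le> B"
  shows "\<bar>(\<integral>x. f x \<partial>z) - ((\<integral>x. g x \<partial>z) + c)\<bar> \<le> B"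
proof -
  interpret prob_space z by (rule beliefsD[OF z])
  have "(\<integral>x. f x \<partial>z) - ((\<integral>x. g x \<partial>z) + c) = (\<integral>x. f x - (g x + c) \<partial>z)"
    using f g by (simp add: prob_space)
  also have "\<bar>\<dots>\<bar> \<le> (\<integral>x. \<bar>f x - (g x + c)\<bar> \<partial>z)" by (rule integral_abs_bound)
  also have "\<dots> \<le> (\<integral>x. B \<partial>z)"
    by (rule integral_mono) (use f g b in auto)
  also have "\<dots> = B" by (simp add: prob_space)
  finally show ?thesis .
qed

definition lip1 :: "('x::metric_space \<Rightarrow> real) set" where
  "lip1 = {f. \<forall>x y. \<bar>f x - f y\<bar> \<le> dist x y}"

text \<open>The dual form of the Wasserstein distance of order one. On beliefs over a compact state
  space the supremum is finite, being at most the diameter.\<close>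

definition kant :: "'x::metric_space measure \<Rightarrow> 'x measure \<Rightarrow> real" where
  "kant z z' = (SUP f\<in>lip1. \<bar>(\<integral>x. f x \<partial>z) - (\<integral>x. f x \<partial>z')\<bar>)"

lemma lipschitz_imp_continuous:
  fixes f :: "'a::metric_space \<Rightarrow> real"
  assumes "\<And>x y. \<bar>f x - f y\<bar> \<le> L * dist x y"
  shows "continuous_on UNIV f"
proof (rule lipschitz_on_continuous_on[of "max L 0"])
  show "(max L 0)-lipschitz_on UNIV f"
  proof (rule lipschitz_onI)
    fix x y :: 'a
    have "L * dist x y \<le> max L 0 * dist x y" by (rule mult_right_mono) auto
    then show "dist (f x) (f y) \<le> max L 0 * dist x y" using assms[of x y] by (simp add: dist_real_def)
  qed simp
qed

lemma kant_sym: "kant z z' = kant z' z"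
  by (simp add: kant_def abs_minus_commute)

lemma zero_in_lip1: "(\<lambda>_. 0) \<in> lip1"
  by (simp add: lip1_def)

context
  assumes compactX: "compact (UNIV :: 'x::polish_space set)"
begin

lemma dist_le_diameter: "dist x (y::'x) \<le> diameter (UNIV :: 'x set)"
  by (rule diameter_bounded_bound[OF compact_imp_bounded[OF compactX]]) auto

lemma continuous_bounded:
  fixes f :: "'x \<Rightarrow> real"
  assumes "continuous_on UNIV f"
  obtains B where "\<And>x. \<bar>f x\<bar> \<le> B"
  using compact_imp_bounded[OF compact_continuous_image[OF assms compactX]]
  by (auto simp: bounded_iff)

lemma continuous_integrable:
  fixes f :: "'x \<Rightarrow> real"
  assumes "continuous_on UNIV f" "z \<in> beliefs"
  shows "integrable z f"
  using continuous_bounded[OF assms(1)] belief_integrable[OF assms(2) borel_measurable_continuous_onI[OF assms(1)]]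
  by metis

lemma lip1_continuous: "f \<in> lip1 \<Longrightarrow> continuous_on UNIV (f :: 'x \<Rightarrow> real)"
  by (rule lipschitz_imp_continuous[of f 1]) (auto simp: lip1_def)

lemma lip1_integrable: "f \<in> lip1 \<Longrightarrow> z \<in> beliefs \<Longrightarrow> integrable z (f :: 'x \<Rightarrow> real)"
  by (rule continuous_integrable[OF lip1_continuous])

lemma lip1_midpoint:
  fixes f :: "'x \<Rightarrow> real"
  assumes "f \<in> lip1"
  obtains c where "\<And>x. \<bar>f x - c\<bar> \<le> diameter (UNIV :: 'x set) / 2"
proof -
  have "\<bar>f x - f y\<bar> \<le> diameter (UNIV :: 'x set)" for x y
    using assms dist_le_diameter[of x y] unfolding lip1_def by (auto intro: order_trans)
  then show ?thesis using exists_midpoint[of UNIV f "diameter (UNIV :: 'x set)"] that by auto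
qed

lemma lip1_integral_diff_le:
  fixes f :: "'x \<Rightarrow> real"
  assumes f: "f \<in> lip1" and z: "z \<in> beliefs" "z' \<in> beliefs"
  shows "\<bar>(\<integral>x. f x \<partial>z) - (\<integral>x. f x \<partial>z')\<bar> \<le> diameter (UNIV :: 'x set)"
proof -
  obtain c where c: "\<And>x. \<bar>f x - c\<bar> \<le> diameter (UNIV :: 'x set) / 2" by (rule lip1_midpoint[OF f]) blast
  have "\<bar>(\<integral>x. f x \<partial>z) - c\<bar> \<le> diameter (UNIV :: 'x set) / 2" if "z \<in> beliefs" for z
    using belief_integral_close[OF that lip1_integrable[OF f that] integrable_zero, of c "diameter (UNIV :: 'x set) / 2"] c by simp
  from this[OF z(1)] this[OF z(2)] show ?thesis by linarith
qed

lemma kant_ge: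
  fixes f :: "'x \<Rightarrow> real"
  assumes f: "f \<in> lip1" and z: "z \<in> beliefs" "z' \<in> beliefs"
  shows "\<bar>(\<integral>x. f x \<partial>z) - (\<integral>x. f x \<partial>z')\<bar> \<le> kant z z'"
  unfolding kant_def
  by (rule cSUP_upper[OF f]) (auto intro!: bdd_aboveI2 lip1_integral_diff_le[OF _ z])

lemma kant_le:
  assumes "\<And>f :: 'x \<Rightarrow> real. f \<in> lip1 \<Longrightarrow> \<bar>(\<integral>x. f x \<partial>z) - (\<integral>x. f x \<partial>z')\<bar> \<le> e"
  shows "kant z z' \<le> e"
  unfolding kant_def by (rule cSUP_least) (use assms zero_in_lip1 in auto)

lemma kant_nonneg: "z \<in> beliefs \<Longrightarrow> z' \<in> beliefs \<Longrightarrow> 0 \<le> kant z (z' :: 'x measure)"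
  using kant_ge[OF zero_in_lip1, of z z'] by simp

lemma kant_le_diameter: "z \<in> beliefs \<Longrightarrow> z' \<in> beliefs \<Longrightarrow> kant z (z' :: 'x measure) \<le> diameter (UNIV :: 'x set)"
  by (rule kant_le, rule lip1_integral_diff_le)

lemma kant_triangle:
  assumes "z \<in> beliefs" "z' \<in> beliefs" "z'' \<in> beliefs"
  shows "kant z z'' \<le> kant z z' + kant z' (z'' :: 'x measure)"
proof (rule kant_le)
  fix f :: "'x \<Rightarrow> real" assume "f \<in> lip1"
  then show "\<bar>(\<integral>x. f x \<partial>z) - (\<integral>x. f x \<partial>z'')\<bar> \<le> kant z z' + kant z' z''"
    using kant_ge[of f z z'] kant_ge[of f z' z''] assms by linarith
qed

lemma lipschitz_integral_diff_le:
  fixes f :: "'x \<Rightarrow> real"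
  assumes f: "\<And>x y. \<bar>f x - f y\<bar> \<le> L * dist x y" and "0 \<le> L" and z: "z \<in> beliefs" "z' \<in> beliefs"
  shows "\<bar>(\<integral>x. f x \<partial>z) - (\<integral>x. f x \<partial>z')\<bar> \<le> L * kant z z'"
proof (cases "L = 0")
  case True
  then have "f = (\<lambda>_. f undefined)" using f by (metis abs_le_zero_iff eq_iff_diff_eq_0 mult_zero_left)
  then have "(\<integral>x. f x \<partial>z) = f undefined" if "z \<in> beliefs" for z
    using prob_space.prob_space[OF beliefsD(1)[OF that]] by (metis lebesgue_integral_const scaleR_one)
  then show ?thesis using z True by simp
next
  case False
  then have "0 < L" using \<open>0 \<le> L\<close> by simp
  then have "(\<lambda>x. f x / L) \<in> lip1"
    using f by (auto simp: lip1_def diff_divide_distrib[symmetric] abs_divide field_simps)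
  from kant_ge[OF this z] show ?thesis
    using \<open>0 < L\<close> by (simp add: diff_divide_distrib[symmetric] abs_divide field_simps)
qed

text \<open>A quantitative Arzela-Ascoli theorem. Up to a constant, a 1-Lipschitz function is
  determined with error 3d by its increments from a base point to the points of a d-net, rounded to
  multiples of d, and only finitely many roundings occur. Increments are bounded by the diameter,
  while the functions themselves are unbounded as a family; this is where the additive constant
  comes from.\<close>

lemma lip1_finite_net:
  assumes "0 < e"
  obtains S where "finite S" "S \<subseteq> lip1"
    "\<And>f :: 'x \<Rightarrow> real. f \<in> lip1 \<Longrightarrow> \<exists>g\<in>S. \<exists>c. \<forall>x. \<bar>f x - (g x + c)\<bar> \<le> e"
proof -
  let ?D = "diameter (UNIV :: 'x set)"
  \<comment> \<open>One d for the rounding and one for each of the two functions on the way to a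
    nearby net point.\<close>
  define d where "d = e / 3"
  have "0 < d" using assms by (simp add: d_def)
  obtain N :: "'x set" where N: "finite N" "\<And>x. \<exists>y\<in>N. dist y x < d"
    using compactX[unfolded compact_eq_totally_bounded] \<open>0 < d\<close> by (auto simp: subset_eq Bex_def)
  define a :: 'x where "a = undefined"
  define q where "q f = (\<lambda>x\<in>N. \<lfloor>(f x - f a) / d\<rfloor>)" for f :: "'x \<Rightarrow> real"
  have "q ` lip1 \<subseteq> PiE N (\<lambda>x. (\<lambda>f. \<lfloor>(f x - f a) / d\<rfloor>) ` lip1)"
    by (auto simp: q_def)
  moreover have "finite (PiE N (\<lambda>x. (\<lambda>f :: 'x \<Rightarrow> real. \<lfloor>(f x - f a) / d\<rfloor>) ` lip1))"
  proof (intro finite_PiE N finite_floor_image[where B="?D"] \<open>0 < d\<close>)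
    fix x and f :: "'x \<Rightarrow> real" assume "f \<in> lip1"
    then show "\<bar>f x - f a\<bar> \<le> ?D" using dist_le_diameter[of x a] by (auto simp: lip1_def intro: order_trans)
  qed
  ultimately have "finite (q ` lip1)" by (rule finite_subset)
  then obtain S where S: "finite S" "S \<subseteq> lip1" "\<And>f. f \<in> lip1 \<Longrightarrow> \<exists>g\<in>S. q g = q f"
    by (rule finite_image_representatives) blast
  show ?thesis
  proof (rule that[OF S(1,2)])
    fix f :: "'x \<Rightarrow> real" assume f: "f \<in> lip1"
    then obtain g where g: "g \<in> S" "q g = q f" using S(3) by blast
    then have g1: "g \<in> lip1" using S(2) by auto
    have "\<bar>f x - (g x + (f a - g a))\<bar> \<le> e" for x
    proof -
      obtain y where y: "y \<in> N" "dist y x < d" using N(2) by blast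
      have "\<lfloor>(g y - g a) / d\<rfloor> = \<lfloor>(f y - f a) / d\<rfloor>"
        using fun_cong[OF g(2), of y] y(1) by (simp add: q_def)
      then have "\<bar>(g y - g a) - (f y - f a)\<bar> \<le> d" by (rule floor_eq_imp_close[OF _ \<open>0 < d\<close>])
      moreover have "\<bar>f y - f x\<bar> \<le> d" "\<bar>g y - g x\<bar> \<le> d"
        using f g1 y(2) unfolding lip1_def by (smt (verit, best) mem_Collect_eq)+
      ultimately show ?thesis unfolding d_def by linarith
    qed
    then show "\<exists>g\<in>S. \<exists>c. \<forall>x. \<bar>f x - (g x + c)\<bar> \<le> e" using g(1) by blast
  qed
qed

text \<open>The constants cancel because both measures have mass 1; the approximation error is paid
  once for each measure.\<close>

lemma kant_le_of_net:
  fixes S :: "('x \<Rightarrow> real) set"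
  assumes S: "S \<subseteq> lip1" "\<And>f :: 'x \<Rightarrow> real. f \<in> lip1 \<Longrightarrow> \<exists>g\<in>S. \<exists>c. \<forall>x. \<bar>f x - (g x + c)\<bar> \<le> e"
    and z: "z \<in> beliefs" "z' \<in> beliefs"
    and r: "\<And>g. g \<in> S \<Longrightarrow> \<bar>(\<integral>x. g x \<partial>z) - (\<integral>x. g x \<partial>z')\<bar> \<le> r"
  shows "kant z z' \<le> r + 2 * e"
proof (rule kant_le)
  fix f :: "'x \<Rightarrow> real" assume f: "f \<in> lip1"
  obtain g c where g: "g \<in> S" "\<And>x. \<bar>f x - (g x + c)\<bar> \<le> e" using S(2)[OF f] by blast
  have g1: "g \<in> lip1" using g S by auto
  have "\<bar>(\<integral>x. f x \<partial>z) - ((\<integral>x. g x \<partial>z) + c)\<bar> \<le> e" if "z \<in> beliefs" for z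
    by (rule belief_integral_close[OF that lip1_integrable[OF f that] lip1_integrable[OF g1 that] g(2)])
  from this[OF z(1)] this[OF z(2)] r[OF g(1)]
  show "\<bar>(\<integral>x. f x \<partial>z) - (\<integral>x. f x \<partial>z')\<bar> \<le> r + 2 * e" by linarith
qed

text \<open>The nets for the accuracies 1/(n+1) together form a countable set of test functions that
  exhausts the supremum. It turns a Kantorovich ball into a countable intersection of measurable
  conditions.\<close>

lemma kant_countable:
  obtains S :: "('x \<Rightarrow> real) set" where "countable S" "S \<subseteq> lip1"
    "\<And>z z' r. z \<in> beliefs \<Longrightarrow> z' \<in> beliefs \<Longrightarrow>
       kant z z' \<le> r \<longleftrightarrow> (\<forall>g\<in>S. \<bar>(\<integral>x. g x \<partial>z) - (\<integral>x. g x \<partial>z')\<bar> \<le> r)"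
proof -
  have "\<forall>n::nat. \<exists>S :: ('x \<Rightarrow> real) set. finite S \<and> S \<subseteq> lip1 \<and>
      (\<forall>f\<in>lip1. \<exists>g\<in>S. \<exists>c. \<forall>x. \<bar>f x - (g x + c)\<bar> \<le> 1 / Suc n)"
  proof
    show "\<exists>S :: ('x \<Rightarrow> real) set. finite S \<and> S \<subseteq> lip1 \<and>
      (\<forall>f\<in>lip1. \<exists>g\<in>S. \<exists>c. \<forall>x. \<bar>f x - (g x + c)\<bar> \<le> 1 / Suc n)" for n :: nat
      by (rule lip1_finite_net[of "1 / Suc n"]; (simp; fail)?) blast
  qed
  then obtain S :: "nat \<Rightarrow> ('x \<Rightarrow> real) set" where "\<forall>n. finite (S n) \<and> S n \<subseteq> lip1 \<and>
      (\<forall>f\<in>lip1. \<exists>g\<in>S n. \<exists>c. \<forall>x. \<bar>f x - (g x + c)\<bar> \<le> 1 / Suc n)"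
    unfolding choice_iff ..
  then have S: "\<And>n. finite (S n)" "\<And>n. S n \<subseteq> lip1"
    "\<And>n f. f \<in> lip1 \<Longrightarrow> \<exists>g\<in>S n. \<exists>c. \<forall>x. \<bar>f x - (g x + c)\<bar> \<le> 1 / Suc n"
    by auto
  show ?thesis
  proof (rule that[of "\<Union>n. S n"])
    fix z z' :: "'x measure" and r assume z: "z \<in> beliefs" "z' \<in> beliefs"
    show "kant z z' \<le> r \<longleftrightarrow> (\<forall>g\<in>\<Union>n. S n. \<bar>(\<integral>x. g x \<partial>z) - (\<integral>x. g x \<partial>z')\<bar> \<le> r)"
    proof
      assume "kant z z' \<le> r"
      then show "\<forall>g\<in>\<Union>n. S n. \<bar>(\<integral>x. g x \<partial>z) - (\<integral>x. g x \<partial>z')\<bar> \<le> r"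
        using S(2) kant_ge[OF _ z] by (meson UN_E order_trans subsetD)
    next
      assume *: "\<forall>g\<in>\<Union>n. S n. \<bar>(\<integral>x. g x \<partial>z) - (\<integral>x. g x \<partial>z')\<bar> \<le> r"
      show "kant z z' \<le> r"
      proof (rule field_le_epsilon)
        fix e :: real assume "0 < e"
        then obtain n where n: "1 / Suc n < e / 2" by (meson half_gt_zero nat_approx_posE)
        have "kant z z' \<le> r + 2 * (1 / Suc n)"
          by (rule kant_le_of_net[OF S(2) S(3) z]) (use * in auto)
        then show "kant z z' \<le> r + e" using n by linarith
      qed
    qed
  qed (use S in \<open>auto intro: countable_finite\<close>)
qed

lemma kant_cball_measurable:
  assumes "z0 \<in> beliefs"
  shows "{z \<in> beliefs. kant z0 (z :: 'x measure) \<le> r} \<in> sets (prob_algebra borel)"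
proof -
  obtain S :: "('x \<Rightarrow> real) set" where S: "countable S" "S \<subseteq> lip1"
    "\<And>z z' r. z \<in> beliefs \<Longrightarrow> z' \<in> beliefs \<Longrightarrow>
       kant z z' \<le> r \<longleftrightarrow> (\<forall>g\<in>S. \<bar>(\<integral>x. g x \<partial>z) - (\<integral>x. g x \<partial>z')\<bar> \<le> r)"
    using kant_countable by metis
  have m: "(\<lambda>z. \<integral>x. g x \<partial>z) \<in> borel_measurable (prob_algebra borel)" if "g \<in> S" for g
  proof -
    have [measurable]: "g \<in> borel_measurable borel"
      using that S(2) by (intro borel_measurable_continuous_onI lip1_continuous) auto
    show ?thesis unfolding prob_algebra_def
      by (intro measurable_restrict_space1 integral_measurable_subprob_algebra) simp
  qed
  have "{z \<in> beliefs. kant z0 z \<le> r} =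
      {z \<in> space (prob_algebra borel). \<forall>g\<in>S. \<bar>(\<integral>x. g x \<partial>z0) - (\<integral>x. g x \<partial>z)\<bar> \<le> r}"
    using S(3)[OF assms] by (auto simp: beliefs_eq)
  also have "\<dots> \<in> sets (prob_algebra borel)"
  proof -
    have "{z \<in> space (prob_algebra borel). \<bar>(\<integral>x. g x \<partial>z0) - (\<integral>x. g x \<partial>z)\<bar> \<le> r} \<in> sets (prob_algebra borel)"
      if "g \<in> S" for g
    proof -
      note [measurable] = m[OF that]
      show ?thesis by measurable
    qed
    then have "(\<Inter>g\<in>S. {z \<in> space (prob_algebra borel). \<bar>(\<integral>x. g x \<partial>z0) - (\<integral>x. g x \<partial>z)\<bar> \<le> r}) \<inter>
        space (prob_algebra borel) \<in> sets (prob_algebra borel)"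
      using S(1) by (cases "S = {}") (auto intro!: sets.Int sets.countable_INT')
    also have "(\<Inter>g\<in>S. {z \<in> space (prob_algebra borel). \<bar>(\<integral>x. g x \<partial>z0) - (\<integral>x. g x \<partial>z)\<bar> \<le> r}) \<inter>
        space (prob_algebra borel) = {z \<in> space (prob_algebra borel). \<forall>g\<in>S. \<bar>(\<integral>x. g x \<partial>z0) - (\<integral>x. g x \<partial>z)\<bar> \<le> r}"
      by auto
    finally show ?thesis .
  qed
  finally show ?thesis .
qed

text \<open>Beliefs are sorted by the rounded integrals of a finite net of test functions. Equal
  roundings put two beliefs within d + 2 d of each other.\<close>

lemma kant_totally_bounded:
  assumes "0 < e"
  obtains N :: "'x measure set" where "finite N" "N \<subseteq> beliefs" "\<And>z. z \<in> beliefs \<Longrightarrow> \<exists>z'\<in>N. kant z z' \<le> e"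
proof -
  define d where "d = e / 3"
  have "0 < d" using assms by (simp add: d_def)
  obtain S where S: "finite S" "S \<subseteq> lip1"
    "\<And>f :: 'x \<Rightarrow> real. f \<in> lip1 \<Longrightarrow> \<exists>g\<in>S. \<exists>c. \<forall>x. \<bar>f x - (g x + c)\<bar> \<le> d"
    by (rule lip1_finite_net[OF \<open>0 < d\<close>]) blast
  define q where "q z = (\<lambda>g\<in>S. \<lfloor>(\<integral>x. g x \<partial>z) / d\<rfloor>)" for z :: "'x measure"
  have "q ` beliefs \<subseteq> PiE S (\<lambda>g. (\<lambda>z. \<lfloor>(\<integral>x. g x \<partial>z) / d\<rfloor>) ` beliefs)" by (auto simp: q_def)
  moreover have "finite (PiE S (\<lambda>g. (\<lambda>z. \<lfloor>(\<integral>x. g x \<partial>z) / d\<rfloor>) ` beliefs))"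
  proof (intro finite_PiE S)
    fix g assume "g \<in> S"
    then have g: "g \<in> lip1" using S by auto
    obtain B where B: "\<And>x. \<bar>g x\<bar> \<le> B" using continuous_bounded[OF lip1_continuous[OF g]] by metis
    have "\<bar>\<integral>x. g x \<partial>z\<bar> \<le> B" if "z \<in> beliefs" for z
      using belief_integral_close[OF that lip1_integrable[OF g that] integrable_zero, of 0 B] B by simp
    then show "finite ((\<lambda>z. \<lfloor>(\<integral>x. g x \<partial>z) / d\<rfloor>) ` beliefs)" by (rule finite_floor_image[OF _ \<open>0 < d\<close>])
  qed
  ultimately have "finite (q ` beliefs)" by (rule finite_subset)
  then obtain N where N: "finite N" "N \<subseteq> beliefs" "\<And>z. z \<in> beliefs \<Longrightarrow> \<exists>z'\<in>N. q z' = q z"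
    by (rule finite_image_representatives) blast
  show ?thesis
  proof (rule that[OF N(1,2)])
    fix z :: "'x measure" assume z: "z \<in> beliefs"
    then obtain z' where z': "z' \<in> N" "q z' = q z" using N(3) by blast
    have "kant z z' \<le> d + 2 * d"
    proof (rule kant_le_of_net[OF S(2,3) z])
      show "z' \<in> beliefs" using z' N(2) by auto
      fix g assume "g \<in> S"
      then have "\<lfloor>(\<integral>x. g x \<partial>z) / d\<rfloor> = \<lfloor>(\<integral>x. g x \<partial>z') / d\<rfloor>"
        using fun_cong[OF z'(2), of g] by (simp add: q_def)
      then show "\<bar>(\<integral>x. g x \<partial>z) - (\<integral>x. g x \<partial>z')\<bar> \<le> d" by (rule floor_eq_imp_close[OF _ \<open>0 < d\<close>])
    qed
    then show "\<exists>z'\<in>N. kant z z' \<le> e" using z'(1) by (auto simp: d_def)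
  qed
qed

section \<open>Separability and measurability of Kantorovich-open sets\<close>

lemma return_in_beliefs: "return borel x \<in> beliefs"
  by (auto simp: beliefs_def intro!: prob_space_return)

lemma kant_dense_sequence:
  obtains d :: "nat \<Rightarrow> 'x measure" where "\<And>n. d n \<in> beliefs" "\<And>z e. z \<in> beliefs \<Longrightarrow> 0 < e \<Longrightarrow> \<exists>n. kant z (d n) < e"
proof -
  have "\<forall>n::nat. \<exists>N :: 'x measure set. finite N \<and> N \<subseteq> beliefs \<and> (\<forall>z\<in>beliefs. \<exists>z'\<in>N. kant z z' \<le> 1 / Suc n)"
  proof
    show "\<exists>N :: 'x measure set. finite N \<and> N \<subseteq> beliefs \<and> (\<forall>z\<in>beliefs. \<exists>z'\<in>N. kant z z' \<le> 1 / Suc n)" for n :: nat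
      by (rule kant_totally_bounded[of "1 / Suc n"]; (simp; fail)?) blast
  qed
  then obtain N :: "nat \<Rightarrow> 'x measure set" where "\<forall>n. finite (N n) \<and> N n \<subseteq> beliefs \<and>
      (\<forall>z\<in>beliefs. \<exists>z'\<in>N n. kant z z' \<le> 1 / Suc n)"
    unfolding choice_iff ..
  then have N: "\<And>n. finite (N n)" "\<And>n. N n \<subseteq> beliefs"
    "\<And>n z. z \<in> beliefs \<Longrightarrow> \<exists>z'\<in>N n. kant z z' \<le> 1 / Suc n"
    by auto
  let ?U = "\<Union>n. N n"
  have "countable ?U" using N(1) by (auto intro: countable_finite)
  have "?U \<noteq> {}" using N(3)[OF return_in_beliefs] by fastforce
  show ?thesis
  proof (rule that[of "from_nat_into ?U"])
    show "from_nat_into ?U n \<in> beliefs" for n using from_nat_into[OF \<open>?U \<noteq> {}\<close>, of n] N(2) by auto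
    fix z :: "'x measure" and e :: real assume z: "z \<in> beliefs" "0 < e"
    obtain n where n: "1 / Suc n < e" using \<open>0 < e\<close> by (metis nat_approx_posE)
    obtain z' where "z' \<in> N n" "kant z z' \<le> 1 / Suc n" using N(3)[OF z(1)] by blast
    moreover obtain k where "from_nat_into ?U k = z'"
      using from_nat_into_surj[OF \<open>countable ?U\<close>, of z'] \<open>z' \<in> N n\<close> by auto
    ultimately show "\<exists>n. kant z (from_nat_into ?U n) < e" using n by (intro exI[of _ k]) auto
  qed
qed

text \<open>By separability an open set is the union of those closed balls with centre
  \<open>d n\<close> and radius 1/(k+1) that it contains.\<close>

lemma kant_open_measurable:
  assumes Op: "Op \<subseteq> beliefs" "\<And>z. z \<in> Op \<Longrightarrow> \<exists>r>0. \<forall>z'\<in>beliefs. kant z z' < r \<longrightarrow> z' \<in> Op"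
  shows "(Op :: 'x measure set) \<in> sets (prob_algebra borel)"
proof -
  obtain d :: "nat \<Rightarrow> 'x measure" where d: "\<And>n. d n \<in> beliefs" "\<And>z e. z \<in> beliefs \<Longrightarrow> 0 < e \<Longrightarrow> \<exists>n. kant z (d n) < e"
    by (rule kant_dense_sequence) blast
  define I where "I = {(n, k). {z \<in> beliefs. kant (d n) z \<le> 1 / Suc k} \<subseteq> Op}"
  have "Op = (\<Union>(n, k)\<in>I. {z \<in> beliefs. kant (d n) z \<le> 1 / Suc k})"
  proof (intro equalityI subsetI)
    fix z assume "z \<in> Op"
    then have z: "z \<in> beliefs" using Op by auto
    obtain r where r: "0 < r" "\<And>z'. z' \<in> beliefs \<Longrightarrow> kant z z' < r \<Longrightarrow> z' \<in> Op" using Op(2)[OF \<open>z \<in> Op\<close>] by blast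
    obtain k where k: "1 / Suc k < r / 2" using \<open>0 < r\<close> by (meson half_gt_zero nat_approx_posE)
    obtain n where n: "kant z (d n) < 1 / Suc k" using d(2)[OF z, of "1 / Suc k"] by auto
    have "(n, k) \<in> I" unfolding I_def
    proof (clarsimp simp del: of_nat_Suc)
      fix z' assume z': "z' \<in> beliefs" "kant (d n) z' \<le> 1 / Suc k"
      show "z' \<in> Op" using kant_triangle[OF z d(1) z'(1), of n] n k z' by (intro r) auto
    qed
    then show "z \<in> (\<Union>(n, k)\<in>I. {z \<in> beliefs. kant (d n) z \<le> 1 / Suc k})"
      using n z by (auto simp: kant_sym[of "d n"] intro!: bexI[of _ "(n, k)"] less_imp_le simp del: of_nat_Suc)
  qed (auto simp: I_def)
  also have "\<dots> \<in> sets (prob_algebra borel)"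
    by (intro sets.countable_UN'[OF countableI_type]) (auto intro!: kant_cball_measurable d)
  finally show ?thesis .
qed

lemma kant_lipschitz_measurable:
  assumes h: "\<And>z z'. z \<in> beliefs \<Longrightarrow> z' \<in> beliefs \<Longrightarrow> \<bar>h z - h z'\<bar> \<le> L * kant z (z' :: 'x measure)"
  shows "h \<in> borel_measurable (prob_algebra borel)"
proof (rule borel_measurableI)
  fix V :: "real set" assume "open V"
  show "h -` V \<inter> space (prob_algebra borel) \<in> sets (prob_algebra borel)"
  proof (rule kant_open_measurable)
    fix z assume "z \<in> h -` V \<inter> space (prob_algebra borel)"
    then have z: "h z \<in> V" "z \<in> beliefs" by (auto simp: beliefs_eq)
    obtain e where e: "0 < e" "\<And>t. \<bar>t - h z\<bar> < e \<Longrightarrow> t \<in> V"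
      using \<open>open V\<close> z(1) unfolding open_dist dist_real_def by blast
    \<comment> \<open>The sign of \<open>L\<close> is unknown; \<open>\<bar>L\<bar> + 1\<close> is
      positive and dominates \<open>L\<close>.\<close>
    show "\<exists>r>0. \<forall>z'\<in>beliefs. kant z z' < r \<longrightarrow> z' \<in> h -` V \<inter> space (prob_algebra borel)"
    proof (intro exI[of _ "e / (\<bar>L\<bar> + 1)"] conjI ballI impI)
      fix z' assume z': "z' \<in> beliefs" "kant z z' < e / (\<bar>L\<bar> + 1)"
      have "\<bar>h z' - h z\<bar> \<le> L * kant z z'" using h[OF z(2) z'(1)] by (simp add: abs_minus_commute)
      also have "\<dots> \<le> (\<bar>L\<bar> + 1) * kant z z'" using kant_nonneg[OF z(2) z'(1)] by (intro mult_right_mono) auto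
      also have "\<dots> < e" using z'(2) by (simp add: field_simps)
      finally show "z' \<in> h -` V \<inter> space (prob_algebra borel)" using e(2) z' by (simp add: beliefs_eq)
    qed (use e in simp)
  qed (auto simp: beliefs_eq)
qed

text \<open>The approximation is the inf-convolution of \<open>f\<close> with \<open>L\<close> times
  the distance. As an infimum of \<open>L\<close>-Lipschitz functions it is
  \<open>L\<close>-Lipschitz, it lies below \<open>f\<close>, and for a large penalty
  \<open>L\<close> it stays close to \<open>f\<close>.\<close>

lemma lipschitz_approximation:
  fixes f :: "'x \<Rightarrow> real"
  assumes f: "continuous_on UNIV f" and "0 < e"
  obtains g L where "0 \<le> L" "\<And>x y. \<bar>g x - g y\<bar> \<le> L * dist x y" "\<And>x. \<bar>f x - g x\<bar> \<le> e"
proof -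
  obtain B where B: "\<And>x. \<bar>f x\<bar> \<le> B" using continuous_bounded[OF f] by metis
  then have "0 \<le> B" by (meson abs_ge_zero order_trans)
  have "uniformly_continuous_on UNIV f" by (rule compact_uniformly_continuous[OF f compactX])
  then obtain d where d: "0 < d" "\<And>x y. dist x y < d \<Longrightarrow> \<bar>f x - f y\<bar> < e"
    using \<open>0 < e\<close> unfolding uniformly_continuous_on_def dist_real_def by (metis UNIV_I abs_minus_commute dist_commute)
  \<comment> \<open>\<open>2 * B\<close> bounds the oscillation of \<open>f\<close>, so from
    distance \<open>d\<close> on the penalty outweighs any gain from moving away from x.\<close>
  define L where "L = 2 * B / d"
  have "0 \<le> L" using \<open>0 \<le> B\<close> d(1) by (simp add: L_def)
  define g where "g x = (INF y. f y + L * dist x y)" for x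
  have bdd: "bdd_below (range (\<lambda>y. f y + L * dist x y))" for x
  proof (rule bdd_belowI2)
    show "- B \<le> f y + L * dist x y" for y using B[of y] \<open>0 \<le> L\<close> by (smt (verit) mult_nonneg_nonneg zero_le_dist)
  qed
  have half: "g x \<le> g y + L * dist x y" for x y
  proof -
    have "g x - L * dist x y \<le> g y" unfolding g_def[of y]
    proof (rule cINF_greatest)
      fix w
      have "g x \<le> f w + L * dist x w" unfolding g_def by (rule cINF_lower[OF bdd]) simp
      also have "\<dots> \<le> f w + L * (dist x y + dist y w)"
        using \<open>0 \<le> L\<close> by (intro add_left_mono mult_left_mono dist_triangle)
      finally show "g x - L * dist x y \<le> f w + L * dist y w" by (simp add: algebra_simps)
    qed simp
    then show ?thesis by simp
  qed
  show ?thesis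
  proof (rule that[OF \<open>0 \<le> L\<close>])
    show "\<bar>g x - g y\<bar> \<le> L * dist x y" for x y
      using half[of x y] half[of y x] by (simp add: dist_commute abs_le_iff)
    fix x
    have "g x \<le> f x + L * dist x x" unfolding g_def by (rule cINF_lower[OF bdd]) simp
    moreover have "f x - e \<le> g x" unfolding g_def
    proof (rule cINF_greatest)
      fix y
      show "f x - e \<le> f y + L * dist x y"
      proof (cases "dist x y < d")
        case True
        then show ?thesis using d(2)[OF True] \<open>0 \<le> L\<close> by (smt (verit) mult_nonneg_nonneg zero_le_dist)
      next
        case False
        then have "L * d \<le> L * dist x y" using \<open>0 \<le> L\<close> by (intro mult_left_mono) auto
        then show ?thesis using B[of x] B[of y] d(1) \<open>0 < e\<close> by (simp add: L_def abs_le_iff)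
      qed
    qed simp
    ultimately show "\<bar>f x - g x\<bar> \<le> e" using \<open>0 < e\<close> by simp
  qed
qed

text \<open>A continuous test function is uniformly close to a Lipschitz one, whose integral varies
  by at most its constant times the Kantorovich distance.\<close>

lemma weak_open_kant_open:
  assumes "openin weak_topology (Op :: 'x measure set)" "z \<in> Op" "z \<in> beliefs"
  shows "\<exists>r>0. \<forall>z'\<in>beliefs. kant z z' < r \<longrightarrow> z' \<in> Op"
  using assms unfolding weak_topology_def openin_topology_generated_by_iff
proof (induction arbitrary: z rule: generate_topology_on.induct)
  case (Int a b)
  then obtain r s where "0 < r" "\<forall>z'\<in>beliefs. kant z z' < r \<longrightarrow> z' \<in> a"
    "0 < s" "\<forall>z'\<in>beliefs. kant z z' < s \<longrightarrow> z' \<in> b" using Int.IH(1)[of z] Int.IH(2)[of z] by blast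
  then show ?case by (intro exI[of _ "min r s"]) auto
next
  case (UN K)
  then obtain k where "k \<in> K" "z \<in> k" by auto
  then obtain r where "0 < r" "\<forall>z'\<in>beliefs. kant z z' < r \<longrightarrow> z' \<in> k" using UN by metis
  then show ?case using \<open>k \<in> K\<close> by blast
next
  case (Basis s)
  then obtain f :: "'x \<Rightarrow> real" and V where s: "s = {z \<in> beliefs. (\<integral>x. f x \<partial>z) \<in> V}"
    and f: "continuous_on UNIV f" and V: "open V" by auto
  have "(\<integral>x. f x \<partial>z) \<in> V" using Basis s by auto
  then obtain e where e: "0 < e" "\<And>t. dist t (\<integral>x. f x \<partial>z) < e \<Longrightarrow> t \<in> V" using V unfolding open_dist by blast
  obtain g L where g: "0 \<le> L" "\<And>x y. \<bar>g x - g y\<bar> \<le> L * dist x y" "\<And>x. \<bar>f x - g x\<bar> \<le> e / 3"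
    by (rule lipschitz_approximation[OF f, of "e / 3"]) (use e in auto)
  have ig: "integrable z g" if "z \<in> beliefs" for z
    by (rule continuous_integrable[OF lipschitz_imp_continuous that]) (rule g(2))
  have fg: "\<bar>(\<integral>x. f x \<partial>z) - (\<integral>x. g x \<partial>z)\<bar> \<le> e / 3" if "z \<in> beliefs" for z
    using belief_integral_close[OF that continuous_integrable[OF f that] ig[OF that], of 0 "e / 3"] g(3) by simp
  show ?case
  proof (intro exI[of _ "e / (3 * (L + 1))"] conjI ballI impI)
    fix z' assume z': "z' \<in> beliefs" "kant z z' < e / (3 * (L + 1))"
    have "\<bar>(\<integral>x. g x \<partial>z) - (\<integral>x. g x \<partial>z')\<bar> \<le> L * kant z z'"
      by (rule lipschitz_integral_diff_le[OF g(2,1) Basis(3) z'(1)])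
    also have "\<dots> \<le> (L + 1) * kant z z'" using kant_nonneg[OF Basis(3) z'(1)] by (intro mult_right_mono) auto
    also have "\<dots> < e / 3" using z'(2) g(1) by (simp add: field_simps)
    finally have "dist (\<integral>x. f x \<partial>z') (\<integral>x. f x \<partial>z) < e"
      using fg[OF Basis(3)] fg[OF z'(1)] unfolding dist_real_def by linarith
    then show "z' \<in> s" using e(2) z' s by auto
  qed (use e g in simp)
qed simp

section \<open>The Borel algebra of the weak topology\<close>

lemma topspace_weak_topology: "topspace weak_topology = (beliefs :: 'x measure set)"
proof -
  have "(beliefs :: 'x measure set) \<in> {{z \<in> beliefs. (\<integral>x. f x \<partial>z) \<in> V} | (f :: 'x \<Rightarrow> real) V.
        continuous_on UNIV f \<and> bounded (range f) \<and> open V}"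
    by (auto intro!: exI[of _ "\<lambda>_. 0"] exI[of _ UNIV] simp: image_constant_conv)
  then show ?thesis unfolding weak_topology_def topology_generated_by_topspace by blast
qed

lemma sets_belief_algebra_eq: "sets (belief_algebra :: 'x measure measure) = sigma_sets beliefs {W. openin weak_topology W}"
  unfolding belief_algebra_def
  by (rule sets_measure_of) (use openin_subset in \<open>force simp: topspace_weak_topology[symmetric]\<close>)

lemma space_belief_algebra: "space (belief_algebra :: 'x measure measure) = beliefs"
  unfolding belief_algebra_def
  by (rule space_measure_of) (use openin_subset in \<open>force simp: topspace_weak_topology[symmetric]\<close>)

lemma integral_measurable_belief_algebra:
  fixes f :: "'x \<Rightarrow> real"
  assumes f: "continuous_on UNIV f"
  shows "(\<lambda>z. \<integral>x. f x \<partial>z) \<in> borel_measurable belief_algebra"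
proof (rule borel_measurableI)
  fix V :: "real set" assume "open V"
  have "bounded (range f)" by (rule compact_imp_bounded[OF compact_continuous_image[OF f compactX]])
  then have "openin weak_topology {z \<in> beliefs. (\<integral>x. f x \<partial>z) \<in> V}"
    unfolding weak_topology_def using f \<open>open V\<close> by (intro topology_generated_by_Basis) auto
  moreover have "(\<lambda>z. \<integral>x. f x \<partial>z) -` V \<inter> space belief_algebra = {z \<in> beliefs. (\<integral>x. f x \<partial>z) \<in> V}"
    by (auto simp: space_belief_algebra)
  ultimately show "(\<lambda>z. \<integral>x. f x \<partial>z) -` V \<inter> space belief_algebra \<in> sets belief_algebra"
    unfolding sets_belief_algebra_eq by auto
qed

text \<open>The indicator of an open set is a pointwise limit of continuous functions built from the
  distance to the complement.\<close>

lemma emeasure_open_measurable_belief_algebra: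
  assumes U: "open (U :: 'x set)"
  shows "(\<lambda>z. emeasure z U) \<in> borel_measurable belief_algebra"
proof -
  \<comment> \<open>The case \<open>U = UNIV\<close> is separate because the distance to the empty
    set is 0 by convention.\<close>
  define f where "f n x = (if U = UNIV then 1 else min 1 (real n * infdist x (- U)))" for n and x :: 'x
  have cont: "continuous_on UNIV (f n)" for n
    unfolding f_def by (cases "U = UNIV") (auto intro!: continuous_intros)
  have lim: "(\<lambda>n. f n x) \<longlonglongrightarrow> indicator U x" for x
  proof (cases "x \<in> U \<and> U \<noteq> UNIV")
    case True
    then have ne: "- U \<noteq> {}" by auto
    have "infdist x (- U) \<noteq> 0" using in_closed_iff_infdist_zero[OF closed_Compl[OF U] ne, of x] True by auto
    then have pos: "0 < infdist x (- U)" using infdist_nonneg[of x "- U"] by linarith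
    then obtain m where m: "1 < real m * infdist x (- U)" using ex_less_of_nat_mult by blast
    have "f n x = 1" if "m \<le> n" for n
    proof -
      have "real m * infdist x (- U) \<le> real n * infdist x (- U)" using that pos by (intro mult_right_mono) auto
      then show ?thesis using m True by (simp add: f_def)
    qed
    then show ?thesis using True by (intro tendsto_eventually) (auto simp: eventually_sequentially)
  next
    case False
    then have "f n x = indicator U x" for n by (auto simp: f_def)
    then show ?thesis by simp
  qed
  have "(\<lambda>z. measure z U) \<in> borel_measurable belief_algebra"
  proof (rule borel_measurable_LIMSEQ_real)
    show "(\<lambda>z. \<integral>x. f n x \<partial>z) \<in> borel_measurable belief_algebra" for n
      by (rule integral_measurable_belief_algebra[OF cont])
    fix z :: "'x measure" assume "z \<in> space belief_algebra"
    then have z: "z \<in> beliefs" by (simp add: space_belief_algebra)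
    interpret prob_space z by (rule beliefsD[OF z])
    have Uz: "U \<in> sets z" using U by (simp add: beliefsD(2)[OF z])
    have "(\<lambda>n. \<integral>x. f n x \<partial>z) \<longlonglongrightarrow> (\<integral>x. indicator U x \<partial>z)"
    proof (rule integral_dominated_convergence[where w="\<lambda>_. 1"])
      show "f n \<in> borel_measurable z" for n
        using borel_measurable_continuous_onI[OF cont] by (simp add: measurable_cong_sets[OF beliefsD(2)[OF z] refl])
      show "AE x in z. norm (f n x) \<le> 1" for n
        using infdist_nonneg[of _ "- U"] by (intro AE_I2) (simp add: f_def)
    qed (use lim Uz in auto)
    then show "(\<lambda>n. \<integral>x. f n x \<partial>z) \<longlonglongrightarrow> measure z U"
      using Uz by (simp add: beliefsD(3)[OF z])
  qed
  then have "(\<lambda>z. ennreal (measure z U)) \<in> borel_measurable belief_algebra" by measurable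
  then show ?thesis
    by (rule measurable_cong[THEN iffD1, rotated])
       (auto simp: space_belief_algebra dest!: beliefsD(1) intro!: finite_measure.emeasure_eq_measure[symmetric] prob_space.finite_measure)
qed

text \<open>Weakly open sets are open for \<open>kant\<close>, hence in \<open>prob_algebra\<close>.
  Conversely the masses of open sets, a generating pi-system, are weakly Borel. Measurability in the
  belief thus becomes measurability of kernels.\<close>

lemma sets_belief_algebra [measurable_cong]: "sets (belief_algebra :: 'x measure measure) = sets (prob_algebra borel)"
proof
  show "sets belief_algebra \<subseteq> sets (prob_algebra (borel :: 'x measure))"
    unfolding sets_belief_algebra_eq beliefs_eq
  proof (rule sets.sigma_sets_subset, safe)
    fix W :: "'x measure set" assume W: "openin weak_topology W"
    show "W \<in> sets (prob_algebra borel)"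
    proof (rule kant_open_measurable)
      show "W \<subseteq> beliefs" using openin_subset[OF W] by (simp add: topspace_weak_topology)
      then show "\<exists>r>0. \<forall>z'\<in>beliefs. kant z z' < r \<longrightarrow> z' \<in> W" if "z \<in> W" for z
        using weak_open_kant_open[OF W that] that by auto
    qed
  qed
  have "(\<lambda>z. z) \<in> belief_algebra \<rightarrow>\<^sub>M prob_algebra (borel :: 'x measure)"
  proof (rule measurable_prob_algebra_generated[where \<Omega>=UNIV and G="{S. open S}"])
    show "sets borel = sigma_sets UNIV {S :: 'x set. open S}"
      unfolding borel_def by (rule sets_measure_of) auto
  qed (auto simp: Int_stable_def space_belief_algebra dest: beliefsD intro!: emeasure_open_measurable_belief_algebra)
  then show "sets (prob_algebra borel) \<subseteq> sets (belief_algebra :: 'x measure measure)"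
    using measurable_sets[of "\<lambda>z. z" belief_algebra "prob_algebra borel"] sets.sets_into_space
    by (fastforce simp: space_belief_algebra beliefs_eq Int_absorb2)
qed

end

section \<open>Measurable selection of minimizers\<close>

text \<open>The Kuratowski and Ryll-Nardzewski selection theorem for the closed sets of minimizers.
  Points of a dense sequence, with indices chosen by \<open>LEAST\<close>, come within (1/2)^n of a
  minimizer and form a Cauchy sequence, whose limit is a minimizer by continuity.\<close>

lemma measurable_argmin:
  fixes G :: "'a \<Rightarrow> 'u::polish_space \<Rightarrow> real"
  assumes compactU: "compact (UNIV :: 'u set)"
    and meas[measurable]: "\<And>u. (\<lambda>z. G z u) \<in> borel_measurable M"
    and cont: "\<And>z. z \<in> space M \<Longrightarrow> continuous_on UNIV (G z)"
  obtains g where "g \<in> M \<rightarrow>\<^sub>M borel" "\<And>z u. z \<in> space M \<Longrightarrow> G z (g z) \<le> G z u"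
proof -
  obtain D :: "'u set" where D: "countable D" "\<And>X. open X \<Longrightarrow> X \<noteq> {} \<Longrightarrow> \<exists>d\<in>D. d \<in> X"
    using countable_dense_exists by metis
  define d where "d = from_nat_into D"
  have dense: "\<exists>j. d j \<in> X" if "open X" "x \<in> X" for X x
    using D(2)[OF that(1)] that(2) from_nat_into_surj[OF D(1)] unfolding d_def by (metis empty_iff)
  define V where "V z = (INF j. G z (d j))" for z
  have V_meas[measurable]: "V \<in> borel_measurable M"
    unfolding V_def by (rule borel_measurable_cINF_real) auto
  have min: "\<exists>u. \<forall>u'. G z u \<le> G z u'" if "z \<in> space M" for z
    using continuous_attains_inf[OF compactU _ cont[OF that]] by auto
  have V_le: "V z \<le> G z u" if z: "z \<in> space M" for z u
  proof (rule field_le_epsilon)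
    fix e :: real assume "0 < e"
    have "open {v. G z v < G z u + e}"
      using open_Collect_less[OF cont[OF z] continuous_on_const] .
    then obtain j where "G z (d j) < G z u + e" using dense[of _ u] \<open>0 < e\<close> by fastforce
    moreover have "V z \<le> G z (d j)" unfolding V_def
      using min[OF z] by (intro cINF_lower) (auto intro: bdd_belowI2)
    ultimately show "V z \<le> G z u + e" by linarith
  qed
  have V_min: "\<exists>u. G z u = V z" if z: "z \<in> space M" for z
  proof -
    obtain u where "\<forall>u'. G z u \<le> G z u'" using min[OF z] by blast
    then have "G z u \<le> V z" unfolding V_def by (intro cINF_greatest) auto
    then show ?thesis using V_le[OF z, of u] by (intro exI[of _ u]) simp
  qed
  \<comment> \<open>\<open>P i r z\<close> expresses that some minimizer lies within
    \<open>r\<close> of \<open>d i\<close>, in terms of the dense sequence alone, so that it is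
    measurable in z. Letting the slack 1/(n+1) tend to 0, compactness recovers an exact minimizer;
    see \<open>P_iff\<close>.\<close>
  define P where "P i r z \<longleftrightarrow> (\<forall>n. \<exists>j. dist (d i) (d j) < r + 1 / Suc n \<and> G z (d j) < V z + 1 / Suc n)" for i r z
  have P_meas[measurable]: "Measurable.pred M (P i r)" for i r unfolding P_def by measurable
  have P_iff: "P i r z \<longleftrightarrow> (\<exists>a. G z a = V z \<and> dist (d i) a \<le> r)" if z: "z \<in> space M" for i r z
  proof
    assume "P i r z"
    then obtain j where j: "\<And>n. dist (d i) (d (j n)) < r + 1 / Suc n" "\<And>n. G z (d (j n)) < V z + 1 / Suc n"
      unfolding P_def by metis
    obtain a s where s: "strict_mono s" "((\<lambda>n. d (j n)) \<circ> s) \<longlonglongrightarrow> a"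
      using compactU[unfolded compact_def] by (metis UNIV_I)
    have inv: "(\<lambda>n. 1 / Suc (s n)) \<longlonglongrightarrow> (0::real)"
      using LIMSEQ_subseq_LIMSEQ[OF LIMSEQ_Suc[OF lim_inverse_n'] s(1)] by (simp add: comp_def)
    have "(\<lambda>n. G z (d (j (s n)))) \<longlonglongrightarrow> G z a"
      using continuous_on_tendsto_compose[OF cont[OF z] s(2)] by (simp add: comp_def)
    moreover have "(\<lambda>n. V z + 1 / Suc (s n)) \<longlonglongrightarrow> V z + 0" by (intro tendsto_intros inv)
    ultimately have "G z a \<le> V z + 0" by (rule LIMSEQ_le) (use j(2) in \<open>auto intro: less_imp_le\<close>)
    moreover have "(\<lambda>n. dist (d i) (d (j (s n)))) \<longlonglongrightarrow> dist (d i) a"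
      using s(2) by (intro tendsto_intros) (simp add: comp_def)
    moreover have "(\<lambda>n. r + 1 / Suc (s n)) \<longlonglongrightarrow> r + 0" by (intro tendsto_intros inv)
    ultimately have "dist (d i) a \<le> r + 0" by (intro LIMSEQ_le[of _ "dist (d i) a"]) (use j(1) in \<open>auto intro: less_imp_le\<close>)
    then show "\<exists>a. G z a = V z \<and> dist (d i) a \<le> r"
      using \<open>G z a \<le> V z + 0\<close> V_le[OF z, of a] by auto
  next
    assume "\<exists>a. G z a = V z \<and> dist (d i) a \<le> r"
    then obtain a where a: "G z a = V z" "dist (d i) a \<le> r" by blast
    show "P i r z" unfolding P_def
    proof
      fix n
      have "open {v. dist (d i) v < r + 1 / Suc n}" by (intro open_Collect_less continuous_intros)
      moreover have "open {v. G z v < V z + 1 / Suc n}"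
        using open_Collect_less[OF cont[OF z] continuous_on_const] .
      ultimately have "open ({v. dist (d i) v < r + 1 / Suc n} \<inter> {v. G z v < V z + 1 / Suc n})" by (rule open_Int)
      moreover have "a \<in> {v. dist (d i) v < r + 1 / Suc n} \<inter> {v. G z v < V z + 1 / Suc n}"
        using a by (auto intro: le_less_trans simp del: of_nat_Suc)
      ultimately show "\<exists>j. dist (d i) (d j) < r + 1 / Suc n \<and> G z (d j) < V z + 1 / Suc n"
        using dense by fastforce
    qed
  qed
  have near: "\<exists>i. dist (d i) a \<le> r" if "0 < r" for a r
    using dense[of "ball a r" a] that by (auto simp: dist_commute intro: less_imp_le)
  \<comment> \<open>A minimizer within (1/2)^n of the old centre has a dense point within
    (1/2)^(n+1), so the bound 2 * (1/2)^n between consecutive centres can always be met.\<close>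
  define k where "k n z = rec_nat (LEAST i. P i 1 z)
      (\<lambda>n m. LEAST i. P i ((1/2)^Suc n) z \<and> dist (d i) (d m) \<le> 2 * (1/2)^n) n" for n z
  have k0: "k 0 = (\<lambda>z. LEAST i. P i 1 z)"
    and kS: "k (Suc n) = (\<lambda>z. LEAST i. P i ((1/2)^Suc n) z \<and> dist (d i) (d (k n z)) \<le> 2 * (1/2)^n)" for n
    by (auto simp: k_def)
  have k_meas[measurable]: "k n \<in> M \<rightarrow>\<^sub>M count_space UNIV" for n
  proof (induction n)
    case 0 show ?case unfolding k0 by measurable
  next
    case (Suc n)
    note [measurable] = Suc
    have [measurable]: "Measurable.pred M (\<lambda>z. dist (d i) (d (k n z)) \<le> c)" for i c
      by (rule measurable_compose[OF Suc]) simp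
    show ?case unfolding kS by measurable
  qed
  have kP: "P (k n z) ((1/2)^n) z" if z: "z \<in> space M" for n z
  proof (induction n)
    case 0
    obtain a where "G z a = V z" using V_min[OF z] by blast
    then have "\<exists>i. P i 1 z" using near[of 1 a] P_iff[OF z] by auto
    then show ?case unfolding k0 by (auto intro: LeastI_ex)
  next
    case (Suc n)
    then obtain a where a: "G z a = V z" "dist (d (k n z)) a \<le> (1/2)^n" using P_iff[OF z] by blast
    obtain i where i: "dist (d i) a \<le> (1/2)^Suc n" using near[of "(1/2)^Suc n" a] by auto
    have "dist (d i) (d (k n z)) \<le> dist (d i) a + dist (d (k n z)) a" by (rule dist_triangle2)
    also have "\<dots> \<le> (1/2)^Suc n + (1/2)^n" by (rule add_mono[OF i a(2)])
    also have "\<dots> \<le> 2 * (1/2)^n" by simp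
    finally have "\<exists>i. P i ((1/2)^Suc n) z \<and> dist (d i) (d (k n z)) \<le> 2 * (1/2)^n"
      using i a P_iff[OF z] by blast
    then show ?case unfolding kS by (rule LeastI2_ex) simp
  qed
  have kd: "dist (d (k (Suc n) z)) (d (k n z)) \<le> 2 * (1/2)^n" if z: "z \<in> space M" for n z
  proof -
    obtain a where a: "G z a = V z" "dist (d (k n z)) a \<le> (1/2)^n" using P_iff[OF z] kP[OF z] by blast
    obtain i where i: "dist (d i) a \<le> (1/2)^Suc n" using near[of "(1/2)^Suc n" a] by auto
    have "dist (d i) (d (k n z)) \<le> dist (d i) a + dist (d (k n z)) a" by (rule dist_triangle2)
    also have "\<dots> \<le> (1/2)^Suc n + (1/2)^n" by (rule add_mono[OF i a(2)])
    also have "\<dots> \<le> 2 * (1/2)^n" by simp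
    finally have "\<exists>i. P i ((1/2)^Suc n) z \<and> dist (d i) (d (k n z)) \<le> 2 * (1/2)^n"
      using i a P_iff[OF z] by blast
    then show ?thesis unfolding kS by (rule LeastI2_ex) simp
  qed
  have conv: "convergent (\<lambda>n. d (k n z))" if z: "z \<in> space M" for z
  proof (rule Cauchy_convergent, rule metric_CauchyI)
    have tele: "dist (d (k m z)) (d (k (m + j) z)) \<le> 4 * (1/2)^m - 4 * (1/2)^(m + j)" for m j
    proof (induction j)
      case (Suc j)
      have "dist (d (k m z)) (d (k (m + Suc j) z)) \<le>
          dist (d (k m z)) (d (k (m + j) z)) + dist (d (k (Suc (m + j)) z)) (d (k (m + j) z))"
        using dist_triangle2[of "d (k m z)" "d (k (m + Suc j) z)" "d (k (m + j) z)"] by simp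
      then show ?case using Suc kd[OF z, of "m + j"] by simp
    qed simp
    fix e :: real assume "0 < e"
    then obtain n where n: "(1/2::real)^n < e / 8" using real_arch_pow_inv[of "e / 8" "1/2"] by auto
    show "\<exists>N. \<forall>m\<ge>N. \<forall>j\<ge>N. dist (d (k m z)) (d (k j z)) < e"
    proof (intro exI[of _ n] allI impI)
      fix m j assume "n \<le> m" "n \<le> j"
      have *: "dist (d (k n z)) (d (k m z)) \<le> 4 * (1/2)^n" if "n \<le> m" for m
        using tele[of n "m - n"] that by (smt (verit) le_add_diff_inverse zero_le_power divide_nonneg_nonneg)
      show "dist (d (k m z)) (d (k j z)) < e"
        using *[OF \<open>n \<le> m\<close>] *[OF \<open>n \<le> j\<close>] dist_triangle3[of "d (k m z)" "d (k j z)" "d (k n z)"] n by linarith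
    qed
  qed
  define g where "g z = lim (\<lambda>n. d (k n z))" for z
  have glim: "(\<lambda>n. d (k n z)) \<longlonglongrightarrow> g z" if "z \<in> space M" for z
    using conv[OF that] by (simp add: g_def convergent_LIMSEQ_iff)
  show ?thesis
  proof (rule that)
    show "g \<in> borel_measurable M"
      by (rule borel_measurable_LIMSEQ_metric[OF _ glim]) (auto intro: measurable_compose[OF k_meas])
    fix z u assume z: "z \<in> space M"
    obtain a where a: "\<And>n. G z (a n) = V z" "\<And>n. dist (d (k n z)) (a n) \<le> (1/2)^n"
    proof -
      have "\<forall>n. \<exists>a. G z a = V z \<and> dist (d (k n z)) a \<le> (1/2)^n" using kP[OF z] P_iff[OF z] by blast
      then show ?thesis using that unfolding choice_iff by blast
    qed
    have a0: "(\<lambda>n. dist (d (k n z)) (a n)) \<longlonglongrightarrow> 0"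
      by (rule tendsto_sandwich[of "\<lambda>_. 0" _ _ "\<lambda>n. (1/2::real)^n"]) (use a(2) in \<open>auto simp: LIMSEQ_power_zero\<close>)
    have "(\<lambda>n. dist (d (k n z)) (a n) + dist (d (k n z)) (g z)) \<longlonglongrightarrow> 0 + 0"
      by (intro tendsto_add a0 tendsto_dist_iff[THEN iffD1] glim[OF z])
    then have "(\<lambda>n. dist (a n) (g z)) \<longlonglongrightarrow> 0"
      by (intro tendsto_sandwich[of "\<lambda>_. 0" "\<lambda>n. dist (a n) (g z)" sequentially "\<lambda>n. dist (d (k n z)) (a n) + dist (d (k n z)) (g z)"])
         (auto intro!: always_eventually dist_triangle3)
    then have "a \<longlonglongrightarrow> g z" by (rule tendsto_dist_iff[THEN iffD2])
    then have "(\<lambda>n. G z (a n)) \<longlonglongrightarrow> G z (g z)" by (intro continuous_on_tendsto_compose[OF cont[OF z]]) auto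
    then have "G z (g z) = V z" using a(1) by (simp add: LIMSEQ_const_iff)
    then show "G z (g z) \<le> G z u" using V_le[OF z] by simp
  qed
qed

section \<open>Total variation and densities of kernels\<close>

lemma tv_bdd_above:
  assumes "prob_space \<mu>" "prob_space \<nu>"
  shows "bdd_above ((\<lambda>B. \<bar>measure \<mu> B - measure \<nu> B\<bar>) ` A)"
proof (rule bdd_aboveI2)
  fix B
  have "measure \<mu> B \<le> 1" "measure \<nu> B \<le> 1" using assms by (auto intro: prob_space.prob_le_1)
  then show "\<bar>measure \<mu> B - measure \<nu> B\<bar> \<le> 1"
    using measure_nonneg[of \<mu> B] measure_nonneg[of \<nu> B] by linarith
qed

lemma measure_diff_le_tv:
  assumes "prob_space \<mu>" "prob_space \<nu>" "B \<in> sets \<mu>"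
  shows "\<bar>measure \<mu> B - measure \<nu> B\<bar> \<le> tv_norm_diff \<mu> \<nu> / 2"
  unfolding tv_norm_diff_def using cSUP_upper[OF assms(3) tv_bdd_above[OF assms(1,2)]] by simp

lemma tv_norm_diff_leI:
  assumes "\<And>B. B \<in> sets \<mu> \<Longrightarrow> \<bar>measure \<mu> B - measure \<nu> B\<bar> \<le> e / 2"
  shows "tv_norm_diff \<mu> \<nu> \<le> e"
proof -
  have "(SUP B\<in>sets \<mu>. \<bar>measure \<mu> B - measure \<nu> B\<bar>) \<le> e / 2"
    by (rule cSUP_least) (use assms in auto)
  then show ?thesis by (simp add: tv_norm_diff_def)
qed

lemma tv_norm_diff_nonneg: "prob_space \<mu> \<Longrightarrow> prob_space \<nu> \<Longrightarrow> 0 \<le> tv_norm_diff \<mu> \<nu>"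
  using measure_diff_le_tv[of \<mu> \<nu> "{}"] by simp

lemma tv_norm_diff_sym: "sets \<mu> = sets \<nu> \<Longrightarrow> tv_norm_diff \<mu> \<nu> = tv_norm_diff \<nu> \<mu>"
  by (simp add: tv_norm_diff_def abs_minus_commute)

lemma tv_norm_diff_triangle:
  assumes "prob_space \<mu>" "prob_space \<nu>" "prob_space \<rho>" "sets \<mu> = sets \<nu>"
  shows "tv_norm_diff \<mu> \<rho> \<le> tv_norm_diff \<mu> \<nu> + tv_norm_diff \<nu> \<rho>"
proof (rule tv_norm_diff_leI)
  fix B assume "B \<in> sets \<mu>"
  then have "\<bar>measure \<mu> B - measure \<nu> B\<bar> \<le> tv_norm_diff \<mu> \<nu> / 2"
    "\<bar>measure \<nu> B - measure \<rho> B\<bar> \<le> tv_norm_diff \<nu> \<rho> / 2"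
    using measure_diff_le_tv[OF assms(1,2), of B] measure_diff_le_tv[OF assms(2,3), of B] assms(4) by auto
  then show "\<bar>measure \<mu> B - measure \<rho> B\<bar> \<le> (tv_norm_diff \<mu> \<nu> + tv_norm_diff \<nu> \<rho>) / 2"
    by argo
qed

section \<open>L1 distances between densities\<close>

lemma L1_diff_eq:
  fixes f g :: "'a \<Rightarrow> real"
  assumes "integrable M f" "integrable M g" "(\<integral>x. f x \<partial>M) = (\<integral>x. g x \<partial>M)"
  shows "(\<integral>x. \<bar>f x - g x\<bar> \<partial>M) = 2 * ((\<integral>x. f x * indicator {x\<in>space M. g x < f x} x \<partial>M) - (\<integral>x. g x * indicator {x\<in>space M. g x < f x} x \<partial>M))"
proof -
  let ?B = "{x\<in>space M. g x < f x}"
  have B: "?B \<in> sets M"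
    using assms(1,2)[THEN borel_measurable_integrable] by measurable
  have i: "integrable M (\<lambda>x. f x * indicator ?B x)" "integrable M (\<lambda>x. g x * indicator ?B x)"
    using B assms by (auto intro: integrable_real_mult_indicator)
  have "(\<integral>x. \<bar>f x - g x\<bar> \<partial>M) = (\<integral>x. 2 * (f x * indicator ?B x - g x * indicator ?B x) - (f x - g x) \<partial>M)"
    by (rule Bochner_Integration.integral_cong) (auto split: split_indicator)
  also have "\<dots> = 2 * ((\<integral>x. f x * indicator ?B x \<partial>M) - (\<integral>x. g x * indicator ?B x \<partial>M)) - ((\<integral>x. f x \<partial>M) - (\<integral>x. g x \<partial>M))"
    using i assms(1,2) by simp
  finally show ?thesis using assms(3) by simp
qed

lemma measure_density_real:
  fixes f :: "'a \<Rightarrow> real"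
  assumes "integrable M f" "\<And>x. 0 \<le> f x" "A \<in> sets M"
  shows "emeasure (density M (\<lambda>x. ennreal (f x))) A = ennreal (\<integral>x. f x * indicator A x \<partial>M)"
proof -
  have [measurable]: "f \<in> borel_measurable M" using assms by simp
  have "emeasure (density M (\<lambda>x. ennreal (f x))) A = (\<integral>\<^sup>+x. ennreal (f x * indicator A x) \<partial>M)"
    using assms(3) by (subst emeasure_density) (auto intro!: nn_integral_cong split: split_indicator)
  also have "\<dots> = ennreal (\<integral>x. f x * indicator A x \<partial>M)"
    by (rule nn_integral_eq_integral) (use assms in \<open>auto intro: integrable_real_mult_indicator\<close>)
  finally show ?thesis .
qed

lemma prob_density_integrable:
  fixes f :: "'a \<Rightarrow> real"
  assumes "prob_space (density M (\<lambda>x. ennreal (f x)))" "f \<in> borel_measurable M" "\<And>x. 0 \<le> f x"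
  shows "integrable M f" "(\<integral>x. f x \<partial>M) = 1"
proof -
  have *: "(\<integral>\<^sup>+x. ennreal (f x) \<partial>M) = 1"
    using prob_space.emeasure_space_1[OF assms(1)] assms(2) by (simp add: emeasure_density cong: nn_integral_cong)
  then show i: "integrable M f" using assms by (intro integrableI_nonneg) auto
  have "ennreal (\<integral>x. f x \<partial>M) = 1"
    using * by (subst nn_integral_eq_integral[symmetric]) (use i assms in auto)
  then show "(\<integral>x. f x \<partial>M) = 1" by simp
qed

text \<open>Between probability densities the L1 distance is twice the excess on the set where
  \<open>f\<close> is larger than \<open>g\<close>. As a single set realises it, bounds on the
  measures of sets become bounds in L1.\<close>

lemma L1_density_diff:
  fixes f g :: "'a \<Rightarrow> real"
  assumes f: "prob_space (density M (\<lambda>x. ennreal (f x)))" "f \<in> borel_measurable M" "\<And>x. 0 \<le> f x"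
    and g: "prob_space (density M (\<lambda>x. ennreal (g x)))" "g \<in> borel_measurable M" "\<And>x. 0 \<le> g x"
  obtains B where "B \<in> sets M" "(\<integral>x. \<bar>f x - g x\<bar> \<partial>M) =
    2 * (measure (density M (\<lambda>x. ennreal (f x))) B - measure (density M (\<lambda>x. ennreal (g x))) B)"
proof -
  let ?B = "{x\<in>space M. g x < f x}"
  have B: "?B \<in> sets M" using f(2) g(2) by measurable
  have "measure (density M (\<lambda>x. ennreal (f x))) ?B = (\<integral>x. f x * indicator ?B x \<partial>M)"
       "measure (density M (\<lambda>x. ennreal (g x))) ?B = (\<integral>x. g x * indicator ?B x \<partial>M)"
    using measure_density_real[OF prob_density_integrable(1)[OF f] f(3) B]
      measure_density_real[OF prob_density_integrable(1)[OF g] g(3) B] f(3) g(3)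
    by (auto simp: measure_def intro!: enn2real_ennreal integral_nonneg_AE)
  then show ?thesis
    using that[OF B] L1_diff_eq[OF prob_density_integrable(1)[OF f] prob_density_integrable(1)[OF g]]
      prob_density_integrable(2)[OF f] prob_density_integrable(2)[OF g] by simp
qed

text \<open>A jointly measurable density is obtained as the limit of densities of countably many
  members of the family, chosen so close that the convergence is almost everywhere and
  dominated.\<close>

lemma kernel_joint_density:
  fixes K :: "'a \<Rightarrow> 'b measure" and d :: "nat \<Rightarrow> 'a"
  assumes lam: "prob_space lam" and K: "\<And>a. a \<in> space M \<Longrightarrow> prob_space (K a)" "\<And>a. a \<in> space M \<Longrightarrow> sets (K a) = sets lam"
    and d: "\<And>k. d k \<in> space M" and ac: "\<And>k. absolutely_continuous lam (K (d k))"
    and tv_meas[measurable]: "\<And>k. (\<lambda>a. tv_norm_diff (K a) (K (d k))) \<in> borel_measurable M"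
    and near: "\<And>a e. a \<in> space M \<Longrightarrow> 0 < e \<Longrightarrow> \<exists>k. tv_norm_diff (K a) (K (d k)) < e"
  obtains p :: "'a \<times> 'b \<Rightarrow> real" where "p \<in> borel_measurable (M \<Otimes>\<^sub>M lam)" "\<And>w. 0 \<le> p w"
    "\<And>a. a \<in> space M \<Longrightarrow> K a = density lam (\<lambda>x. ennreal (p (a, x)))"
proof -
  interpret lam: prob_space lam by fact
  define r where "r k x = enn2real (RN_deriv lam (K (d k)) x)" for k x
  have r_meas[measurable]: "r k \<in> borel_measurable lam" for k unfolding r_def by measurable
  have r0: "0 \<le> r k x" for k x by (simp add: r_def)
  have rK: "density lam (\<lambda>x. ennreal (r k x)) = K (d k)" for k
  proof -
    have "AE x in lam. RN_deriv lam (K (d k)) x \<noteq> \<infinity>"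
      using K[OF d] ac by (intro lam.RN_deriv_finite) (auto intro: prob_space_imp_sigma_finite)
    then have "AE x in lam. ennreal (r k x) = RN_deriv lam (K (d k)) x"
      by eventually_elim (simp add: r_def top.not_eq_extremum)
    then have "density lam (\<lambda>x. ennreal (r k x)) = density lam (RN_deriv lam (K (d k)))"
      by (intro density_cong) auto
    also have "\<dots> = K (d k)" by (rule lam.density_RN_deriv[OF ac K(2)[OF d]])
    finally show ?thesis .
  qed
  have pr: "prob_space (density lam (\<lambda>x. ennreal (r k x)))" for k using K(1)[OF d] by (simp add: rK)
  note ri = prob_density_integrable(1)[OF pr r_meas r0]
  have rtv: "(\<integral>x. \<bar>r k x - r l x\<bar> \<partial>lam) \<le> tv_norm_diff (K (d k)) (K (d l))" for k l
  proof -
    obtain B where B: "B \<in> sets lam" "(\<integral>x. \<bar>r k x - r l x\<bar> \<partial>lam) = 2 * (measure (K (d k)) B - measure (K (d l)) B)"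
      using L1_density_diff[OF pr r_meas r0 pr r_meas r0] rK by metis
    have "\<bar>measure (K (d k)) B - measure (K (d l)) B\<bar> \<le> tv_norm_diff (K (d k)) (K (d l)) / 2"
      by (rule measure_diff_le_tv[OF K(1)[OF d] K(1)[OF d]]) (simp add: B K(2)[OF d])
    then show ?thesis using B(2) by argo
  qed
  \<comment> \<open>The least index makes the choice measurable in a. The errors (1/4)^n are
    summable, which yields the almost sure limit and the dominating function
    \<open>w\<close>.\<close>
  define k where "k n a = (LEAST k. tv_norm_diff (K a) (K (d k)) < (1/4)^n)" for n a
  have k_meas[measurable]: "k n \<in> M \<rightarrow>\<^sub>M count_space UNIV" for n unfolding k_def by measurable
  have kn: "tv_norm_diff (K a) (K (d (k n a))) < (1/4)^n" if "a \<in> space M" for a n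
    unfolding k_def by (rule LeastI_ex[OF near[OF that]]) simp
  define q where "q n w = r (k n (fst w)) (snd w)" for n w
  have q_meas[measurable]: "q n \<in> borel_measurable (M \<Otimes>\<^sub>M lam)" for n
    unfolding q_def by (rule measurable_compose_countable[where g="\<lambda>w. k n (fst w)"]) measurable
  \<comment> \<open>Where the sequence diverges, \<open>lim\<close> is an arbitrary value; the
    maximum with 0 keeps \<open>p\<close> nonnegative there too.\<close>
  define p where "p w = max 0 (lim (\<lambda>n. q n w))" for w
  have p_meas[measurable]: "p \<in> borel_measurable (M \<Otimes>\<^sub>M lam)" unfolding p_def by measurable
  show ?thesis
  proof (rule that[OF p_meas])
    show "0 \<le> p w" for w by (simp add: p_def)
    fix a assume a: "a \<in> space M"
    define s where "s n x = q n (a, x)" for n x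
    have s_eq: "s n = r (k n a)" for n by (auto simp: s_def q_def)
    have pa[measurable]: "(\<lambda>x. p (a, x)) \<in> borel_measurable lam"
      using measurable_compose[OF measurable_Pair1'[OF a] p_meas] by simp
    have s_meas[measurable]: "s n \<in> borel_measurable lam" for n by (simp add: s_eq)
    have si: "integrable lam (s n)" for n unfolding s_eq by (rule ri)
    have sd: "(\<integral>x. \<bar>s (Suc n) x - s n x\<bar> \<partial>lam) \<le> 2 * (1/4)^n" for n
    proof -
      have "(\<integral>x. \<bar>s (Suc n) x - s n x\<bar> \<partial>lam) \<le> tv_norm_diff (K (d (k (Suc n) a))) (K (d (k n a)))"
        unfolding s_eq by (rule rtv)
      also have "\<dots> \<le> tv_norm_diff (K (d (k (Suc n) a))) (K a) + tv_norm_diff (K a) (K (d (k n a)))"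
        by (intro tv_norm_diff_triangle K d a) (simp add: K d a)
      also have "tv_norm_diff (K (d (k (Suc n) a))) (K a) = tv_norm_diff (K a) (K (d (k (Suc n) a)))"
        by (rule tv_norm_diff_sym) (simp add: K d a)
      finally have "(\<integral>x. \<bar>s (Suc n) x - s n x\<bar> \<partial>lam) \<le> (1/4)^Suc n + (1/4)^n"
        using kn[OF a, of n] kn[OF a, of "Suc n"] by linarith
      also have "\<dots> \<le> 2 * (1/4)^n" by simp
      finally show ?thesis .
    qed
    have int_summable: "summable (\<lambda>n. \<integral>x. norm \<bar>s (Suc n) x - s n x\<bar> \<partial>lam)"
      by (rule summable_comparison_test[of _ "\<lambda>n. 2 * (1/4)^n"])
         (use sd in \<open>auto intro!: exI[of _ 0] summable_mult summable_geometric simp: integral_nonneg_AE\<close>)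
    have AE_summable: "AE x in lam. summable (\<lambda>n. norm \<bar>s (Suc n) x - s n x\<bar>)"
    proof -
      have "(\<integral>\<^sup>+x. (\<Sum>n. ennreal \<bar>s (Suc n) x - s n x\<bar>) \<partial>lam) = (\<Sum>n. \<integral>\<^sup>+x. ennreal \<bar>s (Suc n) x - s n x\<bar> \<partial>lam)"
        by (rule nn_integral_suminf) measurable
      also have "\<dots> = (\<Sum>n. ennreal (\<integral>x. \<bar>s (Suc n) x - s n x\<bar> \<partial>lam))"
        by (intro suminf_cong nn_integral_eq_integral) (use si in auto)
      also have "\<dots> \<noteq> \<infinity>"
        using int_summable by (subst suminf_ennreal2) (auto simp: integral_nonneg_AE)
      finally have "AE x in lam. (\<Sum>n. ennreal \<bar>s (Suc n) x - s n x\<bar>) \<noteq> \<infinity>"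
        by (intro nn_integral_PInf_AE) auto
      then show ?thesis
      proof eventually_elim
        case (elim x)
        then show ?case by (intro summable_suminf_not_top) auto
      qed
    qed
    define w where "w x = \<bar>s 0 x\<bar> + (\<Sum>n. \<bar>s (Suc n) x - s n x\<bar>)" for x
    have wi: "integrable lam w" unfolding w_def
      by (intro Bochner_Integration.integrable_add integrable_abs si integrable_suminf)
         (use AE_summable int_summable si in auto)
    have tele: "s i x = s 0 x + (\<Sum>n<i. s (Suc n) x - s n x)" for i x
      using sum_lessThan_telescope[of "\<lambda>n. s n x" i] by simp
    have lim: "AE x in lam. (\<lambda>i. s i x) \<longlonglongrightarrow> p (a, x)"
      using AE_summable
    proof eventually_elim
      case (elim x)
      then have "summable (\<lambda>n. s (Suc n) x - s n x)" by (simp add: summable_rabs_cancel)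
      then have "convergent (\<lambda>i. s 0 x + (\<Sum>n<i. s (Suc n) x - s n x))"
        by (intro convergent_add convergent_const) (simp add: summable_iff_convergent)
      then have c: "(\<lambda>i. s i x) \<longlonglongrightarrow> lim (\<lambda>i. s i x)" by (simp add: tele[symmetric] convergent_LIMSEQ_iff)
      have "0 \<le> lim (\<lambda>i. s i x)" by (rule LIMSEQ_le_const[OF c]) (auto simp: s_eq r0)
      then have "p (a, x) = lim (\<lambda>i. s i x)" by (simp add: p_def s_def)
      then show ?case using c by simp
    qed
    have bound: "AE x in lam. norm (s i x) \<le> w x" for i
      using AE_summable
    proof eventually_elim
      case (elim x)
      have "\<bar>s i x\<bar> \<le> \<bar>s 0 x\<bar> + \<bar>\<Sum>n<i. s (Suc n) x - s n x\<bar>" by (subst tele) linarith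
      also have "\<bar>\<Sum>n<i. s (Suc n) x - s n x\<bar> \<le> (\<Sum>n<i. \<bar>s (Suc n) x - s n x\<bar>)" by (rule sum_abs)
      also have "\<dots> \<le> (\<Sum>n. \<bar>s (Suc n) x - s n x\<bar>)" by (rule sum_le_suminf) (use elim in auto)
      finally show ?case by (simp add: w_def)
    qed
    have pi: "integrable lam (\<lambda>x. p (a, x))"
      by (rule integrable_dominated_convergence[OF pa s_meas wi lim bound])
    show "K a = density lam (\<lambda>x. ennreal (p (a, x)))"
    proof (rule measure_eqI)
      show "sets (K a) = sets (density lam (\<lambda>x. ennreal (p (a, x))))" using K(2)[OF a] by simp
      fix A assume "A \<in> sets (K a)"
      then have A[measurable]: "A \<in> sets lam" using K(2)[OF a] by simp
      have "(\<lambda>n. \<integral>x. s n x * indicator A x \<partial>lam) \<longlonglongrightarrow> (\<integral>x. p (a, x) * indicator A x \<partial>lam)"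
      proof (rule integral_dominated_convergence[OF _ _ wi])
        show "AE x in lam. (\<lambda>i. s i x * indicator A x) \<longlonglongrightarrow> p (a, x) * indicator A x"
          using lim by eventually_elim (auto intro: tendsto_intros)
        show "AE x in lam. norm (s i x * indicator A x) \<le> w x" for i
          using bound[of i] by eventually_elim (auto split: split_indicator)
      qed measurable
      moreover have "(\<integral>x. s n x * indicator A x \<partial>lam) = measure (K (d (k n a))) A" for n
        using measure_density_real[OF ri r0 A, of "k n a"]
        by (simp add: rK s_eq measure_def r0 integral_nonneg_AE)
      moreover have "(\<lambda>n. measure (K (d (k n a))) A) \<longlonglongrightarrow> measure (K a) A"
      proof (rule tendsto_dist_iff[THEN iffD2], rule tendsto_sandwich[of "\<lambda>_. 0" _ _ "\<lambda>n. (1/4::real)^n"])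
        have "dist (measure (K (d (k n a))) A) (measure (K a) A) \<le> (1/4)^n" for n
        proof -
          have "\<bar>measure (K a) A - measure (K (d (k n a))) A\<bar> \<le> tv_norm_diff (K a) (K (d (k n a))) / 2"
            by (rule measure_diff_le_tv[OF K(1)[OF a] K(1)[OF d]]) (simp add: K(2)[OF a])
          then show ?thesis
            using kn[OF a, of n] tv_norm_diff_nonneg[OF K(1)[OF a] K(1)[OF d], of "k n a"]
            unfolding dist_real_def by argo
        qed
        then show "\<forall>\<^sub>F n in sequentially. dist (measure (K (d (k n a))) A) (measure (K a) A) \<le> (1/4)^n"
          by simp
      qed (auto simp: LIMSEQ_power_zero)
      ultimately have "(\<integral>x. p (a, x) * indicator A x \<partial>lam) = measure (K a) A"
        using LIMSEQ_unique by fastforce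
      then show "emeasure (K a) A = emeasure (density lam (\<lambda>x. ennreal (p (a, x)))) A"
        using measure_density_real[OF pi _ A] K(1)[OF a]
        by (simp add: p_def finite_measure.emeasure_eq_measure prob_space.finite_measure)
    qed
  qed
qed

section \<open>Posteriors of dominated priors\<close>

text \<open>The partition into B and its complement already shows it: the sum of the two minima is
  at most Q(x')(B) + 1 - Q(x)(B).\<close>

lemma dobrushin_kernel_diff:
  assumes Q: "\<And>x. prob_space (Q x)" "\<And>x. sets (Q x) = sets Y" and B: "B \<in> sets Y"
  shows "measure (Q x) B - measure (Q x') B \<le> 1 - dobrushin Y Q"
proof -
  have spQ: "space (Q x) = space Y" for x by (rule sets_eq_imp_space_eq[OF Q(2)])
  let ?S = "{(\<Sum>A\<in>\<A>. min (measure (Q x) A) (measure (Q y) A)) | x y \<A>.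
            finite \<A> \<and> \<A> \<subseteq> sets Y \<and> partition_on (space Y) \<A>}"
  have bdd: "bdd_below ?S" by (auto intro!: bdd_belowI[of _ 0] sum_nonneg)
  have le: "dobrushin Y Q \<le> (\<Sum>A\<in>\<A>. min (measure (Q x) A) (measure (Q y) A))"
    if "finite \<A>" "\<A> \<subseteq> sets Y" "partition_on (space Y) \<A>" for x y \<A>
    unfolding dobrushin_def by (rule cInf_lower[OF _ bdd]) (use that in blast)
  have ne: "space Y \<noteq> {}" using prob_space.not_empty[OF Q(1)] spQ by auto
  show ?thesis
  \<comment> \<open>Blocks of a partition are nonempty, so the trivial sets are treated
    apart.\<close>
  proof (cases "B = {} \<or> B = space Y")
    case True
    have "dobrushin Y Q \<le> (\<Sum>A\<in>{space Y}. min (measure (Q x) A) (measure (Q x') A))"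
      by (rule le) (use ne in \<open>auto intro: partition_onI\<close>)
    then have "dobrushin Y Q \<le> 1" using prob_space.prob_space[OF Q(1)] by (simp add: spQ)
    moreover have "measure (Q x) B = measure (Q x') B"
      using True prob_space.prob_space[OF Q(1)] by (auto simp: spQ)
    ultimately show ?thesis by simp
  next
    case False
    have Bs: "B \<subseteq> space Y" using B by (rule sets.sets_into_space)
    have "dobrushin Y Q \<le> (\<Sum>A\<in>{B, space Y - B}. min (measure (Q x) A) (measure (Q x') A))"
      by (rule le) (use False B Bs in \<open>auto intro!: partition_onI simp: disjnt_def\<close>)
    also have "\<dots> = min (measure (Q x) B) (measure (Q x') B) + min (measure (Q x) (space Y - B)) (measure (Q x') (space Y - B))"
      using False Bs by (subst sum.insert) auto
    also have "\<dots> = min (measure (Q x) B) (measure (Q x') B) + min (1 - measure (Q x) B) (1 - measure (Q x') B)"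
      using prob_space.prob_compl[OF Q(1), of B x] prob_space.prob_compl[OF Q(1), of B x'] B by (simp add: spQ Q(2))
    finally show ?thesis
      using min.cobounded2[of "measure (Q x) B" "measure (Q x') B"]
        min.cobounded1[of "1 - measure (Q x) B" "1 - measure (Q x') B"] by simp
  qed
qed

text \<open>A prior with a kernel of posteriors given the observation. It is instantiated with the
  measure that dominates all transition laws, and again with the initial distribution, whose
  posterior starts the filter.\<close>

locale bayes_kernel =
  fixes lam :: "'x::polish_space measure" and Q :: "'x \<Rightarrow> 'y measure" and Y :: "'y measure" and \<kappa> :: "'y \<Rightarrow> 'x measure"
  assumes compactX: "compact (UNIV :: 'x set)"
    and lam: "lam \<in> space (prob_algebra borel)"
    and Q[measurable]: "Q \<in> borel \<rightarrow>\<^sub>M prob_algebra Y"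
    and \<kappa>[measurable]: "\<kappa> \<in> Y \<rightarrow>\<^sub>M prob_algebra borel"
    and disint: "\<And>A B. A \<in> sets borel \<Longrightarrow> B \<in> sets Y \<Longrightarrow>
      (\<integral>\<^sup>+x. indicator A x * emeasure (Q x) B \<partial>lam) = (\<integral>\<^sup>+y. emeasure (\<kappa> y) A * indicator B y \<partial>(lam \<bind> Q))"
begin

abbreviation m :: "'y measure" where "m \<equiv> lam \<bind> Q"

lemma sets_lam[simp, measurable_cong]: "sets lam = sets borel"
  and prob_lam: "prob_space lam"
  using lam by (auto simp: space_prob_algebra)

sublocale lam: prob_space lam by (rule prob_lam)

lemma space_lam[simp]: "space lam = UNIV" using sets_eq_imp_space_eq[OF sets_lam] by simp

lemma Q_sub[measurable]: "Q \<in> borel \<rightarrow>\<^sub>M subprob_algebra Y" by (rule measurable_prob_algebraD[OF Q])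
lemma \<kappa>_sub[measurable]: "\<kappa> \<in> Y \<rightarrow>\<^sub>M subprob_algebra borel" by (rule measurable_prob_algebraD[OF \<kappa>])

lemma QD: "prob_space (Q x)" "sets (Q x) = sets Y"
  using measurable_space[OF Q, of x] by (auto simp: space_prob_algebra)

lemma \<kappa>D: "y \<in> space Y \<Longrightarrow> \<kappa> y \<in> beliefs"
  using measurable_space[OF \<kappa>] by (auto simp: beliefs_eq)

lemma measurable_\<kappa>: "y \<in> space Y \<Longrightarrow> f \<in> borel_measurable borel \<Longrightarrow> f \<in> borel_measurable (\<kappa> y)"
  using beliefsD(2)[OF \<kappa>D] measurable_cong_sets by blast

lemma sets_m[simp, measurable_cong]: "sets m = sets Y" by (rule sets_bind'[OF lam Q])
lemma space_m[simp]: "space m = space Y" by (rule sets_eq_imp_space_eq[OF sets_m])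
sublocale m: prob_space m by (rule prob_space_bind'[OF lam Q])

lemma disint_nn_integral:
  assumes f[measurable]: "f \<in> borel_measurable borel" and B[measurable]: "B \<in> sets Y"
  shows "(\<integral>\<^sup>+x. f x * emeasure (Q x) B \<partial>lam) = (\<integral>\<^sup>+y. (\<integral>\<^sup>+x. f x \<partial>\<kappa> y) * indicator B y \<partial>m)"
  using f
proof (induction rule: borel_measurable_induct)
  case (cong f g)
  then have "f = g" by auto
  then show ?case using cong by simp
next
  case (set A)
  have "(\<integral>\<^sup>+x. indicator A x \<partial>\<kappa> y) = emeasure (\<kappa> y) A" if "y \<in> space m" for y
    using set \<kappa>D[of y] that beliefsD(2)[of "\<kappa> y"] by simp
  then have "(\<integral>\<^sup>+y. (\<integral>\<^sup>+x. indicator A x \<partial>\<kappa> y) * indicator B y \<partial>m) = (\<integral>\<^sup>+y. emeasure (\<kappa> y) A * indicator B y \<partial>m)"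
    by (intro nn_integral_cong) simp
  then show ?case using disint[OF set B] by simp
next
  case (mult u c)
  note [measurable] = mult(2)
  have "(\<integral>\<^sup>+x. c * u x * emeasure (Q x) B \<partial>lam) = c * (\<integral>\<^sup>+x. u x * emeasure (Q x) B \<partial>lam)"
    by (subst nn_integral_cmult[symmetric]) (auto simp: mult.assoc)
  also have "\<dots> = c * (\<integral>\<^sup>+y. (\<integral>\<^sup>+x. u x \<partial>\<kappa> y) * indicator B y \<partial>m)" using mult by simp
  also have "\<dots> = (\<integral>\<^sup>+y. (\<integral>\<^sup>+x. c * u x \<partial>\<kappa> y) * indicator B y \<partial>m)"
  proof (subst nn_integral_cmult[symmetric])
    show "(\<integral>\<^sup>+y. c * ((\<integral>\<^sup>+x. u x \<partial>\<kappa> y) * indicator B y) \<partial>m) = (\<integral>\<^sup>+y. (\<integral>\<^sup>+x. c * u x \<partial>\<kappa> y) * indicator B y \<partial>m)"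
    proof (rule nn_integral_cong)
      fix y assume "y \<in> space m"
      then have "u \<in> borel_measurable (\<kappa> y)" using mult(2) by (auto intro: measurable_\<kappa>)
      then show "c * ((\<integral>\<^sup>+x. u x \<partial>\<kappa> y) * indicator B y) = (\<integral>\<^sup>+x. c * u x \<partial>\<kappa> y) * indicator B y"
        by (simp add: nn_integral_cmult mult.assoc)
    qed
  qed measurable
  finally show ?case .
next
  case (add u v)
  note [measurable] = add(1) add(3)
  have "(\<integral>\<^sup>+x. (v x + u x) * emeasure (Q x) B \<partial>lam) =
      (\<integral>\<^sup>+y. (\<integral>\<^sup>+x. v x \<partial>\<kappa> y) * indicator B y \<partial>m) + (\<integral>\<^sup>+y. (\<integral>\<^sup>+x. u x \<partial>\<kappa> y) * indicator B y \<partial>m)"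
    using add by (simp add: distrib_right nn_integral_add)
  also have "\<dots> = (\<integral>\<^sup>+y. (\<integral>\<^sup>+x. v x + u x \<partial>\<kappa> y) * indicator B y \<partial>m)"
  proof (subst nn_integral_add[symmetric])
    show "(\<integral>\<^sup>+y. (\<integral>\<^sup>+x. v x \<partial>\<kappa> y) * indicator B y + (\<integral>\<^sup>+x. u x \<partial>\<kappa> y) * indicator B y \<partial>m) =
      (\<integral>\<^sup>+y. (\<integral>\<^sup>+x. v x + u x \<partial>\<kappa> y) * indicator B y \<partial>m)"
    proof (rule nn_integral_cong)
      fix y assume "y \<in> space m"
      then have "u \<in> borel_measurable (\<kappa> y)" "v \<in> borel_measurable (\<kappa> y)"
        using add by (auto intro: measurable_\<kappa>)
      then show "(\<integral>\<^sup>+x. v x \<partial>\<kappa> y) * indicator B y + (\<integral>\<^sup>+x. u x \<partial>\<kappa> y) * indicator B y = (\<integral>\<^sup>+x. v x + u x \<partial>\<kappa> y) * indicator B y"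
        by (simp add: nn_integral_add distrib_right)
    qed
  qed measurable
  finally show ?case .
next
  case (seq U)
  note [measurable] = seq(1)
  have inc: "incseq (\<lambda>i. U i x)" for x using seq(3) by (auto simp: incseq_def le_fun_def)
  have "(\<integral>\<^sup>+x. (SUP i. U i) x * emeasure (Q x) B \<partial>lam) = (\<integral>\<^sup>+x. (SUP i. U i x * emeasure (Q x) B) \<partial>lam)"
    by (simp add: SUP_mult_right_ennreal image_comp)
  also have "\<dots> = (SUP i. \<integral>\<^sup>+x. U i x * emeasure (Q x) B \<partial>lam)"
    using seq(3) by (intro nn_integral_monotone_convergence_SUP) (auto simp: incseq_def le_fun_def intro!: mult_right_mono)
  also have "\<dots> = (SUP i. \<integral>\<^sup>+y. (\<integral>\<^sup>+x. U i x \<partial>\<kappa> y) * indicator B y \<partial>m)" using seq by simp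
  also have "\<dots> = (\<integral>\<^sup>+y. (SUP i. (\<integral>\<^sup>+x. U i x \<partial>\<kappa> y) * indicator B y) \<partial>m)"
    using seq(3) by (intro nn_integral_monotone_convergence_SUP[symmetric])
      (auto simp: incseq_def le_fun_def intro!: mult_right_mono nn_integral_mono)
  also have "\<dots> = (\<integral>\<^sup>+y. (\<integral>\<^sup>+x. (SUP i. U i) x \<partial>\<kappa> y) * indicator B y \<partial>m)"
  proof (rule nn_integral_cong)
    fix y assume "y \<in> space m"
    then have "U i \<in> borel_measurable (\<kappa> y)" for i
      using seq by (auto intro: measurable_\<kappa>)
    then have "(\<integral>\<^sup>+x. (SUP i. U i) x \<partial>\<kappa> y) = (SUP i. \<integral>\<^sup>+x. U i x \<partial>\<kappa> y)"
      using nn_integral_monotone_convergence_SUP[of U "\<kappa> y"] seq(3) by (simp add: image_comp)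
    then show "(SUP i. (\<integral>\<^sup>+x. U i x \<partial>\<kappa> y) * indicator B y) = (\<integral>\<^sup>+x. (SUP i. U i) x \<partial>\<kappa> y) * indicator B y"
      by (simp add: SUP_mult_right_ennreal)
  qed
  finally show ?case .
qed

section \<open>Bayes' formula for priors with a density\<close>

definition like :: "('x \<Rightarrow> real) \<Rightarrow> 'y \<Rightarrow> ennreal" where
  "like f y = (\<integral>\<^sup>+x. ennreal (f x) \<partial>\<kappa> y)"

text \<open>Bayes' formula for the prior with density \<open>f\<close>, where
  \<open>like f y\<close> is the likelihood of y relative to \<open>m\<close>. Where it is 0 or
  infinite, the value \<open>\<kappa> y\<close> keeps \<open>post f y\<close> a belief; for a
  probability density \<open>f\<close> the observation avoids such y almost surely.\<close>

definition post :: "('x \<Rightarrow> real) \<Rightarrow> 'y \<Rightarrow> 'x measure" where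
  "post f y = (if like f y = 0 \<or> like f y = \<infinity> then \<kappa> y else density (\<kappa> y) (\<lambda>x. ennreal (f x) / like f y))"

lemma like_measurable[measurable]:
  assumes [measurable]: "f \<in> borel_measurable borel"
  shows "like f \<in> borel_measurable Y"
  unfolding like_def by measurable

lemma emeasure_post:
  assumes [measurable]: "f \<in> borel_measurable borel" "A \<in> sets borel" and y: "y \<in> space Y" and "like f y \<noteq> \<infinity>"
  shows "emeasure (post f y) A * like f y = (\<integral>\<^sup>+x. ennreal (f x) * indicator A x \<partial>\<kappa> y)"
proof -
  have [measurable_cong, simp]: "sets (\<kappa> y) = sets borel" by (rule beliefsD(2)[OF \<kappa>D[OF y]])
  show ?thesis
  proof (cases "like f y = 0")
    case True
    have "(\<integral>\<^sup>+x. ennreal (f x) * indicator A x \<partial>\<kappa> y) \<le> like f y"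
      unfolding like_def by (rule nn_integral_mono) (auto split: split_indicator)
    then show ?thesis using True by simp
  next
    case False
    have "emeasure (post f y) A * like f y = (\<integral>\<^sup>+x. ennreal (f x) / like f y * indicator A x \<partial>\<kappa> y) * like f y"
    proof -
      have "emeasure (post f y) A = (\<integral>\<^sup>+x. ennreal (f x) / like f y * indicator A x \<partial>\<kappa> y)"
        using False assms(4) by (simp add: post_def, subst emeasure_density) (auto intro!: measurable_\<kappa>[OF y])
      then show ?thesis by simp
    qed
    also have "\<dots> = (\<integral>\<^sup>+x. ennreal (f x) / like f y * indicator A x * like f y \<partial>\<kappa> y)"
      by (rule nn_integral_multc[symmetric], rule measurable_\<kappa>[OF y]) measurable
    also have "\<dots> = (\<integral>\<^sup>+x. ennreal (f x) * indicator A x \<partial>\<kappa> y)"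
    proof (rule nn_integral_cong)
      fix x
      have "ennreal (f x) / like f y * like f y = ennreal (f x)"
        using False assms(4) by (metis ennreal_divide_times ennreal_divide_self infinity_ennreal_def mult.right_neutral top.not_eq_extremum zero_less_iff_neq_zero)
      then show "ennreal (f x) / like f y * indicator A x * like f y = ennreal (f x) * indicator A x"
        by (simp add: indicator_def)
    qed
    finally show ?thesis .
  qed
qed

lemma post_belief:
  assumes [measurable]: "f \<in> borel_measurable borel" and y: "y \<in> space Y"
  shows "post f y \<in> beliefs"
proof (cases "like f y = 0 \<or> like f y = \<infinity>")
  case False
  have [measurable_cong, simp]: "sets (\<kappa> y) = sets borel" by (rule beliefsD(2)[OF \<kappa>D[OF y]])
  have "emeasure (post f y) UNIV = 1"
  proof -
    have *: "emeasure (post f y) UNIV * like f y = like f y"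
      using emeasure_post[of f UNIV y] False y by (simp add: like_def)
    have "emeasure (post f y) UNIV = emeasure (post f y) UNIV * like f y / like f y"
      using False by (simp add: ennreal_mult_divide_eq)
    then show ?thesis using * False by (simp add: ennreal_divide_self top.not_eq_extremum zero_less_iff_neq_zero)
  qed
  moreover have "sets (post f y) = sets borel" using False by (simp add: post_def)
  ultimately show ?thesis using sets_eq_imp_space_eq[of "post f y" borel] by (auto simp: beliefs_def intro: prob_spaceI)
qed (use \<kappa>D[OF y] in \<open>auto simp: post_def\<close>)

lemma obs_law_density:
  assumes [measurable]: "f \<in> borel_measurable borel"
  shows "density lam (\<lambda>x. ennreal (f x)) \<bind> Q = density m (like f)"
proof (rule measure_eqI)
  have Qd: "Q \<in> density lam (\<lambda>x. ennreal (f x)) \<rightarrow>\<^sub>M subprob_algebra Y" by simp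
  show s: "sets (density lam (\<lambda>x. ennreal (f x)) \<bind> Q) = sets (density m (like f))"
    by (subst sets_bind[where N=Y]) (auto simp: QD)
  fix B assume "B \<in> sets (density lam (\<lambda>x. ennreal (f x)) \<bind> Q)"
  then have B[measurable]: "B \<in> sets Y" using s by simp
  have "emeasure (density lam (\<lambda>x. ennreal (f x)) \<bind> Q) B = (\<integral>\<^sup>+x. emeasure (Q x) B \<partial>density lam (\<lambda>x. ennreal (f x)))"
    by (rule emeasure_bind[OF _ Qd B]) simp
  also have "\<dots> = (\<integral>\<^sup>+x. ennreal (f x) * emeasure (Q x) B \<partial>lam)"
    by (subst nn_integral_density) auto
  also have "\<dots> = (\<integral>\<^sup>+y. like f y * indicator B y \<partial>m)"
    unfolding like_def by (rule disint_nn_integral) auto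
  finally show "emeasure (density lam (\<lambda>x. ennreal (f x)) \<bind> Q) B = emeasure (density m (like f)) B"
    by (simp add: emeasure_density)
qed

lemma like_finite:
  assumes [measurable]: "f \<in> borel_measurable borel" and p: "prob_space (density lam (\<lambda>x. ennreal (f x)))"
  shows "AE y in m. like f y \<noteq> \<infinity>"
proof (rule nn_integral_PInf_AE)
  have "prob_space (density lam (\<lambda>x. ennreal (f x)) \<bind> Q)"
    by (rule prob_space_bind'[OF _ Q]) (use p in \<open>auto simp: space_prob_algebra\<close>)
  then have "prob_space (density m (like f))" by (simp add: obs_law_density)
  from prob_space.emeasure_space_1[OF this] show "(\<integral>\<^sup>+y. like f y \<partial>m) \<noteq> \<infinity>"
    by (auto simp: emeasure_density cong: nn_integral_cong_simp)
qed measurable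

text \<open>The density may depend on a parameter, since a filter version has to be measurable in
  belief, action and observation together.\<close>

lemma measurable_post_param:
  assumes f[measurable]: "(\<lambda>(w, x). f w x) \<in> borel_measurable (N \<Otimes>\<^sub>M borel)"
    and Yw[measurable]: "v \<in> N \<rightarrow>\<^sub>M Y"
  shows "(\<lambda>w. post (f w) (v w)) \<in> N \<rightarrow>\<^sub>M prob_algebra borel"
proof -
  have fw[measurable]: "f w \<in> borel_measurable borel" if "w \<in> space N" for w
    using measurable_compose[OF measurable_Pair1'[OF that] f] by simp
  have v: "v w \<in> space Y" if "w \<in> space N" for w using measurable_space[OF Yw that] .
  have kv: "(\<lambda>w. \<kappa> (v w)) \<in> N \<rightarrow>\<^sub>M subprob_algebra borel" by measurable
  have like_m[measurable]: "(\<lambda>w. like (f w) (v w)) \<in> borel_measurable N"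
    unfolding like_def by (rule nn_integral_measurable_subprob_algebra2[OF _ kv]) measurable
  show ?thesis
  proof (rule measurable_prob_algebra_generated[where \<Omega>=UNIV and G="sets borel"])
    show "sets borel = sigma_sets UNIV (sets (borel :: 'x measure))"
      by (metis sets.sigma_sets_eq space_borel)
    show "Int_stable (sets (borel :: 'x measure))" by (auto simp: Int_stable_def)
    show "prob_space (post (f w) (v w))" "sets (post (f w) (v w)) = sets borel" if "w \<in> space N" for w
      using beliefsD[OF post_belief[OF fw[OF that] v[OF that]]] by auto
    fix A :: "'x set" assume A[measurable]: "A \<in> sets borel"
    have "(\<lambda>w. if like (f w) (v w) = 0 \<or> like (f w) (v w) = \<infinity> then emeasure (\<kappa> (v w)) A
        else \<integral>\<^sup>+x. ennreal (f w x) / like (f w) (v w) * indicator A x \<partial>\<kappa> (v w)) \<in> borel_measurable N"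
    proof (intro measurable_If)
      show "(\<lambda>w. \<integral>\<^sup>+x. ennreal (f w x) / like (f w) (v w) * indicator A x \<partial>\<kappa> (v w)) \<in> borel_measurable N"
        by (rule nn_integral_measurable_subprob_algebra2[OF _ kv]) measurable
    qed measurable
    also have "?this \<longleftrightarrow> (\<lambda>w. emeasure (post (f w) (v w)) A) \<in> borel_measurable N"
    proof (rule measurable_cong)
      fix w assume w: "w \<in> space N"
      have "sets (\<kappa> (v w)) = sets borel" by (rule beliefsD(2)[OF \<kappa>D[OF v[OF w]]])
      moreover have "(\<lambda>x. ennreal (f w x) / like (f w) (v w)) \<in> borel_measurable (\<kappa> (v w))"
        by (rule measurable_\<kappa>[OF v[OF w]]) (use fw[OF w] in measurable)
      ultimately show "(if like (f w) (v w) = 0 \<or> like (f w) (v w) = \<infinity> then emeasure (\<kappa> (v w)) A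
        else \<integral>\<^sup>+x. ennreal (f w x) / like (f w) (v w) * indicator A x \<partial>\<kappa> (v w)) = emeasure (post (f w) (v w)) A"
        by (simp add: post_def emeasure_density)
    qed
    finally show "(\<lambda>w. emeasure (post (f w) (v w)) A) \<in> borel_measurable N" .
  qed auto
qed

lemma measurable_post:
  assumes [measurable]: "f \<in> borel_measurable borel"
  shows "post f \<in> Y \<rightarrow>\<^sub>M prob_algebra borel"
  by (rule measurable_post_param[of "\<lambda>_. f" Y "\<lambda>y. y"]) measurable

lemma measurable_emeasure_post:
  assumes "f \<in> borel_measurable borel" "A \<in> sets borel"
  shows "(\<lambda>y. emeasure (post f y) A) \<in> borel_measurable Y"
  by (rule measurable_emeasure_kernel[OF measurable_prob_algebraD[OF measurable_post] assms(2)]) fact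

lemma joint_law_rectangle:
  assumes [measurable]: "f \<in> borel_measurable borel" "A \<in> sets borel" "B \<in> sets Y"
    and p: "prob_space (density lam (\<lambda>x. ennreal (f x)))"
  shows "(\<integral>\<^sup>+x. emeasure (Q x) B * indicator A x \<partial>density lam (\<lambda>x. ennreal (f x))) =
     (\<integral>\<^sup>+y. emeasure (post f y) A * indicator B y \<partial>(density lam (\<lambda>x. ennreal (f x)) \<bind> Q))"
proof -
  have fin: "AE y in m. like f y \<noteq> \<infinity>"
    by (rule like_finite[OF assms(1) p])
  have post_meas: "(\<lambda>y. emeasure (post f y) A) \<in> borel_measurable m"
    using measurable_emeasure_post[OF assms(1,2)] by (simp add: measurable_cong_sets[OF sets_m refl])
  have "(\<integral>\<^sup>+x. emeasure (Q x) B * indicator A x \<partial>density lam (\<lambda>x. ennreal (f x))) =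
      (\<integral>\<^sup>+x. ennreal (f x) * indicator A x * emeasure (Q x) B \<partial>lam)"
    by (subst nn_integral_density) (auto simp: mult_ac)
  also have "\<dots> = (\<integral>\<^sup>+y. (\<integral>\<^sup>+x. ennreal (f x) * indicator A x \<partial>\<kappa> y) * indicator B y \<partial>m)"
    by (rule disint_nn_integral) auto
  also have "\<dots> = (\<integral>\<^sup>+y. like f y * (emeasure (post f y) A * indicator B y) \<partial>m)"
  proof (rule nn_integral_cong_AE)
    show "AE y in m. (\<integral>\<^sup>+x. ennreal (f x) * indicator A x \<partial>\<kappa> y) * indicator B y =
        like f y * (emeasure (post f y) A * indicator B y)"
      using fin by (rule AE_mp) (auto intro!: AE_I2 simp: emeasure_post[symmetric] mult_ac)
  qed
  also have "\<dots> = (\<integral>\<^sup>+y. emeasure (post f y) A * indicator B y \<partial>density m (like f))"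
    using post_meas by (subst nn_integral_density) auto
  finally show ?thesis by (simp add: obs_law_density)
qed

text \<open>Multiplying by the likelihood a of \<open>f\<close> avoids dividing by it. With b the
  likelihood of \<open>g\<close>, a times the difference of the posterior integrals of \<phi> is the
  integral of \<open>(f - a / b * g) * \<phi>\<close> against \<open>\<kappa> y\<close>. The first
  factor has integral 0, so \<phi> may be centred and is then at most half of the diameter.\<close>

lemma kant_post_le:
  assumes f[measurable]: "f \<in> borel_measurable borel" "\<And>x. 0 \<le> f x" and g[measurable]: "g \<in> borel_measurable borel" "\<And>x. 0 \<le> g x"
    and y: "y \<in> space Y" and fin: "like f y \<noteq> \<infinity>" "like g y \<noteq> \<infinity>"
  shows "kant (post f y) (post g y) * enn2real (like f y) \<le>
    diameter (UNIV :: 'x set) / 2 * ((\<integral>x. \<bar>f x - g x\<bar> \<partial>\<kappa> y) + \<bar>enn2real (like f y) - enn2real (like g y)\<bar>)"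
proof -
  let ?D = "diameter (UNIV :: 'x set)"
  define a b where "a = enn2real (like f y)" and "b = enn2real (like g y)"
  interpret k: prob_space "\<kappa> y" by (rule beliefsD(1)[OF \<kappa>D[OF y]])
  note mk = measurable_\<kappa>[OF y]
  have D0: "0 \<le> ?D" using dist_le_diameter[OF compactX, of undefined undefined] by simp
  have fm: "f \<in> borel_measurable (\<kappa> y)" and gm: "g \<in> borel_measurable (\<kappa> y)"
    by (rule mk, fact)+
  have fi: "integrable (\<kappa> y) f" and gi: "integrable (\<kappa> y) g"
    using f(2) g(2) fin fm gm by (auto intro!: integrableI_nonneg simp: like_def top.not_eq_extremum)
  have a: "(\<integral>x. f x \<partial>\<kappa> y) = a" and b: "(\<integral>x. g x \<partial>\<kappa> y) = b"
    using f(2) g(2) fm gm by (auto simp: a_def b_def like_def intro!: integral_eq_nn_integral)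
  have a0: "0 \<le> a" "0 \<le> b" by (auto simp: a_def b_def)
  define I where "I = (\<integral>x. \<bar>f x - g x\<bar> \<partial>\<kappa> y)"
  have I0: "0 \<le> I" by (simp add: I_def)
  have Iab: "\<bar>a - b\<bar> \<le> I"
    using integral_abs_bound[of "\<kappa> y" "\<lambda>x. f x - g x"] fi gi by (simp add: I_def a b)
  have like_eq: "like f y = ennreal a" "like g y = ennreal b"
    using fin by (auto simp: a_def b_def top.not_eq_extremum)
  note pf = post_belief[OF f(1) y] and pg = post_belief[OF g(1) y]
  have "kant (post f y) (post g y) * a \<le> ?D / 2 * (I + \<bar>a - b\<bar>)"
  proof (cases "a = 0")
    case True
    then show ?thesis using D0 I0 by simp
  next
    case False
    then have "0 < a" using a0 by simp
    have post_f: "post f y = density (\<kappa> y) (\<lambda>x. ennreal (f x / a))"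
      using \<open>0 < a\<close> f(2) by (simp add: post_def like_eq divide_ennreal)
    show ?thesis
    proof (cases "b = 0")
      \<comment> \<open>Here \<open>post g y\<close> is the fallback value. But then
        \<open>a = \<bar>a - b\<bar>\<close> and \<open>a \<le> I\<close>, so bounding
        \<open>kant\<close> by the diameter is enough.\<close>
      case True
      have "kant (post f y) (post g y) * a \<le> ?D * a"
        using kant_le_diameter[OF compactX pf pg] \<open>0 < a\<close> by (intro mult_right_mono) auto
      also have "\<dots> = ?D / 2 * (a + a)" by simp
      also have "\<dots> \<le> ?D / 2 * (I + \<bar>a - b\<bar>)" using True Iab \<open>0 < a\<close> D0 by (intro mult_left_mono) auto
      finally show ?thesis .
    next
      case False
      then have "0 < b" using a0 by simp
      have post_g: "post g y = density (\<kappa> y) (\<lambda>x. ennreal (g x / b))"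
        using \<open>0 < b\<close> g(2) by (simp add: post_def like_eq divide_ennreal)
      have "kant (post f y) (post g y) \<le> ?D / 2 * (I + \<bar>a - b\<bar>) / a"
      proof (rule kant_le[OF compactX])
        fix \<phi> :: "'x \<Rightarrow> real" assume \<phi>: "\<phi> \<in> lip1"
        obtain c where c: "\<And>x. \<bar>\<phi> x - c\<bar> \<le> ?D / 2" using lip1_midpoint[OF compactX \<phi>] by metis
        have \<phi>m: "\<phi> \<in> borel_measurable borel"
          by (rule borel_measurable_continuous_onI[OF lip1_continuous[OF compactX \<phi>]])
        obtain B where B: "\<And>x. \<bar>\<phi> x\<bar> \<le> B" using continuous_bounded[OF compactX lip1_continuous[OF compactX \<phi>]] by metis
        have bi: "integrable (\<kappa> y) (\<lambda>x. h x * \<phi> x)" if "integrable (\<kappa> y) h" for h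
        proof (rule Bochner_Integration.integrable_bound[OF integrable_mult_left[OF integrable_abs[OF that], of B]])
          show "(\<lambda>x. h x * \<phi> x) \<in> borel_measurable (\<kappa> y)"
            using borel_measurable_integrable[OF that] mk[OF \<phi>m] by measurable
          show "AE x in \<kappa> y. norm (h x * \<phi> x) \<le> norm (\<bar>h x\<bar> * B)"
            using B by (intro AE_I2) (simp add: abs_mult mult_left_mono order_trans[OF B abs_ge_self])
        qed
        have expand: "(f x - r * g x) * (\<phi> x - c) = (f x * \<phi> x - r * (g x * \<phi> x)) - (c * f x - c * r * g x)" for r x
          by (simp add: algebra_simps)
        have e1: "(\<integral>x. \<phi> x \<partial>post f y) = (\<integral>x. f x * \<phi> x \<partial>\<kappa> y) / a"
          unfolding post_f using f(2) fm mk[OF \<phi>m] \<open>0 < a\<close> by (subst integral_density) auto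
        have e2: "(\<integral>x. \<phi> x \<partial>post g y) = (\<integral>x. g x * \<phi> x \<partial>\<kappa> y) / b"
          unfolding post_g using g(2) gm mk[OF \<phi>m] \<open>0 < b\<close> by (subst integral_density) auto
        have "a * ((\<integral>x. \<phi> x \<partial>post f y) - (\<integral>x. \<phi> x \<partial>post g y)) =
            (\<integral>x. f x * \<phi> x \<partial>\<kappa> y) - a / b * (\<integral>x. g x * \<phi> x \<partial>\<kappa> y)"
          using \<open>0 < a\<close> by (simp add: e1 e2 right_diff_distrib)
        also have "\<dots> = (\<integral>x. (f x - a / b * g x) * (\<phi> x - c) \<partial>\<kappa> y)"
        proof -
          have "(\<integral>x. (f x - a / b * g x) * (\<phi> x - c) \<partial>\<kappa> y) =
             (\<integral>x. (f x * \<phi> x - a / b * (g x * \<phi> x)) - (c * f x - c * (a / b) * g x) \<partial>\<kappa> y)"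
            by (rule Bochner_Integration.integral_cong[OF refl]) (rule expand)
          also have "\<dots> = (\<integral>x. f x * \<phi> x \<partial>\<kappa> y) - a / b * (\<integral>x. g x * \<phi> x \<partial>\<kappa> y) - (c * a - c * (a / b) * b)"
            using bi[OF fi] bi[OF gi] fi gi by (simp add: a b)
          finally show ?thesis using \<open>0 < b\<close> by simp
        qed
        finally have eq: "a * ((\<integral>x. \<phi> x \<partial>post f y) - (\<integral>x. \<phi> x \<partial>post g y)) =
            (\<integral>x. (f x - a / b * g x) * (\<phi> x - c) \<partial>\<kappa> y)" .
        have "\<bar>\<integral>x. (f x - a / b * g x) * (\<phi> x - c) \<partial>\<kappa> y\<bar> \<le> (\<integral>x. (\<bar>f x - g x\<bar> + \<bar>a - b\<bar> / b * g x) * (?D / 2) \<partial>\<kappa> y)"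
        proof (rule order_trans[OF integral_abs_bound], rule integral_mono)
          show "integrable (\<kappa> y) (\<lambda>x. \<bar>(f x - a / b * g x) * (\<phi> x - c)\<bar>)"
            unfolding expand
            by (intro integrable_abs Bochner_Integration.integrable_diff integrable_mult_right bi fi gi)
          show "integrable (\<kappa> y) (\<lambda>x. (\<bar>f x - g x\<bar> + \<bar>a - b\<bar> / b * g x) * (?D / 2))"
            using fi gi by simp
          fix x
          \<comment> \<open>Splitting off the difference of the densities leaves a term with
            integral \<open>\<bar>a - b\<bar>\<close>, since \<open>g\<close> has integral
            b.\<close>
          have "f x - a / b * g x = (f x - g x) - (a - b) / b * g x" using \<open>0 < b\<close> by (simp add: field_simps)
          also have "\<bar>\<dots>\<bar> \<le> \<bar>f x - g x\<bar> + \<bar>(a - b) / b * g x\<bar>" by (rule abs_triangle_ineq4)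
          also have "\<bar>(a - b) / b * g x\<bar> = \<bar>a - b\<bar> / b * g x" using \<open>0 < b\<close> g(2)[of x] by (simp add: abs_mult)
          finally have "\<bar>f x - a / b * g x\<bar> \<le> \<bar>f x - g x\<bar> + \<bar>a - b\<bar> / b * g x" .
          then show "\<bar>(f x - a / b * g x) * (\<phi> x - c)\<bar> \<le> (\<bar>f x - g x\<bar> + \<bar>a - b\<bar> / b * g x) * (?D / 2)"
            unfolding abs_mult using c[of x] by (intro mult_mono) auto
        qed
        also have "\<dots> = (I + \<bar>a - b\<bar>) * (?D / 2)"
          using fi gi \<open>0 < b\<close> by (simp add: I_def b)
        finally have "a * \<bar>(\<integral>x. \<phi> x \<partial>post f y) - (\<integral>x. \<phi> x \<partial>post g y)\<bar> \<le> ?D / 2 * (I + \<bar>a - b\<bar>)"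
          unfolding eq[symmetric] abs_mult using \<open>0 < a\<close> by (simp add: mult.commute)
        then show "\<bar>(\<integral>x. \<phi> x \<partial>post f y) - (\<integral>x. \<phi> x \<partial>post g y)\<bar> \<le> ?D / 2 * (I + \<bar>a - b\<bar>) / a"
          using \<open>0 < a\<close> by (simp add: pos_le_divide_eq mult.commute)
      qed
      then show ?thesis using \<open>0 < a\<close> by (simp add: pos_le_divide_eq)
    qed
  qed
  then show ?thesis by (simp add: a_def b_def I_def)
qed

text \<open>Dobrushin's contraction. The L1 distance of the observation laws is realised on one set
  B, where it compares integrals of \<open>measure (Q x) B\<close>. This function of x oscillates by
  at most 1 - \<delta>(Q), and it may be centred because the two densities have equal mass.\<close>

lemma like_L1_contraction:
  assumes f[measurable]: "f \<in> borel_measurable borel" "\<And>x. 0 \<le> f x" "prob_space (density lam (\<lambda>x. ennreal (f x)))"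
    and g[measurable]: "g \<in> borel_measurable borel" "\<And>x. 0 \<le> g x" "prob_space (density lam (\<lambda>x. ennreal (g x)))"
  shows "(\<integral>y. \<bar>enn2real (like f y) - enn2real (like g y)\<bar> \<partial>m) \<le> (1 - dobrushin Y Q) * (\<integral>x. \<bar>f x - g x\<bar> \<partial>lam)"
proof -
  have fi: "integrable lam f" "(\<integral>x. f x \<partial>lam) = 1" using prob_density_integrable[OF f(3) _ f(2)] f(1) by auto
  have gi: "integrable lam g" "(\<integral>x. g x \<partial>lam) = 1" using prob_density_integrable[OF g(3) _ g(2)] g(1) by auto
  have dens: "density m (\<lambda>y. ennreal (enn2real (like h y))) = density lam (\<lambda>x. ennreal (h x)) \<bind> Q"
    if h[measurable]: "h \<in> borel_measurable borel" and p: "prob_space (density lam (\<lambda>x. ennreal (h x)))" for h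
  proof -
    have "AE y in m. like h y \<noteq> \<infinity>" by (rule like_finite[OF h p])
    then have "AE y in m. ennreal (enn2real (like h y)) = like h y"
      by eventually_elim (simp add: top.not_eq_extremum)
    then show ?thesis unfolding obs_law_density[OF h] by (intro density_cong) auto
  qed
  have pr: "prob_space (density lam (\<lambda>x. ennreal (h x)) \<bind> Q)" if "prob_space (density lam (\<lambda>x. ennreal (h x)))" for h
    by (rule prob_space_bind'[OF _ Q]) (use that in \<open>auto simp: space_prob_algebra\<close>)
  have mq: "measure (density lam (\<lambda>x. ennreal (h x)) \<bind> Q) B = (\<integral>x. h x * measure (Q x) B \<partial>lam)"
    if [measurable]: "h \<in> borel_measurable borel" "B \<in> sets Y" and "\<And>x. 0 \<le> h x" "prob_space (density lam (\<lambda>x. ennreal (h x)))" for h B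
  proof -
    interpret d: prob_space "density lam (\<lambda>x. ennreal (h x))" by fact
    have "measure (density lam (\<lambda>x. ennreal (h x)) \<bind> Q) B = (\<integral>x. measure (Q x) B \<partial>density lam (\<lambda>x. ennreal (h x)))"
      by (rule d.measure_bind[where N=Y]) auto
    also have "\<dots> = (\<integral>x. h x * measure (Q x) B \<partial>lam)"
      using that(3) by (subst integral_density) auto
    finally show ?thesis .
  qed
  obtain B where "B \<in> sets m" and B: "(\<integral>y. \<bar>enn2real (like f y) - enn2real (like g y)\<bar> \<partial>m) =
      2 * (measure (density lam (\<lambda>x. ennreal (f x)) \<bind> Q) B - measure (density lam (\<lambda>x. ennreal (g x)) \<bind> Q) B)"
    using L1_density_diff[of m "\<lambda>y. enn2real (like f y)" "\<lambda>y. enn2real (like g y)"] dens f g pr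
    by (auto simp: measurable_cong_sets[OF sets_m refl])
  then have Bm[measurable]: "B \<in> sets Y" by simp
  define \<phi> where "\<phi> x = measure (Q x) B" for x
  have [measurable]: "\<phi> \<in> borel_measurable borel" unfolding \<phi>_def by measurable
  have \<phi>01: "0 \<le> \<phi> x" "\<phi> x \<le> 1" for x using QD(1) by (auto simp: \<phi>_def prob_space.prob_le_1)
  obtain c where c: "\<And>x. \<bar>\<phi> x - c\<bar> \<le> (1 - dobrushin Y Q) / 2"
  proof -
    have "\<bar>\<phi> a - \<phi> b\<bar> \<le> 1 - dobrushin Y Q" for a b
      using dobrushin_kernel_diff[of Q Y B a b] dobrushin_kernel_diff[of Q Y B b a] QD Bm
      unfolding \<phi>_def by (simp add: abs_le_iff)
    then show ?thesis using exists_midpoint[of UNIV \<phi> "1 - dobrushin Y Q"] that by auto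
  qed
  have hi: "integrable lam (\<lambda>x. h x * \<phi> x)" if "integrable lam h" for h
  proof (rule Bochner_Integration.integrable_bound[OF that])
    show "(\<lambda>x. h x * \<phi> x) \<in> borel_measurable lam"
      using borel_measurable_integrable[OF that] by measurable
    show "AE x in lam. norm (h x * \<phi> x) \<le> norm (h x)"
      using \<phi>01 by (intro AE_I2) (simp add: abs_mult mult_left_le)
  qed
  have "measure (density lam (\<lambda>x. ennreal (f x)) \<bind> Q) B - measure (density lam (\<lambda>x. ennreal (g x)) \<bind> Q) B =
      (\<integral>x. f x * \<phi> x \<partial>lam) - (\<integral>x. g x * \<phi> x \<partial>lam)"
    using f g by (simp add: mq \<phi>_def)
  also have "\<dots> = (\<integral>x. (f x - g x) * (\<phi> x - c) \<partial>lam)"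
  proof -
    have "(\<integral>x. (f x - g x) * (\<phi> x - c) \<partial>lam) = (\<integral>x. (f x * \<phi> x - g x * \<phi> x) - (c * f x - c * g x) \<partial>lam)"
      by (simp add: algebra_simps)
    also have "\<dots> = (\<integral>x. f x * \<phi> x \<partial>lam) - (\<integral>x. g x * \<phi> x \<partial>lam) - (c * 1 - c * 1)"
      using hi[OF fi(1)] hi[OF gi(1)] fi gi by simp
    finally show ?thesis by simp
  qed
  also have "\<dots> \<le> \<bar>\<integral>x. (f x - g x) * (\<phi> x - c) \<partial>lam\<bar>" by (rule abs_ge_self)
  also have "\<dots> \<le> (\<integral>x. \<bar>f x - g x\<bar> * ((1 - dobrushin Y Q) / 2) \<partial>lam)"
  proof (rule order_trans[OF integral_abs_bound], rule integral_mono)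
    have "integrable lam (\<lambda>x. (f x - g x) * \<phi> x - c * (f x - g x))"
      using hi[of "\<lambda>x. f x - g x"] fi gi by simp
    then show "integrable lam (\<lambda>x. \<bar>(f x - g x) * (\<phi> x - c)\<bar>)"
      by (intro integrable_abs) (simp add: algebra_simps)
    show "integrable lam (\<lambda>x. \<bar>f x - g x\<bar> * ((1 - dobrushin Y Q) / 2))" using fi gi by simp
    show "\<bar>(f x - g x) * (\<phi> x - c)\<bar> \<le> \<bar>f x - g x\<bar> * ((1 - dobrushin Y Q) / 2)" for x
      unfolding abs_mult using c[of x] by (intro mult_left_mono) auto
  qed
  also have "\<dots> = (1 - dobrushin Y Q) / 2 * (\<integral>x. \<bar>f x - g x\<bar> \<partial>lam)" by simp
  finally show ?thesis unfolding B by simp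
qed

text \<open>The factor \<open>3 - 2 \<delta>(Q)\<close> arises as \<open>1 + 2 (1 - \<delta>(Q))\<close>: the posteriors differ by the
  difference of the joint laws plus that of the observation laws, and averaging \<open>h\<close> over the
  observation law costs the latter once more.\<close>

lemma posterior_integral_contraction:
  assumes f[measurable]: "f \<in> borel_measurable borel" "\<And>x. 0 \<le> f x" "prob_space (density lam (\<lambda>x. ennreal (f x)))"
    and g[measurable]: "g \<in> borel_measurable borel" "\<And>x. 0 \<le> g x" "prob_space (density lam (\<lambda>x. ennreal (g x)))"
    and h: "\<And>z z'. z \<in> beliefs \<Longrightarrow> z' \<in> beliefs \<Longrightarrow> \<bar>h z - h z'\<bar> \<le> L * kant z z'" and "0 \<le> L"
  shows "\<bar>(\<integral>y. h (post f y) \<partial>(density lam (\<lambda>x. ennreal (f x)) \<bind> Q)) - (\<integral>y. h (post g y) \<partial>(density lam (\<lambda>x. ennreal (g x)) \<bind> Q))\<bar>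
    \<le> L * (diameter (UNIV :: 'x set) / 2) * (3 - 2 * dobrushin Y Q) * (\<integral>x. \<bar>f x - g x\<bar> \<partial>lam)"
proof -
  let ?D = "diameter (UNIV :: 'x set)"
  define a where "a k y = enn2real (like k y)" for k y
  have a_meas[measurable]: "a k \<in> borel_measurable Y" if [measurable]: "k \<in> borel_measurable borel" for k
    unfolding a_def by measurable
  have hm: "h \<in> borel_measurable (prob_algebra borel)" by (rule kant_lipschitz_measurable[OF compactX h])
  obtain c where c: "\<And>z. z \<in> beliefs \<Longrightarrow> \<bar>h z - c\<bar> \<le> L * ?D / 2"
  proof -
    have "\<bar>h z - h z'\<bar> \<le> L * ?D" if "z \<in> beliefs" "z' \<in> beliefs" for z z'
      using h[OF that] mult_left_mono[OF kant_le_diameter[OF compactX that] \<open>0 \<le> L\<close>] by linarith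
    then show ?thesis using exists_midpoint[of beliefs h "L * ?D"] that by auto
  qed
  have hp: "(\<lambda>y. h (post k y)) \<in> borel_measurable Y" if "k \<in> borel_measurable borel" for k
    by (rule measurable_compose[OF measurable_post[OF that] hm])
  have int: "(\<integral>y. h (post k y) \<partial>(density lam (\<lambda>x. ennreal (k x)) \<bind> Q)) = (\<integral>y. a k y * h (post k y) \<partial>m)"
    "integrable m (\<lambda>y. a k y * h (post k y))" "integrable m (a k)" "(\<integral>y. a k y \<partial>m) = 1"
    if k[measurable]: "k \<in> borel_measurable borel" and p: "prob_space (density lam (\<lambda>x. ennreal (k x)))" for k
  proof -
    have d: "density lam (\<lambda>x. ennreal (k x)) \<bind> Q = density m (\<lambda>y. ennreal (a k y))"
    proof -
      have "AE y in m. like k y \<noteq> \<infinity>" by (rule like_finite[OF k p])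
      then have "AE y in m. like k y = ennreal (a k y)"
        by eventually_elim (simp add: a_def top.not_eq_extremum)
      then show ?thesis unfolding obs_law_density[OF k] by (intro density_cong) auto
    qed
    have "prob_space (density lam (\<lambda>x. ennreal (k x)) \<bind> Q)"
      by (rule prob_space_bind'[OF _ Q]) (use p in \<open>auto simp: space_prob_algebra\<close>)
    then have p': "prob_space (density m (\<lambda>y. ennreal (a k y)))" by (simp add: d)
    have "a k \<in> borel_measurable m" by (simp add: measurable_cong_sets[OF sets_m refl])
    note pi = prob_density_integrable[OF p' this]
    show i: "integrable m (a k)" "(\<integral>y. a k y \<partial>m) = 1" using pi by (auto simp: a_def)
    show "(\<integral>y. h (post k y) \<partial>(density lam (\<lambda>x. ennreal (k x)) \<bind> Q)) = (\<integral>y. a k y * h (post k y) \<partial>m)"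
      unfolding d using hp[OF k] by (subst integral_density) (auto simp: a_def measurable_cong_sets[OF sets_m refl])
    show "integrable m (\<lambda>y. a k y * h (post k y))"
    proof (rule Bochner_Integration.integrable_bound[OF integrable_mult_left[OF i(1), of "\<bar>c\<bar> + L * ?D / 2"]])
      show "(\<lambda>y. a k y * h (post k y)) \<in> borel_measurable m"
        using hp[OF k] by (auto simp: measurable_cong_sets[OF sets_m refl])
      show "AE y in m. norm (a k y * h (post k y)) \<le> norm (a k y * (\<bar>c\<bar> + L * ?D / 2))"
      proof (rule AE_I2)
        fix y assume "y \<in> space m"
        then have "\<bar>h (post k y) - c\<bar> \<le> L * ?D / 2" by (intro c post_belief) auto
        then have "\<bar>h (post k y)\<bar> \<le> \<bar>c\<bar> + L * ?D / 2" by argo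
        then show "norm (a k y * h (post k y)) \<le> norm (a k y * (\<bar>c\<bar> + L * ?D / 2))"
          unfolding real_norm_def abs_mult by (intro mult_left_mono) auto
      qed
    qed
  qed
  note F = int[OF f(1,3)] and G = int[OF g(1,3)]
  have fi: "integrable lam f" using prob_density_integrable[OF f(3) _ f(2)] f(1) by auto
  have gi: "integrable lam g" using prob_density_integrable[OF g(3) _ g(2)] g(1) by auto
  define J where "J y = (\<integral>x. \<bar>f x - g x\<bar> \<partial>\<kappa> y)" for y
  have fin: "AE y in m. like f y \<noteq> \<infinity>" "AE y in m. like g y \<noteq> \<infinity>"
    using like_finite f g by auto
  have J: "integrable m J" "(\<integral>y. J y \<partial>m) = (\<integral>x. \<bar>f x - g x\<bar> \<partial>lam)"
  proof -
    have Jm: "J \<in> borel_measurable m" unfolding J_def by measurable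
    have J0: "0 \<le> J y" for y by (simp add: J_def)
    have "(\<integral>\<^sup>+x. ennreal \<bar>f x - g x\<bar> * emeasure (Q x) (space Y) \<partial>lam) =
        (\<integral>\<^sup>+y. (\<integral>\<^sup>+x. ennreal \<bar>f x - g x\<bar> \<partial>\<kappa> y) * indicator (space Y) y \<partial>m)"
      by (rule disint_nn_integral) auto
    also have "(\<integral>\<^sup>+x. ennreal \<bar>f x - g x\<bar> * emeasure (Q x) (space Y) \<partial>lam) = (\<integral>\<^sup>+x. ennreal \<bar>f x - g x\<bar> \<partial>lam)"
      using prob_space.emeasure_space_1[OF QD(1)] sets_eq_imp_space_eq[OF QD(2)] by simp
    also have "\<dots> = ennreal (\<integral>x. \<bar>f x - g x\<bar> \<partial>lam)" by (rule nn_integral_eq_integral) (use fi gi in auto)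
    also have "(\<integral>\<^sup>+y. (\<integral>\<^sup>+x. ennreal \<bar>f x - g x\<bar> \<partial>\<kappa> y) * indicator (space Y) y \<partial>m) = (\<integral>\<^sup>+y. ennreal (J y) \<partial>m)"
    proof (rule nn_integral_cong_AE)
      have *: "(\<integral>\<^sup>+x. ennreal \<bar>f x - g x\<bar> \<partial>\<kappa> y) = ennreal (J y)"
        if y: "y \<in> space Y" and fin: "like f y \<noteq> \<infinity>" "like g y \<noteq> \<infinity>" for y
      proof -
        have "f \<in> borel_measurable (\<kappa> y)" "g \<in> borel_measurable (\<kappa> y)"
          by (rule measurable_\<kappa>[OF y], fact)+
        then have "integrable (\<kappa> y) f" "integrable (\<kappa> y) g"
          using f(2) g(2) fin by (auto intro!: integrableI_nonneg simp: like_def top.not_eq_extremum)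
        then show ?thesis unfolding J_def by (intro nn_integral_eq_integral) auto
      qed
      show "AE y in m. (\<integral>\<^sup>+x. ennreal \<bar>f x - g x\<bar> \<partial>\<kappa> y) * indicator (space Y) y = ennreal (J y)"
        using fin AE_space by eventually_elim (simp add: *)
    qed
    finally have *: "(\<integral>\<^sup>+y. ennreal (J y) \<partial>m) = ennreal (\<integral>x. \<bar>f x - g x\<bar> \<partial>lam)" ..
    then show "integrable m J" using Jm J0 by (intro integrableI_nonneg) auto
    show "(\<integral>y. J y \<partial>m) = (\<integral>x. \<bar>f x - g x\<bar> \<partial>lam)"
      using * Jm J0 by (subst integral_eq_nn_integral) (auto simp: integral_nonneg_AE)
  qed
  \<comment> \<open>The term \<open>c * (a f y - a g y)\<close> integrates to 0 because both
    likelihoods have integral 1. It replaces \<open>h\<close> by \<open>h - c\<close> in front of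
    the difference of the likelihoods.\<close>
  have point: "AE y in m. \<bar>a f y * h (post f y) - a g y * h (post g y) - c * (a f y - a g y)\<bar> \<le>
      L * (?D / 2) * (J y + 2 * \<bar>a f y - a g y\<bar>)"
    using fin
  proof (rule AE_mp[OF AE_conjI], intro AE_I2 impI, elim conjE)
    fix y assume "y \<in> space m" and fin: "like f y \<noteq> \<infinity>" "like g y \<noteq> \<infinity>"
    then have y: "y \<in> space Y" by simp
    note pf = post_belief[OF f(1) y] and pg = post_belief[OF g(1) y]
    have "a f y * h (post f y) - a g y * h (post g y) - c * (a f y - a g y) =
        (h (post f y) - h (post g y)) * a f y + (h (post g y) - c) * (a f y - a g y)"
      by (simp add: algebra_simps)
    also have "\<bar>\<dots>\<bar> \<le> \<bar>h (post f y) - h (post g y)\<bar> * a f y + \<bar>h (post g y) - c\<bar> * \<bar>a f y - a g y\<bar>"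
      by (rule order_trans[OF abs_triangle_ineq]) (simp add: abs_mult a_def)
    also have "\<dots> \<le> L * kant (post f y) (post g y) * a f y + L * ?D / 2 * \<bar>a f y - a g y\<bar>"
      by (intro add_mono mult_right_mono h c pf pg) (auto simp: a_def)
    also have "\<dots> \<le> L * (?D / 2 * (J y + \<bar>a f y - a g y\<bar>)) + L * ?D / 2 * \<bar>a f y - a g y\<bar>"
      using mult_left_mono[OF kant_post_le[OF f(1,2) g(1,2) y fin] \<open>0 \<le> L\<close>] by (simp add: a_def J_def mult.assoc)
    also have "\<dots> = L * (?D / 2) * (J y + 2 * \<bar>a f y - a g y\<bar>)" by (simp add: algebra_simps)
    finally show "\<bar>a f y * h (post f y) - a g y * h (post g y) - c * (a f y - a g y)\<bar> \<le>
      L * (?D / 2) * (J y + 2 * \<bar>a f y - a g y\<bar>)" .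
  qed
  have eq: "(\<integral>y. a f y * h (post f y) \<partial>m) - (\<integral>y. a g y * h (post g y) \<partial>m) =
      (\<integral>y. a f y * h (post f y) - a g y * h (post g y) - c * (a f y - a g y) \<partial>m)"
    using F G by simp
  have "\<bar>(\<integral>y. a f y * h (post f y) \<partial>m) - (\<integral>y. a g y * h (post g y) \<partial>m)\<bar> \<le>
      (\<integral>y. \<bar>a f y * h (post f y) - a g y * h (post g y) - c * (a f y - a g y)\<bar> \<partial>m)"
    unfolding eq by (rule integral_abs_bound)
  also have "\<dots> \<le> (\<integral>y. L * (?D / 2) * (J y + 2 * \<bar>a f y - a g y\<bar>) \<partial>m)"
    by (rule integral_mono_AE[OF _ _ point]) (use F G J in auto)
  also have "\<dots> = L * (?D / 2) * ((\<integral>x. \<bar>f x - g x\<bar> \<partial>lam) + 2 * (\<integral>y. \<bar>a f y - a g y\<bar> \<partial>m))"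
    using F G J by simp
  also have "\<dots> \<le> L * (?D / 2) * ((\<integral>x. \<bar>f x - g x\<bar> \<partial>lam) + 2 * ((1 - dobrushin Y Q) * (\<integral>x. \<bar>f x - g x\<bar> \<partial>lam)))"
    using like_L1_contraction[OF f g] \<open>0 \<le> L\<close> dist_le_diameter[OF compactX, of undefined undefined]
    by (intro mult_left_mono add_left_mono) (auto simp: a_def)
  also have "\<dots> = L * (?D / 2) * (3 - 2 * dobrushin Y Q) * (\<integral>x. \<bar>f x - g x\<bar> \<partial>lam)"
    by (simp add: algebra_simps)
  finally show ?thesis by (simp add: F(1) G(1))
qed

end

section \<open>The belief MDP\<close>

text \<open>Finite intersections of a countable base. Countability allows almost sure equalities on
  single sets to be combined; stability under intersection then gives equality of measures.\<close>

lemma countable_generating_pi_system: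
  obtains G :: "'x::second_countable_topology set set"
  where "countable G" "Int_stable G" "UNIV \<in> G" "sets borel = sigma_sets UNIV G"
proof -
  obtain B :: "'x set set" where B: "countable B" "topological_basis B" using ex_countable_basis by blast
  define G where "G = Inter ` {S. finite S \<and> S \<subseteq> B}"
  have s: "sets borel = sigma_sets UNIV B"
    by (subst borel_eq_countable_basis[OF B]) (simp add: sets_measure_of)
  have "sigma_sets UNIV G = sigma_sets UNIV B"
  proof (rule sigma_sets_eqI)
    fix a assume "a \<in> G"
    then obtain S where S: "finite S" "S \<subseteq> B" "a = \<Inter>S" by (auto simp: G_def)
    have "\<Inter>S \<in> sets borel"
      using S topological_basis_open[OF B(2)] by (intro borel_open open_Inter) auto
    then show "a \<in> sigma_sets UNIV B" using S s by simp
  next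
    fix b assume "b \<in> B"
    then have "b \<in> G" by (auto simp: G_def intro!: image_eqI[of _ _ "{b}"])
    then show "b \<in> sigma_sets UNIV G" by auto
  qed
  then have "sets borel = sigma_sets UNIV G" using s by simp
  moreover have "Int_stable G"
    unfolding Int_stable_def G_def
  proof safe
    fix S S' :: "'x set set" assume "finite S" "S \<subseteq> B" "finite S'" "S' \<subseteq> B"
    then show "\<Inter>S \<inter> \<Inter>S' \<in> Inter ` {S. finite S \<and> S \<subseteq> B}"
      by (intro image_eqI[of _ _ "S \<union> S'"]) auto
  qed
  moreover have "UNIV \<in> G" by (auto simp: G_def intro!: image_eqI[of _ _ "{}"])
  moreover have "countable G" unfolding G_def by (intro countable_image countable_Collect_finite_subset B)
  ultimately show ?thesis using that by blast
qed

lemma succ_mult_divide_cancel: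
  fixes l e k :: real
  assumes "0 \<le> l"
  shows "(l + 1) * (e / (k * (l + 1))) = e / k"
proof -
  have "l + 1 \<noteq> 0" using assms by simp
  then show ?thesis by (simp only: times_divide_eq_right mult.commute[of k]) (rule nonzero_mult_divide_mult_cancel_left)
qed

text \<open>The diagonal argument, in the form of compactness of the cube in the product
  topology.\<close>

lemma bounded_sequences_convergent_subseq:
  fixes x :: "nat \<Rightarrow> nat \<Rightarrow> real"
  assumes "\<And>n i. \<bar>x n i\<bar> \<le> B"
  obtains s where "strict_mono s" "\<And>i. convergent (\<lambda>n. x (s n) i)"
proof -
  have "compactin (product_topology (\<lambda>_. euclidean) UNIV) (PiE UNIV (\<lambda>_::nat. {-B..B}))"
    by (subst compactin_PiE) auto
  then have "compact (PiE UNIV (\<lambda>_::nat. {-B..B}))" by (simp add: euclidean_product_topology)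
  then have "seq_compact (PiE UNIV (\<lambda>_::nat. {-B..B}))" by (rule compact_imp_seq_compact)
  moreover have "x n \<in> PiE UNIV (\<lambda>_. {-B..B})" for n
    using assms[of n] by (auto simp: abs_le_iff minus_le_iff)
  ultimately obtain l s where s: "strict_mono s" "(x \<circ> s) \<longlonglongrightarrow> l" unfolding seq_compact_def by metis
  have "(\<lambda>n. x (s n) i) \<longlonglongrightarrow> l i" for i
    using continuous_on_tendsto_compose[OF continuous_on_product_coordinates[of i] s(2)] by (simp add: comp_def)
  then show ?thesis using that s(1) convergent_def by blast
qed

section \<open>Domination of the transition laws\<close>

locale pomdp =
  fixes Y :: "'y measure" and T :: "'x::polish_space \<times> 'u::polish_space \<Rightarrow> 'x measure"
    and Q :: "'x \<Rightarrow> 'y measure" and c :: "'x \<Rightarrow> 'u \<Rightarrow> real" and \<alpha> K\<^sub>1 :: real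
  assumes T_meas[measurable]: "T \<in> borel \<Otimes>\<^sub>M borel \<rightarrow>\<^sub>M prob_algebra borel"
    and Q_meas: "Q \<in> borel \<rightarrow>\<^sub>M prob_algebra Y"
    and compactU: "compact (UNIV :: 'u set)"
    and compX: "compact (UNIV :: 'x set)"
    and tv_cont: "\<And>xs us x u. xs \<longlonglongrightarrow> x \<Longrightarrow> us \<longlonglongrightarrow> u \<Longrightarrow>
           (\<lambda>n. tv_norm_diff (T (xs n, us n)) (T (x, u))) \<longlonglongrightarrow> 0"
    and \<alpha>_nonneg: "0 \<le> \<alpha>"
    and tv_lip: "\<And>x x' u. tv_norm_diff (T (x, u)) (T (x', u)) \<le> \<alpha> * dist x x'"
    and K1_nonneg: "0 \<le> K\<^sub>1"
    and c_lip: "\<And>x x' u. \<bar>c x u - c x' u\<bar> \<le> K\<^sub>1 * dist x x'"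
    and c_cont: "continuous_on UNIV (\<lambda>(x, u). c x u)"
    and contraction: "\<alpha> * diameter (UNIV :: 'x set) * (3 - 2 * dobrushin Y Q) / 2 < 1"
begin

lemma TD: "prob_space (T a)" "sets (T a) = sets borel" "space (T a) = UNIV"
proof -
  have "T a \<in> space (prob_algebra borel)" using measurable_space[OF T_meas, of a] by (simp add: space_pair_measure)
  then show "prob_space (T a)" "sets (T a) = sets borel" by (auto simp: space_prob_algebra)
  then show "space (T a) = UNIV" using sets_eq_imp_space_eq[of "T a" borel] by simp
qed

lemma tv_T_continuous: "continuous_on UNIV (\<lambda>a. tv_norm_diff (T a) (T b))"
  unfolding continuous_on_sequentially
proof (intro ballI allI impI, elim conjE)
  fix s :: "nat \<Rightarrow> 'x \<times> 'u" and a assume "s \<longlonglongrightarrow> a"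
  then have "(\<lambda>n. tv_norm_diff (T (fst (s n), snd (s n))) (T (fst a, snd a))) \<longlonglongrightarrow> 0"
    by (intro tv_cont tendsto_fst tendsto_snd)
  then have lim: "(\<lambda>n. tv_norm_diff (T (s n)) (T a)) \<longlonglongrightarrow> 0" by simp
  show "((\<lambda>a. tv_norm_diff (T a) (T b)) \<circ> s) \<longlonglongrightarrow> tv_norm_diff (T a) (T b)"
  proof (rule tendsto_dist_iff[THEN iffD2], rule tendsto_sandwich[OF _ _ tendsto_const lim])
    have "dist (tv_norm_diff (T (s n)) (T b)) (tv_norm_diff (T a) (T b)) \<le> tv_norm_diff (T (s n)) (T a)" for n
      using tv_norm_diff_triangle[OF TD(1) TD(1) TD(1), of "s n" a b]
        tv_norm_diff_triangle[OF TD(1) TD(1) TD(1), of a "s n" b]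
        tv_norm_diff_sym[of "T a" "T (s n)"] by (simp add: TD dist_real_def abs_le_iff)
    then show "\<forall>\<^sub>F n in sequentially. dist (((\<lambda>a. tv_norm_diff (T a) (T b)) \<circ> s) n) (tv_norm_diff (T a) (T b)) \<le> tv_norm_diff (T (s n)) (T a)"
      by simp
  qed simp
qed

lemma tv_T_refl: "tv_norm_diff (T a) (T a) = 0"
proof -
  have "sets (T a) \<noteq> {}" using sets.top by blast
  then show ?thesis by (simp add: tv_norm_diff_def)
qed

text \<open>Total variation continuity makes the family \<open>T\<close> separable, so a mixture of countably many
  of its members dominates all of them.\<close>

lemma ex_dominating_density:
  obtains lam and p :: "('x \<times> 'u) \<times> 'x \<Rightarrow> real"
  where "lam \<in> space (prob_algebra borel)" "p \<in> borel_measurable ((borel \<Otimes>\<^sub>M borel) \<Otimes>\<^sub>M borel)" "\<And>w. 0 \<le> p w"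
    "\<And>a. T a = density lam (\<lambda>x. ennreal (p (a, x)))"
proof -
  obtain D :: "('x \<times> 'u) set" where D: "countable D" "\<And>X. open X \<Longrightarrow> X \<noteq> {} \<Longrightarrow> \<exists>d\<in>D. d \<in> X"
    using countable_dense_exists by metis
  define d where "d = from_nat_into D"
  have near: "\<exists>k. tv_norm_diff (T a) (T (d k)) < e" if "0 < e" for a e
  proof -
    have "open {b. tv_norm_diff (T b) (T a) < e}"
      using open_Collect_less[OF tv_T_continuous continuous_on_const] .
    moreover have "a \<in> {b. tv_norm_diff (T b) (T a) < e}" using that by (simp add: tv_T_refl)
    ultimately obtain b where "b \<in> D" "tv_norm_diff (T b) (T a) < e" using D(2) by blast
    moreover obtain k where "d k = b" using from_nat_into_surj[OF D(1) \<open>b \<in> D\<close>] by (auto simp: d_def)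
    ultimately show ?thesis using tv_norm_diff_sym[of "T a" "T b"] by (intro exI[of _ k]) (simp add: TD)
  qed
  \<comment> \<open>The geometric weights give every \<open>T (d n)\<close> positive mass, so
    \<open>lam\<close>-null sets are null for all of them and, by approximation in total variation,
    for every \<open>T a\<close>.\<close>
  define lam where "lam = measure_pmf (geometric_pmf (1/2)) \<bind> (\<lambda>n. T (d n))"
  have Tpmf: "(\<lambda>n. T (d n)) \<in> measure_pmf (geometric_pmf (1/2)) \<rightarrow>\<^sub>M prob_algebra borel"
    by (auto simp: space_prob_algebra TD)
  have lam: "lam \<in> space (prob_algebra borel)"
    unfolding lam_def using prob_space_bind'[OF _ Tpmf] sets_bind'[OF _ Tpmf]
    by (auto simp: space_prob_algebra measure_pmf.prob_space_axioms)
  then have lamD: "prob_space lam" "sets lam = sets borel" by (auto simp: space_prob_algebra)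
  have ac: "absolutely_continuous lam (T a)" for a
    unfolding absolutely_continuous_def
  proof
    fix A assume "A \<in> null_sets lam"
    then have A: "A \<in> sets borel" "emeasure lam A = 0" by (auto simp: lamD)
    have "emeasure lam A = (\<integral>\<^sup>+n. emeasure (T (d n)) A \<partial>measure_pmf (geometric_pmf (1/2)))"
      unfolding lam_def by (rule emeasure_bind[OF _ measurable_prob_algebraD[OF Tpmf] A(1)]) simp
    then have "AE n in measure_pmf (geometric_pmf (1/2)). emeasure (T (d n)) A = 0"
      using A(2) by (simp add: nn_integral_0_iff_AE)
    then have z: "measure (T (d n)) A = 0" for n
      by (simp add: AE_measure_pmf_iff set_pmf_geometric measure_def)
    have "measure (T a) A \<le> e" if e: "0 < e" for e
    proof -
      obtain k where "tv_norm_diff (T a) (T (d k)) < e" using near[OF e] by blast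
      moreover have "\<bar>measure (T a) A - measure (T (d k)) A\<bar> \<le> tv_norm_diff (T a) (T (d k)) / 2"
        by (rule measure_diff_le_tv[OF TD(1) TD(1)]) (simp add: TD A)
      ultimately show ?thesis using z[of k] e by argo
    qed
    then have "measure (T a) A \<le> 0" by (rule field_le_epsilon) simp
    then have "measure (T a) A = 0" by (simp add: measure_le_0_iff)
    then show "A \<in> null_sets (T a)"
      using A(1) TD(1)[of a] by (auto simp: null_sets_def TD finite_measure.emeasure_eq_measure prob_space.finite_measure)
  qed
  obtain p where "p \<in> borel_measurable ((borel \<Otimes>\<^sub>M borel) \<Otimes>\<^sub>M lam)" "\<And>w. 0 \<le> p w"
    "\<And>a. a \<in> space (borel \<Otimes>\<^sub>M borel) \<Longrightarrow> T a = density lam (\<lambda>x. ennreal (p (a, x)))"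
  proof (rule kernel_joint_density[OF lamD(1), of "borel \<Otimes>\<^sub>M borel" T d])
    show "\<exists>k. tv_norm_diff (T a) (T (d k)) < e" if "0 < e" for a e by (rule near[OF that])
    show "absolutely_continuous lam (T (d k))" for k by (rule ac)
    show "prob_space (T a)" "sets (T a) = sets lam" for a by (simp_all add: TD lamD)
    show "d k \<in> space (borel \<Otimes>\<^sub>M borel)" for k by (simp add: space_pair_measure)
    show "(\<lambda>a. tv_norm_diff (T a) (T (d k))) \<in> borel_measurable (borel \<Otimes>\<^sub>M borel)" for k
      unfolding borel_prod by (rule borel_measurable_continuous_onI[OF tv_T_continuous])
  qed blast
  then show ?thesis using that[OF lam, of p] by (auto simp: space_pair_measure measurable_cong_sets[OF sets_pair_measure_cong[OF refl lamD(2)] refl])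
qed

end

locale pomdp_density = pomdp Y T Q c \<alpha> K\<^sub>1 + bayes_kernel lam Q Y \<kappa>
  for Y :: "'y measure" and T :: "'x::polish_space \<times> 'u::polish_space \<Rightarrow> 'x measure"
    and Q :: "'x \<Rightarrow> 'y measure" and c :: "'x \<Rightarrow> 'u \<Rightarrow> real" and \<alpha> K\<^sub>1 :: real
    and lam :: "'x measure" and \<kappa> :: "'y \<Rightarrow> 'x measure" +
  fixes p :: "('x \<times> 'u) \<times> 'x \<Rightarrow> real"
  assumes p_meas[measurable]: "p \<in> borel_measurable ((borel \<Otimes>\<^sub>M borel) \<Otimes>\<^sub>M borel)"
    and p_nonneg: "\<And>w. 0 \<le> p w"
    and T_density: "\<And>a. T a = density lam (\<lambda>x. ennreal (p (a, x)))"
begin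

section \<open>Predicted laws and filter versions\<close>

lemma T_sub[measurable]: "T \<in> borel \<Otimes>\<^sub>M borel \<rightarrow>\<^sub>M subprob_algebra borel"
  by (rule measurable_prob_algebraD[OF T_meas])

lemma measurable_belief: "z \<in> beliefs \<Longrightarrow> f \<in> borel \<rightarrow>\<^sub>M N \<Longrightarrow> f \<in> z \<rightarrow>\<^sub>M N"
  using beliefsD(2) measurable_cong_sets by blast

lemma T_meas_u: "(\<lambda>x. T (x, u)) \<in> borel \<rightarrow>\<^sub>M prob_algebra borel"
  by measurable

lemma next_state_belief: "z \<in> beliefs \<Longrightarrow> next_state_law T z u \<in> beliefs"
  unfolding next_state_law_def beliefs_eq
  using prob_space_bind'[OF _ T_meas_u] sets_bind'[OF _ T_meas_u] by (auto simp: space_prob_algebra)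

text \<open>For a belief \<open>z\<close>, the density of the predicted state law with respect to
  \<open>lam\<close>; \<open>enn2real\<close> changes the integral only on a \<open>lam\<close>-null
  set.\<close>

definition pz :: "'x measure \<Rightarrow> 'u \<Rightarrow> 'x \<Rightarrow> real" where
  "pz z u x' = enn2real (\<integral>\<^sup>+x. ennreal (p ((x, u), x')) \<partial>z)"

lemma pz_nonneg: "0 \<le> pz z u x'" by (simp add: pz_def)

lemma pz_joint_measurable: "(\<lambda>(w, x'). pz (fst w) (snd w) x') \<in> borel_measurable ((prob_algebra borel \<Otimes>\<^sub>M borel) \<Otimes>\<^sub>M borel)"
proof -
  have [measurable]: "(\<lambda>w. fst (fst w)) \<in> (prob_algebra borel \<Otimes>\<^sub>M (borel :: 'u measure)) \<Otimes>\<^sub>M (borel :: 'x measure) \<rightarrow>\<^sub>M subprob_algebra (borel :: 'x measure)"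
    by (rule measurable_prob_algebraD) measurable
  have "(\<lambda>w. \<integral>\<^sup>+x. ennreal (p ((x, snd (fst w)), snd w)) \<partial>fst (fst w)) \<in>
      borel_measurable ((prob_algebra (borel :: 'x measure) \<Otimes>\<^sub>M (borel :: 'u measure)) \<Otimes>\<^sub>M (borel :: 'x measure))"
    by (rule nn_integral_measurable_subprob_algebra2[where N=borel]) measurable
  then show ?thesis unfolding pz_def split_beta by measurable
qed

lemma pz_measurable[measurable]: "pz z u \<in> borel_measurable borel" if "z \<in> beliefs"
proof -
  have "(z, u) \<in> space (prob_algebra borel \<Otimes>\<^sub>M borel)" using that by (simp add: space_pair_measure beliefs_eq)
  from measurable_compose[OF measurable_Pair1'[OF this] pz_joint_measurable] show ?thesis by simp
qed

lemma next_state_density: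
  assumes z: "z \<in> beliefs"
  shows "next_state_law T z u = density lam (\<lambda>x. ennreal (pz z u x))"
proof -
  interpret z: prob_space z by (rule beliefsD(1)[OF z])
  have sz[measurable_cong]: "sets z = sets borel" by (rule beliefsD(2)[OF z])
  interpret pair_sigma_finite z lam by unfold_locales
  define P where "P x' = (\<integral>\<^sup>+x. ennreal (p ((x, u), x')) \<partial>z)" for x'
  have P_meas[measurable]: "P \<in> borel_measurable lam" unfolding P_def by measurable
  have dens: "next_state_law T z u = density lam P"
  proof (rule measure_eqI)
    show "sets (next_state_law T z u) = sets (density lam P)"
      using beliefsD(2)[OF next_state_belief[OF z]] by simp
    fix A assume "A \<in> sets (next_state_law T z u)"
    then have A[measurable]: "A \<in> sets borel" using beliefsD(2)[OF next_state_belief[OF z]] by simp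
    have "emeasure (next_state_law T z u) A = (\<integral>\<^sup>+x. emeasure (T (x, u)) A \<partial>z)"
      unfolding next_state_law_def
      by (rule emeasure_bind[OF z.not_empty measurable_belief[OF z measurable_prob_algebraD[OF T_meas_u]] A])
    also have "\<dots> = (\<integral>\<^sup>+x. \<integral>\<^sup>+x'. ennreal (p ((x, u), x')) * indicator A x' \<partial>lam \<partial>z)"
      unfolding T_density by (intro nn_integral_cong emeasure_density) measurable
    also have "\<dots> = (\<integral>\<^sup>+x'. \<integral>\<^sup>+x. ennreal (p ((x, u), x')) * indicator A x' \<partial>z \<partial>lam)"
      by (rule Fubini'[symmetric]) measurable
    also have "\<dots> = (\<integral>\<^sup>+x'. P x' * indicator A x' \<partial>lam)"
      unfolding P_def by (intro nn_integral_cong nn_integral_multc) measurable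
    also have "\<dots> = emeasure (density lam P) A" by (simp add: emeasure_density)
    finally show "emeasure (next_state_law T z u) A = emeasure (density lam P) A" .
  qed
  have "(\<integral>\<^sup>+x. P x \<partial>lam) = emeasure (density lam P) UNIV" by (simp add: emeasure_density)
  also have "\<dots> = 1"
    using prob_space.emeasure_space_1[OF beliefsD(1)[OF next_state_belief[OF z]], of u] beliefsD(3)[OF next_state_belief[OF z], of u]
    by (simp add: dens)
  finally have "AE x in lam. P x \<noteq> \<infinity>" by (intro nn_integral_PInf_AE) auto
  then have "AE x in lam. ennreal (pz z u x) = P x"
    by eventually_elim (simp add: pz_def P_def top.not_eq_extremum)
  moreover have "(\<lambda>x. ennreal (pz z u x)) \<in> borel_measurable lam"
    using pz_measurable[OF z, of u] by (simp add: measurable_cong_sets[OF sets_lam refl])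
  ultimately show ?thesis unfolding dens using density_cong[OF _ P_meas] by metis
qed

lemma prob_pz: "z \<in> beliefs \<Longrightarrow> prob_space (density lam (\<lambda>x. ennreal (pz z u x)))"
  using beliefsD(1)[OF next_state_belief] by (simp add: next_state_density[symmetric])

lemma next_obs_prob: "z \<in> beliefs \<Longrightarrow> prob_space (next_obs_law T Q z u)"
  and sets_next_obs: "z \<in> beliefs \<Longrightarrow> sets (next_obs_law T Q z u) = sets Y"
  unfolding next_obs_law_def using next_state_belief[of z u]
  by (auto simp: beliefs_eq sets_bind'[OF _ Q] intro: prob_space_bind'[OF _ Q])

lemma space_next_obs: "z \<in> beliefs \<Longrightarrow> space (next_obs_law T Q z u) = space Y"
  by (rule sets_eq_imp_space_eq[OF sets_next_obs])

lemma next_joint_law_rectangle: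
  assumes z: "z \<in> beliefs" and [measurable]: "A \<in> sets borel" "B \<in> sets Y"
  shows "emeasure (next_joint_law Y T Q z u) (A \<times> B) = (\<integral>\<^sup>+x. emeasure (Q x) B * indicator A x \<partial>next_state_law T z u)"
proof -
  note nb = next_state_belief[OF z, of u]
  have k: "(\<lambda>x. Q x \<bind> (\<lambda>y. return (borel \<Otimes>\<^sub>M Y) (x, y))) \<in> borel \<rightarrow>\<^sub>M subprob_algebra (borel \<Otimes>\<^sub>M Y)"
    by measurable
  have "emeasure (next_joint_law Y T Q z u) (A \<times> B) =
      (\<integral>\<^sup>+x. emeasure (Q x \<bind> (\<lambda>y. return (borel \<Otimes>\<^sub>M Y) (x, y))) (A \<times> B) \<partial>next_state_law T z u)"
    unfolding next_joint_law_def
    by (rule emeasure_bind[OF _ measurable_belief[OF nb k]]) (auto simp: beliefsD(3)[OF nb])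
  also have "\<dots> = (\<integral>\<^sup>+x. emeasure (Q x) B * indicator A x \<partial>next_state_law T z u)"
  proof (rule nn_integral_cong)
    fix x
    have [measurable_cong]: "sets (Q x) = sets Y" by (rule QD)
    have "emeasure (Q x \<bind> (\<lambda>y. return (borel \<Otimes>\<^sub>M Y) (x, y))) (A \<times> B) =
        (\<integral>\<^sup>+y. emeasure (return (borel \<Otimes>\<^sub>M Y) (x, y)) (A \<times> B) \<partial>Q x)"
      by (rule emeasure_bind[OF prob_space.not_empty[OF QD(1)]]) measurable
    also have "\<dots> = (\<integral>\<^sup>+y. indicator A x * indicator B y \<partial>Q x)"
      by (intro nn_integral_cong) (auto simp: indicator_def)
    also have "\<dots> = emeasure (Q x) B * indicator A x"
      by (subst nn_integral_cmult) (auto simp: mult.commute QD)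
    finally show "emeasure (Q x \<bind> (\<lambda>y. return (borel \<Otimes>\<^sub>M Y) (x, y))) (A \<times> B) = emeasure (Q x) B * indicator A x" .
  qed
  finally show ?thesis .
qed

lemma sets_belief_alg: "sets (belief_algebra :: 'x measure measure) = sets (prob_algebra borel)"
  by (rule sets_belief_algebra[OF compactX])

text \<open>With \<open>\<kappa>\<close> fixed once for all, the posterior depends on belief and
  action only through the jointly measurable \<open>pz\<close>. This also guarantees that the choice
  in \<open>belief_update\<close> picks an actual filter version.\<close>

lemma filter_version_post: "filter_version Y T Q (\<lambda>z u y. post (pz z u) y)"
  unfolding filter_version_def
proof (intro conjI ballI allI)
  let ?N = "prob_algebra (borel :: 'x measure) \<Otimes>\<^sub>M (borel :: 'u measure) \<Otimes>\<^sub>M Y"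
  have v: "(\<lambda>w. snd (snd w)) \<in> ?N \<rightarrow>\<^sub>M Y" by measurable
  have "(\<lambda>(w, x). pz (fst w) (fst (snd w)) x) \<in> borel_measurable (?N \<Otimes>\<^sub>M borel)"
  proof -
    have "(\<lambda>v. ((fst (fst v), fst (snd (fst v))), snd v)) \<in> ?N \<Otimes>\<^sub>M borel \<rightarrow>\<^sub>M (prob_algebra borel \<Otimes>\<^sub>M borel) \<Otimes>\<^sub>M borel"
      by measurable
    from measurable_compose[OF this pz_joint_measurable] show ?thesis by (simp add: split_beta)
  qed
  from measurable_post_param[OF this v]
  have "(\<lambda>w. post (pz (fst w) (fst (snd w))) (snd (snd w))) \<in> ?N \<rightarrow>\<^sub>M prob_algebra borel" by simp
  then show "(\<lambda>(z, u, y). post (pz z u) y) \<in> belief_algebra \<Otimes>\<^sub>M borel \<Otimes>\<^sub>M Y \<rightarrow>\<^sub>M belief_algebra"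
    by (subst measurable_cong_sets[OF sets_pair_measure_cong[OF sets_belief_alg refl] sets_belief_alg])
       (simp add: split_beta)
  fix z :: "'x measure" and u and A :: "'x set" and B assume z: "z \<in> beliefs" and AB: "A \<in> sets borel" "B \<in> sets Y"
  show "emeasure (next_joint_law Y T Q z u) (A \<times> B) = (\<integral>\<^sup>+y\<in>B. emeasure (post (pz z u) y) A \<partial>next_obs_law T Q z u)"
    unfolding next_joint_law_rectangle[OF z AB] next_obs_law_def next_state_density[OF z]
    by (rule joint_law_rectangle[OF pz_measurable[OF z] AB prob_pz[OF z]])
qed

text \<open>For each A both versions are densities of the same joint law, so they agree almost
  surely on a countable generating pi-system and hence as measures. Under integrals
  \<open>belief_update\<close> may therefore be replaced by Bayes' formula.\<close>

lemma filter_version_unique: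
  assumes F: "filter_version Y T Q F" and F': "filter_version Y T Q F'" and z: "z \<in> beliefs"
  shows "AE y in next_obs_law T Q z u. F z u y = F' z u y"
proof -
  let ?P = "next_obs_law T Q z u"
  interpret P: prob_space ?P by (rule next_obs_prob[OF z])
  have meas: "F z u \<in> Y \<rightarrow>\<^sub>M prob_algebra borel" if "filter_version Y T Q F" for F
  proof -
    have Fm: "(\<lambda>(z, u, y). F z u y) \<in> belief_algebra \<Otimes>\<^sub>M borel \<Otimes>\<^sub>M Y \<rightarrow>\<^sub>M prob_algebra borel"
      using that unfolding filter_version_def by (simp add: measurable_cong_sets[OF refl sets_belief_alg])
    have "(\<lambda>y. (z, u, y)) \<in> Y \<rightarrow>\<^sub>M belief_algebra \<Otimes>\<^sub>M borel \<Otimes>\<^sub>M Y"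
      using z by (intro measurable_Pair measurable_const measurable_ident) (auto simp: space_belief_algebra[OF compactX])
    from measurable_compose[OF this Fm] show ?thesis by simp
  qed
  obtain G :: "'x set set" where G: "countable G" "Int_stable G" "UNIV \<in> G" "sets borel = sigma_sets UNIV G"
    by (rule countable_generating_pi_system)
  have "AE y in ?P. \<forall>A\<in>G. emeasure (F z u y) A = emeasure (F' z u y) A"
    unfolding AE_ball_countable[OF G(1)]
  proof
    fix A assume "A \<in> G"
    then have A: "A \<in> sets borel" using G(4) by auto
    have m: "(\<lambda>y. emeasure (F z u y) A) \<in> borel_measurable ?P" if "filter_version Y T Q F" for F
      using measurable_emeasure_kernel[OF measurable_prob_algebraD[OF meas[OF that]] A]
      by (simp add: measurable_cong_sets[OF sets_next_obs[OF z] refl])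
    show "AE y in ?P. emeasure (F z u y) A = emeasure (F' z u y) A"
    proof (rule P.density_unique_finite_measure[OF m[OF F] m[OF F']])
      fix B assume "B \<in> P.events"
      then have "B \<in> sets Y" by (simp add: sets_next_obs[OF z])
      show "(\<integral>\<^sup>+y\<in>B. emeasure (F z u y) A \<partial>?P) = (\<integral>\<^sup>+y\<in>B. emeasure (F' z u y) A \<partial>?P)"
      proof -
        have "emeasure (next_joint_law Y T Q z u) (A \<times> B) = (\<integral>\<^sup>+y\<in>B. emeasure (F z u y) A \<partial>?P)"
          "emeasure (next_joint_law Y T Q z u) (A \<times> B) = (\<integral>\<^sup>+y\<in>B. emeasure (F' z u y) A \<partial>?P)"
          using F F' z A \<open>B \<in> sets Y\<close> unfolding filter_version_def by blast+
        then show ?thesis by simp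
      qed
    qed auto
  qed
  then show ?thesis using AE_space
  proof eventually_elim
    case (elim y)
    then have y: "y \<in> space Y" by (simp add: space_next_obs[OF z])
    have b: "F z u y \<in> beliefs" "F' z u y \<in> beliefs"
      using measurable_space[OF meas[OF F] y] measurable_space[OF meas[OF F'] y] by (auto simp: beliefs_eq)
    show ?case
    proof (rule measure_eqI_generator_eq[OF G(2), where \<Omega>=UNIV and A="\<lambda>_. UNIV"])
      show "emeasure (F z u y) UNIV \<noteq> \<infinity>"
        using prob_space.emeasure_space_1[OF beliefsD(1)[OF b(1)]] by (simp add: beliefsD(3)[OF b(1)])
    qed (use G elim b in \<open>auto simp: beliefsD\<close>)
  qed
qed

abbreviation "F \<equiv> belief_update Y T Q"

lemma filter_version_F: "filter_version Y T Q F"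
  unfolding belief_update_def by (rule someI[of "filter_version Y T Q", OF filter_version_post])

lemma F_measurable: "(\<lambda>(z, u, y). F z u y) \<in> prob_algebra borel \<Otimes>\<^sub>M borel \<Otimes>\<^sub>M Y \<rightarrow>\<^sub>M prob_algebra borel"
  using filter_version_F unfolding filter_version_def
  by (simp add: measurable_cong_sets[OF sets_pair_measure_cong[OF sets_belief_alg refl] sets_belief_alg])

lemma F_measurable_y:
  assumes "z \<in> beliefs"
  shows "F z u \<in> Y \<rightarrow>\<^sub>M prob_algebra borel"
proof -
  have "(\<lambda>y. (z, u, y)) \<in> Y \<rightarrow>\<^sub>M prob_algebra borel \<Otimes>\<^sub>M borel \<Otimes>\<^sub>M Y"
    using assms by (intro measurable_Pair measurable_const measurable_ident) (auto simp: beliefs_eq)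
  from measurable_compose[OF this F_measurable] show ?thesis by simp
qed

lemma F_belief: "z \<in> beliefs \<Longrightarrow> y \<in> space Y \<Longrightarrow> F z u y \<in> beliefs"
  using measurable_space[OF F_measurable_y] by (auto simp: beliefs_eq)

lemma belief_kernel_prob: "z \<in> beliefs \<Longrightarrow> prob_space (belief_kernel Y T Q z u)"
  unfolding belief_kernel_def
  by (rule prob_space.prob_space_distr[OF next_obs_prob])
     (use F_measurable_y[of z u] in \<open>auto simp: measurable_cong_sets[OF sets_next_obs sets_belief_alg]\<close>)

lemma space_belief_kernel: "space (belief_kernel Y T Q z u) = beliefs"
  by (simp add: belief_kernel_def space_belief_algebra[OF compactX])

lemma belief_kernel_integral:
  fixes h :: "'x measure \<Rightarrow> real"
  assumes z: "z \<in> beliefs" and h: "h \<in> borel_measurable (prob_algebra borel)"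
  shows "(\<integral>z'. h z' \<partial>belief_kernel Y T Q z u) = (\<integral>y. h (F z u y) \<partial>next_obs_law T Q z u)"
  unfolding belief_kernel_def
  by (rule integral_distr)
     (use F_measurable_y[OF z, of u] h in \<open>auto simp: measurable_cong_sets[OF sets_next_obs[OF z] sets_belief_alg] measurable_cong_sets[OF sets_belief_alg refl]\<close>)

section \<open>The belief kernel on Lipschitz functions\<close>

definition lipschitz_h :: "real \<Rightarrow> ('x measure \<Rightarrow> real) \<Rightarrow> bool" where
  "lipschitz_h L h \<longleftrightarrow> 0 \<le> L \<and> (\<forall>z\<in>beliefs. \<forall>z'\<in>beliefs. \<bar>h z - h z'\<bar> \<le> L * kant z z')"

lemma lipschitz_h_const: "0 \<le> L \<Longrightarrow> lipschitz_h L (\<lambda>_. a)"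
  by (simp add: lipschitz_h_def mult_nonneg_nonneg kant_nonneg[OF compactX])

lemma lipschitz_hD:
  "lipschitz_h L h \<Longrightarrow> z \<in> beliefs \<Longrightarrow> z' \<in> beliefs \<Longrightarrow> \<bar>h z - h z'\<bar> \<le> L * kant z z'"
  by (simp add: lipschitz_h_def)

lemma lipschitz_h_measurable: "lipschitz_h L h \<Longrightarrow> h \<in> borel_measurable (prob_algebra borel)"
  by (rule kant_lipschitz_measurable[OF compactX lipschitz_hD])

lemma lipschitz_h_bound:
  assumes "lipschitz_h L h" "z \<in> beliefs" "z' \<in> beliefs"
  shows "\<bar>h z - h z'\<bar> \<le> L * diameter (UNIV :: 'x set)"
  using lipschitz_hD[OF assms] mult_left_mono[OF kant_le_diameter[OF compactX assms(2,3)], of L] assms(1)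
  unfolding lipschitz_h_def by linarith

lemma integrable_kernel:
  assumes h: "lipschitz_h L h" and z: "z \<in> beliefs"
  shows "integrable (belief_kernel Y T Q z u) h"
proof -
  interpret k: prob_space "belief_kernel Y T Q z u" by (rule belief_kernel_prob[OF z])
  show ?thesis
  proof (rule k.integrable_const_bound[of _ "\<bar>h z\<bar> + L * diameter (UNIV :: 'x set)"])
    show "AE x in belief_kernel Y T Q z u. norm (h x) \<le> \<bar>h z\<bar> + L * diameter (UNIV :: 'x set)"
    proof (rule AE_I2)
      fix x assume "x \<in> space (belief_kernel Y T Q z u)"
      then have "x \<in> beliefs" by (simp add: space_belief_kernel)
      then show "norm (h x) \<le> \<bar>h z\<bar> + L * diameter (UNIV :: 'x set)"
        using lipschitz_h_bound[OF h _ z, of x] unfolding real_norm_def by linarith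
    qed
    show "h \<in> borel_measurable (belief_kernel Y T Q z u)"
      using lipschitz_h_measurable[OF h] by (simp add: belief_kernel_def measurable_cong_sets[OF sets_belief_alg refl])
  qed
qed

definition eta :: "('x measure \<Rightarrow> real) \<Rightarrow> 'x measure \<Rightarrow> 'u \<Rightarrow> real" where
  "eta h z u = (\<integral>z'. h z' \<partial>belief_kernel Y T Q z u)"

text \<open>Once the chosen filter is replaced by Bayes' formula, this is the contraction for
  posteriors. Both arguments vary: equal actions lead to the Lipschitz bound in the belief, equal
  beliefs to continuity in the action.\<close>

lemma eta_diff_le:
  assumes h: "lipschitz_h L h" and z: "z \<in> beliefs" "z' \<in> beliefs"
  shows "\<bar>eta h z u - eta h z' u'\<bar> \<le> L * (diameter (UNIV :: 'x set) / 2) * (3 - 2 * dobrushin Y Q) * (\<integral>x. \<bar>pz z u x - pz z' u' x\<bar> \<partial>lam)"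
proof -
  have eq: "eta h z u = (\<integral>y. h (post (pz z u) y) \<partial>(density lam (\<lambda>x. ennreal (pz z u x)) \<bind> Q))" if z: "z \<in> beliefs" for z u
  proof -
    have "eta h z u = (\<integral>y. h (F z u y) \<partial>next_obs_law T Q z u)"
      unfolding eta_def by (rule belief_kernel_integral[OF z lipschitz_h_measurable[OF h]])
    also have "\<dots> = (\<integral>y. h (post (pz z u) y) \<partial>next_obs_law T Q z u)"
    proof (rule integral_cong_AE)
      show "(\<lambda>y. h (F z u y)) \<in> borel_measurable (next_obs_law T Q z u)"
        using measurable_compose[OF F_measurable_y[OF z] lipschitz_h_measurable[OF h]]
        by (simp add: measurable_cong_sets[OF sets_next_obs[OF z] refl])
      show "(\<lambda>y. h (post (pz z u) y)) \<in> borel_measurable (next_obs_law T Q z u)"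
        using measurable_compose[OF measurable_post[OF pz_measurable[OF z]] lipschitz_h_measurable[OF h]]
        by (simp add: measurable_cong_sets[OF sets_next_obs[OF z] refl])
      show "AE y in next_obs_law T Q z u. h (F z u y) = h (post (pz z u) y)"
        using filter_version_unique[OF filter_version_F filter_version_post z, of u] by eventually_elim simp
    qed
    also have "next_obs_law T Q z u = density lam (\<lambda>x. ennreal (pz z u x)) \<bind> Q"
      unfolding next_obs_law_def next_state_density[OF z] ..
    finally show ?thesis .
  qed
  show ?thesis unfolding eq[OF z(1)] eq[OF z(2)]
    by (rule posterior_integral_contraction)
       (use z prob_pz pz_measurable pz_nonneg lipschitz_hD[OF h] h in \<open>auto simp: lipschitz_h_def\<close>)
qed

text \<open>One set realises the L1 distance of the predicted densities, which reduces it to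
  integrals of the functions \<open>measure (T (x, u)) B\<close> of x.\<close>

lemma pz_L1_diff:
  assumes z: "z \<in> beliefs" "z' \<in> beliefs"
  obtains B where "B \<in> sets borel" "(\<integral>x. \<bar>pz z u x - pz z' u' x\<bar> \<partial>lam) =
    2 * ((\<integral>x. measure (T (x, u)) B \<partial>z) - (\<integral>x. measure (T (x, u')) B \<partial>z'))"
proof -
  have m: "pz z u \<in> borel_measurable lam" if "z \<in> beliefs" for z u
    using pz_measurable[OF that] by (simp add: measurable_cong_sets[OF sets_lam refl])
  obtain B where B: "B \<in> sets lam" "(\<integral>x. \<bar>pz z u x - pz z' u' x\<bar> \<partial>lam) =
    2 * (measure (next_state_law T z u) B - measure (next_state_law T z' u') B)"
    using L1_density_diff[OF prob_pz[OF z(1), of u] m[OF z(1)] pz_nonneg prob_pz[OF z(2), of u'] m[OF z(2)] pz_nonneg]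
    unfolding next_state_density[OF z(1)] next_state_density[OF z(2)] by metis
  have "measure (next_state_law T z u) B = (\<integral>x. measure (T (x, u)) B \<partial>z)" if z: "z \<in> beliefs" for z u
  proof -
    interpret prob_space z by (rule beliefsD(1)[OF z])
    show ?thesis unfolding next_state_law_def
      by (rule measure_bind[OF measurable_belief[OF z measurable_prob_algebraD[OF T_meas_u]]]) (use B in simp)
  qed
  then show ?thesis using B z that[of B] by simp
qed

lemma measure_T_measurable:
  assumes "B \<in> sets borel"
  shows "(\<lambda>x. measure (T (x, u)) B) \<in> borel_measurable borel"
  by (rule measure_measurable_subprob_algebra2[OF _ measurable_prob_algebraD[OF T_meas_u]]) (use assms in measurable)

text \<open>\<open>tv_norm_diff\<close> is twice a supremum over sets, so
  \<open>measure (T (x, u)) B\<close> has Lipschitz constant \<alpha>/2 in x; the factor 2 of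
  \<open>pz_L1_diff\<close> restores \<alpha>.\<close>

lemma pz_L1_lipschitz:
  assumes z: "z \<in> beliefs" "z' \<in> beliefs"
  shows "(\<integral>x. \<bar>pz z u x - pz z' u x\<bar> \<partial>lam) \<le> \<alpha> * kant z z'"
proof -
  obtain B where B: "B \<in> sets borel" "(\<integral>x. \<bar>pz z u x - pz z' u x\<bar> \<partial>lam) =
    2 * ((\<integral>x. measure (T (x, u)) B \<partial>z) - (\<integral>x. measure (T (x, u)) B \<partial>z'))"
    by (rule pz_L1_diff[OF z])
  have "\<bar>(\<integral>x. measure (T (x, u)) B \<partial>z) - (\<integral>x. measure (T (x, u)) B \<partial>z')\<bar> \<le> \<alpha> / 2 * kant z z'"
  proof (rule lipschitz_integral_diff_le[OF compactX _ _ z])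
    fix x x'
    have "\<bar>measure (T (x, u)) B - measure (T (x', u)) B\<bar> \<le> tv_norm_diff (T (x, u)) (T (x', u)) / 2"
      by (rule measure_diff_le_tv[OF TD(1) TD(1)]) (simp add: TD B)
    then show "\<bar>measure (T (x, u)) B - measure (T (x', u)) B\<bar> \<le> \<alpha> / 2 * dist x x'"
      using tv_lip[of x u x'] by argo
  qed (use \<alpha>_nonneg in simp)
  then show ?thesis unfolding B(2) by argo
qed

text \<open>The realising set changes with n, but total variation is uniform over sets: the
  integrand still tends to 0 for each x, and dominated convergence applies.\<close>

lemma pz_L1_continuous:
  assumes z: "z \<in> beliefs" and u: "us \<longlonglongrightarrow> u"
  shows "(\<lambda>n. \<integral>x. \<bar>pz z (us n) x - pz z u x\<bar> \<partial>lam) \<longlonglongrightarrow> 0"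
proof -
  have "\<forall>n. \<exists>B. B \<in> sets borel \<and> (\<integral>x. \<bar>pz z (us n) x - pz z u x\<bar> \<partial>lam) =
    2 * ((\<integral>x. measure (T (x, us n)) B \<partial>z) - (\<integral>x. measure (T (x, u)) B \<partial>z))"
  proof
    fix n
    show "\<exists>B. B \<in> sets borel \<and> (\<integral>x. \<bar>pz z (us n) x - pz z u x\<bar> \<partial>lam) =
      2 * ((\<integral>x. measure (T (x, us n)) B \<partial>z) - (\<integral>x. measure (T (x, u)) B \<partial>z))"
      by (rule pz_L1_diff[OF z z, of "us n" u]) blast
  qed
  then obtain B where "\<forall>n. B n \<in> sets borel \<and> (\<integral>x. \<bar>pz z (us n) x - pz z u x\<bar> \<partial>lam) =
    2 * ((\<integral>x. measure (T (x, us n)) (B n) \<partial>z) - (\<integral>x. measure (T (x, u)) (B n) \<partial>z))"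
    unfolding choice_iff ..
  then have B: "\<And>n. B n \<in> sets borel" "\<And>n. (\<integral>x. \<bar>pz z (us n) x - pz z u x\<bar> \<partial>lam) =
    2 * ((\<integral>x. measure (T (x, us n)) (B n) \<partial>z) - (\<integral>x. measure (T (x, u)) (B n) \<partial>z))"
    by auto
  interpret z: prob_space z by (rule beliefsD(1)[OF z])
  have m: "(\<lambda>x. measure (T (x, u)) (B n)) \<in> borel_measurable z" for n u
    by (rule measurable_belief[OF z measure_T_measurable[OF B(1)]])
  have le1: "\<bar>measure (T (x, u)) A\<bar> \<le> 1" for x u A using prob_space.prob_le_1[OF TD(1)] by simp
  have i: "integrable z (\<lambda>x. measure (T (x, u)) (B n))" for n u
    by (rule z.integrable_const_bound[of _ 1]) (use m le1 in auto)
  have "(\<lambda>n. \<integral>x. measure (T (x, us n)) (B n) - measure (T (x, u)) (B n) \<partial>z) \<longlonglongrightarrow> (\<integral>x. 0 \<partial>z)"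
  proof (rule integral_dominated_convergence[where w="\<lambda>_. 2"])
    show "AE x in z. (\<lambda>n. measure (T (x, us n)) (B n) - measure (T (x, u)) (B n)) \<longlonglongrightarrow> 0"
    proof (rule AE_I2)
      fix x
      have lim: "(\<lambda>n. tv_norm_diff (T (x, us n)) (T (x, u))) \<longlonglongrightarrow> 0"
        by (rule tv_cont[OF tendsto_const u])
      show "(\<lambda>n. measure (T (x, us n)) (B n) - measure (T (x, u)) (B n)) \<longlonglongrightarrow> 0"
      proof (rule tendsto_rabs_zero_cancel, rule tendsto_sandwich[OF _ _ tendsto_const lim])
        have "\<bar>measure (T (x, us n)) (B n) - measure (T (x, u)) (B n)\<bar> \<le> tv_norm_diff (T (x, us n)) (T (x, u))" for n
          using measure_diff_le_tv[OF TD(1) TD(1), of "B n" "(x, us n)" "(x, u)"] B(1)[of n]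
            tv_norm_diff_nonneg[OF TD(1) TD(1), of "(x, us n)" "(x, u)"] by (simp add: TD)
        then show "\<forall>\<^sub>F n in sequentially. \<bar>measure (T (x, us n)) (B n) - measure (T (x, u)) (B n)\<bar> \<le> tv_norm_diff (T (x, us n)) (T (x, u))"
          by simp
      qed simp
    qed
    show "AE x in z. norm (measure (T (x, us n)) (B n) - measure (T (x, u)) (B n)) \<le> 2" for n
    proof (rule AE_I2)
      fix x
      show "norm (measure (T (x, us n)) (B n) - measure (T (x, u)) (B n)) \<le> 2"
        using le1[of x "us n" "B n"] le1[of x u "B n"] unfolding real_norm_def by linarith
    qed
  qed (use m in auto)
  then have "(\<lambda>n. 2 * (\<integral>x. measure (T (x, us n)) (B n) - measure (T (x, u)) (B n) \<partial>z)) \<longlonglongrightarrow> 2 * 0"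
    by (intro tendsto_mult tendsto_const) simp
  then show ?thesis unfolding B(2) using i by simp
qed

abbreviation "K\<^sub>2 \<equiv> \<alpha> * diameter (UNIV :: 'x set) * (3 - 2 * dobrushin Y Q) / 2"

lemma D_nonneg: "0 \<le> diameter (UNIV :: 'x set)" using dist_le_diameter[OF compactX, of undefined undefined] by simp

lemma dobrushin_le_1: "dobrushin Y Q \<le> 1"
  using dobrushin_kernel_diff[of Q Y "{}" undefined undefined] QD by simp

lemma K2_nonneg: "0 \<le> K\<^sub>2" using \<alpha>_nonneg D_nonneg dobrushin_le_1 by simp

lemma eta_lipschitz:
  assumes h: "lipschitz_h L h" and z: "z \<in> beliefs" "z' \<in> beliefs"
  shows "\<bar>eta h z u - eta h z' u\<bar> \<le> L * K\<^sub>2 * kant z z'"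
proof -
  have "\<bar>eta h z u - eta h z' u\<bar> \<le> L * (diameter (UNIV :: 'x set) / 2) * (3 - 2 * dobrushin Y Q) * (\<alpha> * kant z z')"
    using eta_diff_le[OF h z, of u u] pz_L1_lipschitz[OF z, of u] h D_nonneg dobrushin_le_1
    by (elim order_trans) (intro mult_left_mono, auto simp: lipschitz_h_def)
  then show ?thesis by (simp add: mult_ac)
qed

lemma eta_continuous:
  assumes h: "lipschitz_h L h" and z: "z \<in> beliefs"
  shows "continuous_on UNIV (eta h z)"
  unfolding continuous_on_sequentially
proof (intro ballI allI impI, elim conjE)
  fix us :: "nat \<Rightarrow> 'u" and u assume "us \<longlonglongrightarrow> u"
  from tendsto_mult_left[OF pz_L1_continuous[OF z this], of "L * (diameter (UNIV :: 'x set) / 2) * (3 - 2 * dobrushin Y Q)"]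
  have lim: "(\<lambda>n. L * (diameter (UNIV :: 'x set) / 2) * (3 - 2 * dobrushin Y Q) * (\<integral>x. \<bar>pz z (us n) x - pz z u x\<bar> \<partial>lam)) \<longlonglongrightarrow> 0" by simp
  show "(eta h z \<circ> us) \<longlonglongrightarrow> eta h z u"
    by (rule tendsto_dist_iff[THEN iffD2], rule tendsto_sandwich[OF _ _ tendsto_const lim])
       (use eta_diff_le[OF h z z] in \<open>auto simp: dist_real_def\<close>)
qed

lemma eta_close:
  assumes h: "lipschitz_h L h" "lipschitz_h L' h'" and z: "z \<in> beliefs" and e: "\<And>z. z \<in> beliefs \<Longrightarrow> \<bar>h z - (h' z + b)\<bar> \<le> e"
  shows "\<bar>eta h z u - (eta h' z u + b)\<bar> \<le> e"
proof -
  interpret k: prob_space "belief_kernel Y T Q z u" by (rule belief_kernel_prob[OF z])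
  note i = integrable_kernel[OF h(1) z, of u] integrable_kernel[OF h(2) z, of u]
  have "eta h z u - (eta h' z u + b) = (\<integral>z'. h z' - (h' z' + b) \<partial>belief_kernel Y T Q z u)"
    using i k.prob_space by (simp add: eta_def)
  moreover have "\<bar>\<integral>z'. h z' - (h' z' + b) \<partial>belief_kernel Y T Q z u\<bar> \<le> (\<integral>z'. e \<partial>belief_kernel Y T Q z u)"
    by (rule order_trans[OF integral_abs_bound], rule integral_mono) (use i e in \<open>auto simp: space_belief_kernel\<close>)
  ultimately show ?thesis by (simp add: k.prob_space)
qed

section \<open>The belief cost\<close>

lemma c_bound: obtains C where "0 \<le> C" "\<And>x u. \<bar>c x u\<bar> \<le> C"
proof -
  have "compact (UNIV :: ('x \<times> 'u) set)" using compact_Times[OF compactX compactU] by (simp add: UNIV_Times_UNIV)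
  then obtain C where C: "\<forall>v\<in>(\<lambda>(x, u). c x u) ` UNIV. norm v \<le> C"
    using compact_imp_bounded[OF compact_continuous_image[OF c_cont]] unfolding bounded_iff by blast
  then have "\<bar>c x u\<bar> \<le> C" for x u by (auto simp: split_beta)
  moreover from this[of undefined undefined] have "0 \<le> C" by linarith
  ultimately show ?thesis using that by blast
qed

lemma c_measurable[measurable]: "(\<lambda>(x, u). c x u) \<in> borel_measurable (borel \<Otimes>\<^sub>M borel)"
  unfolding borel_prod by (rule borel_measurable_continuous_onI[OF c_cont])

lemma c_cont_x: "continuous_on UNIV (\<lambda>x. c x u)"
  and c_cont_u: "continuous_on UNIV (c x)"
proof -
  show "continuous_on UNIV (\<lambda>x. c x u)"
    by (rule lipschitz_imp_continuous[of _ "K\<^sub>1"]) (rule c_lip)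
  have "continuous_on UNIV (\<lambda>u. (x, u))" by (intro continuous_intros)
  from continuous_on_compose2[OF c_cont this] show "continuous_on UNIV (c x)" by simp
qed

lemma belief_cost_integrable: "z \<in> beliefs \<Longrightarrow> integrable z (\<lambda>x. c x u)"
  by (rule continuous_integrable[OF compactX c_cont_x])

lemma belief_cost_lipschitz:
  "z \<in> beliefs \<Longrightarrow> z' \<in> beliefs \<Longrightarrow> \<bar>belief_cost c z u - belief_cost c z' u\<bar> \<le> K\<^sub>1 * kant z z'"
  unfolding belief_cost_def by (rule lipschitz_integral_diff_le[OF compactX c_lip K1_nonneg])

lemma belief_cost_bound:
  assumes "\<And>x u. \<bar>c x u\<bar> \<le> C" "z \<in> beliefs"
  shows "\<bar>belief_cost c z u\<bar> \<le> C"
  using belief_integral_close[OF assms(2) belief_cost_integrable[OF assms(2)] integrable_zero, of u 0 C] assms(1)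
  by (simp add: belief_cost_def)

lemma belief_cost_continuous:
  assumes z: "z \<in> beliefs"
  shows "continuous_on UNIV (belief_cost c z)"
  unfolding continuous_on_sequentially
proof (intro ballI allI impI, elim conjE)
  fix us :: "nat \<Rightarrow> 'u" and u assume us: "us \<longlonglongrightarrow> u"
  interpret z: prob_space z by (rule beliefsD(1)[OF z])
  obtain C where C: "\<And>x u. \<bar>c x u\<bar> \<le> C" using c_bound by metis
  have "(\<lambda>n. \<integral>x. c x (us n) \<partial>z) \<longlonglongrightarrow> (\<integral>x. c x u \<partial>z)"
  proof (rule integral_dominated_convergence[where w="\<lambda>_. C"])
    show "AE x in z. (\<lambda>n. c x (us n)) \<longlonglongrightarrow> c x u"
      by (intro AE_I2 continuous_on_tendsto_compose[OF c_cont_u us]) auto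
  qed (use C belief_cost_integrable[OF z] in auto)
  then show "(belief_cost c z \<circ> us) \<longlonglongrightarrow> belief_cost c z u" by (simp add: belief_cost_def comp_def)
qed

section \<open>The Bellman operator and the optimality equation\<close>

definition G :: "('x measure \<Rightarrow> real) \<Rightarrow> 'x measure \<Rightarrow> 'u \<Rightarrow> real" where
  "G h z u = belief_cost c z u + eta h z u"

text \<open>The undiscounted Bellman operator; discounting is expressed by applying it to \<beta>
  times a function. For Lipschitz \<open>h\<close> the real infimum is a minimum, see
  \<open>opt_attained\<close>.\<close>

definition opt :: "('x measure \<Rightarrow> real) \<Rightarrow> 'x measure \<Rightarrow> real" where
  "opt h z = (INF u. G h z u)"

lemma G_continuous: "lipschitz_h L h \<Longrightarrow> z \<in> beliefs \<Longrightarrow> continuous_on UNIV (G h z)"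
  unfolding G_def[abs_def] by (intro continuous_on_add belief_cost_continuous eta_continuous)

lemma G_lipschitz:
  assumes "lipschitz_h L h" "z \<in> beliefs" "z' \<in> beliefs"
  shows "\<bar>G h z u - G h z' u\<bar> \<le> (K\<^sub>1 + L * K\<^sub>2) * kant z z'"
  using eta_lipschitz[OF assms, of u] belief_cost_lipschitz[OF assms(2,3), of u]
  unfolding G_def distrib_right by argo

lemma opt_attained:
  assumes "lipschitz_h L h" "z \<in> beliefs"
  obtains u where "opt h z = G h z u" "\<And>u'. G h z u \<le> G h z u'"
proof -
  obtain u where u: "\<And>u'. G h z u \<le> G h z u'"
    using continuous_attains_inf[OF compactU _ G_continuous[OF assms]] by auto
  then have "opt h z = G h z u" unfolding opt_def
    by (intro cInf_eq_minimum) auto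
  then show ?thesis using u that by blast
qed

lemma opt_le:
  assumes "lipschitz_h L h" "z \<in> beliefs"
  shows "opt h z \<le> G h z u"
  using opt_attained[OF assms] by metis

text \<open>Each minimizer is tried in the other problem. Function and belief may change at once, so
  that perturbations of either are covered.\<close>

lemma opt_close:
  assumes h: "lipschitz_h L h" "lipschitz_h L' h'" and z: "z \<in> beliefs" "z' \<in> beliefs"
    and e: "\<And>u. \<bar>G h z u - (G h' z' u + b)\<bar> \<le> e"
  shows "\<bar>opt h z - (opt h' z' + b)\<bar> \<le> e"
proof -
  obtain u where u: "opt h z = G h z u" using opt_attained[OF h(1) z(1)] by metis
  obtain u' where u': "opt h' z' = G h' z' u'" using opt_attained[OF h(2) z(2)] by metis
  show ?thesis using e[of u] e[of u'] opt_le[OF h(1) z(1), of u'] opt_le[OF h(2) z(2), of u]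
    unfolding u u' by linarith
qed

lemma opt_nonexpansive:
  assumes h: "lipschitz_h L h" "lipschitz_h L' h'" and z: "z \<in> beliefs"
    and e: "\<And>z. z \<in> beliefs \<Longrightarrow> \<bar>h z - (h' z + b)\<bar> \<le> e"
  shows "\<bar>opt h z - (opt h' z + b)\<bar> \<le> e"
proof (rule opt_close[OF h z z])
  show "\<bar>G h z u - (G h' z u + b)\<bar> \<le> e" for u
  proof -
    have "\<bar>eta h z u - (eta h' z u + b)\<bar> \<le> e" by (rule eta_close[OF h z e])
    then show ?thesis unfolding G_def by argo
  qed
qed

lemma opt_lipschitz:
  assumes "lipschitz_h L h"
  shows "lipschitz_h (K\<^sub>1 + L * K\<^sub>2) (opt h)"
proof -
  have "\<bar>opt h z - opt h z'\<bar> \<le> (K\<^sub>1 + L * K\<^sub>2) * kant z z'" if "z \<in> beliefs" "z' \<in> beliefs" for z z'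
    using opt_close[OF assms assms that, of 0] G_lipschitz[OF assms that] by simp
  moreover have "0 \<le> K\<^sub>1 + L * K\<^sub>2" using K1_nonneg K2_nonneg assms unfolding lipschitz_h_def by (intro add_nonneg_nonneg mult_nonneg_nonneg) auto
  ultimately show ?thesis by (simp add: lipschitz_h_def)
qed

abbreviation "Lip \<equiv> K\<^sub>1 / (1 - K\<^sub>2)"

lemma Lip_fixed: "K\<^sub>1 + Lip * K\<^sub>2 = Lip"
  using contraction by (simp add: field_simps)

lemma Lip_nonneg: "0 \<le> Lip" using K1_nonneg contraction by simp

lemma opt_Lip: "lipschitz_h Lip h \<Longrightarrow> lipschitz_h Lip (opt h)"
  using opt_lipschitz[of Lip h] by (simp only: Lip_fixed)

lemma lipschitz_h_scale: "lipschitz_h L h \<Longrightarrow> 0 \<le> b \<Longrightarrow> b \<le> 1 \<Longrightarrow> lipschitz_h L (\<lambda>z. b * h z + a)"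
proof -
  assume h: "lipschitz_h L h" and b: "0 \<le> b" "b \<le> 1"
  have "\<bar>b * h z + a - (b * h z' + a)\<bar> \<le> L * kant z z'" if "z \<in> beliefs" "z' \<in> beliefs" for z z'
  proof -
    have "\<bar>b * h z + a - (b * h z' + a)\<bar> = b * \<bar>h z - h z'\<bar>"
      using b by (simp add: right_diff_distrib[symmetric] abs_mult)
    also have "\<dots> \<le> 1 * \<bar>h z - h z'\<bar>" by (rule mult_right_mono) (use b in auto)
    also have "\<dots> \<le> L * kant z z'" using lipschitz_hD[OF h that] by simp
    finally show ?thesis .
  qed
  then show ?thesis using h by (simp add: lipschitz_h_def)
qed

text \<open>A vanishing discount argument. For a discounted value iterate v the residual of the
  average cost equation splits into an increment of the iteration, of order \<beta>^k, and (1 -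
  \<beta>) times a difference of values of v, which is at most \<open>Lip\<close> times the diameter
  for every \<beta>.\<close>

lemma approximate_acoe:
  assumes "0 < e" and z0: "z0 \<in> beliefs"
  obtains h \<rho> where "lipschitz_h Lip h" "h z0 = 0" "\<And>z. z \<in> beliefs \<Longrightarrow> \<bar>opt h z - (h z + \<rho>)\<bar> \<le> e"
proof -
  obtain C where C: "0 \<le> C" "\<And>x u. \<bar>c x u\<bar> \<le> C" using c_bound by metis
  \<comment> \<open>Chosen to make (1 - \<beta>) times \<open>Lip\<close> times the diameter at most
    e/2. The 1 in the denominator avoids a division by 0, and the minimum keeps \<beta>
    nonnegative.\<close>
  define \<beta> where "\<beta> = 1 - min 1 (e / (2 * (Lip * diameter (UNIV :: 'x set) + 1)))"
  have LD: "0 \<le> Lip * diameter (UNIV :: 'x set)" using Lip_nonneg D_nonneg by (rule mult_nonneg_nonneg)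
  have pos: "0 < e / (2 * (Lip * diameter (UNIV :: 'x set) + 1))" using \<open>0 < e\<close> LD by (intro divide_pos_pos) auto
  have \<beta>: "0 \<le> \<beta>" "\<beta> < 1" using pos by (auto simp: \<beta>_def)
  have bD: "(1 - \<beta>) * (Lip * diameter (UNIV :: 'x set)) \<le> e / 2"
  proof -
    have "(1 - \<beta>) * (Lip * diameter (UNIV :: 'x set)) \<le> e / (2 * (Lip * diameter (UNIV :: 'x set) + 1)) * (Lip * diameter (UNIV :: 'x set) + 1)"
      using LD pos by (intro mult_mono) (auto simp: \<beta>_def)
    also have "\<dots> = e / 2" by (subst mult.commute) (rule succ_mult_divide_cancel[OF LD])
    finally show ?thesis .
  qed
  \<comment> \<open>The iterates of the discounted Bellman operator. The term \<open>+ 0\<close>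
    gives the argument the form of \<open>lipschitz_h_scale\<close>.\<close>
  define v where "v k = ((\<lambda>w. opt (\<lambda>z. \<beta> * w z + 0)) ^^ k) (\<lambda>_. 0)" for k
  have v0: "v 0 = (\<lambda>_. 0)" and vS: "v (Suc k) = opt (\<lambda>z. \<beta> * v k z + 0)" for k by (auto simp: v_def)
  have zero: "lipschitz_h Lip (\<lambda>_. 0)"
    by (rule lipschitz_h_const[OF Lip_nonneg])
  have vL: "lipschitz_h Lip (v k)" for k
    by (induction k) (use zero \<beta> in \<open>auto simp: v0 vS simp del: add_0_right intro!: opt_Lip lipschitz_h_scale\<close>)
  have bvL: "lipschitz_h Lip (\<lambda>z. \<beta> * v k z + a)" for k a
    using lipschitz_h_scale[OF vL] \<beta> by simp
  have diff: "\<bar>v (Suc k) z - v k z\<bar> \<le> \<beta> ^ k * C" if "z \<in> beliefs" for k z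
    using that
  proof (induction k arbitrary: z)
    case 0
    obtain u where u: "opt (\<lambda>_. 0) z = G (\<lambda>_. 0) z u" using opt_attained[OF zero 0] by metis
    show ?case using belief_cost_bound[OF C(2) 0, of u] by (simp add: v0 vS u G_def eta_def)
  next
    case (Suc k)
    have "\<bar>opt (\<lambda>z. \<beta> * v (Suc k) z + 0) z - (opt (\<lambda>z. \<beta> * v k z + 0) z + 0)\<bar> \<le> \<beta> * (\<beta> ^ k * C)"
    proof (rule opt_nonexpansive[OF bvL bvL Suc.prems])
      fix z :: "'x measure" assume "z \<in> beliefs"
      from mult_left_mono[OF Suc.IH[OF this] \<beta>(1)]
      show "\<bar>\<beta> * v (Suc k) z + 0 - (\<beta> * v k z + 0 + 0)\<bar> \<le> \<beta> * (\<beta> ^ k * C)"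
        using \<beta>(1) by (simp add: right_diff_distrib[symmetric] abs_mult del: right_diff_distrib)
    qed
    then show ?case unfolding vS[of "Suc k"] vS[of k] by (simp add: vS mult.assoc)
  qed
  have "(\<lambda>k. \<beta> ^ k * C) \<longlonglongrightarrow> 0 * C" by (intro tendsto_mult tendsto_const LIMSEQ_power_zero) (use \<beta> in auto)
  then have "\<forall>\<^sub>F k in sequentially. \<beta> ^ k * C < e / 2" using \<open>0 < e\<close> by (intro order_tendstoD) auto
  then obtain k where k: "\<beta> ^ k * C < e / 2" by (auto simp: eventually_sequentially)
  define h where "h z = \<beta> * v k z + - (\<beta> * v k z0)" for z
  show ?thesis
  proof (rule that)
    show hL: "lipschitz_h Lip h" unfolding h_def by (rule bvL)
    show "h z0 = 0" by (simp add: h_def)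
    fix z :: "'x measure" assume z: "z \<in> beliefs"
    \<comment> \<open>\<open>opt\<close> commutes with adding constants: this is
      \<open>opt_nonexpansive\<close> with error 0.\<close>
    have "\<bar>opt h z - (opt (\<lambda>z. \<beta> * v k z + 0) z + - (\<beta> * v k z0))\<bar> \<le> 0"
      by (rule opt_nonexpansive[OF hL bvL z]) (simp add: h_def)
    then have "opt h z = v (Suc k) z - \<beta> * v k z0" by (simp add: vS)
    then have "opt h z - (h z + (1 - \<beta>) * v k z0) = (v (Suc k) z - v k z) + (1 - \<beta>) * (v k z - v k z0)"
      by (simp add: h_def algebra_simps)
    moreover have "\<bar>(1 - \<beta>) * (v k z - v k z0)\<bar> \<le> e / 2"
    proof -
      have "\<bar>(1 - \<beta>) * (v k z - v k z0)\<bar> = (1 - \<beta>) * \<bar>v k z - v k z0\<bar>" using \<beta> by (simp add: abs_mult)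
      also have "\<dots> \<le> (1 - \<beta>) * (Lip * diameter (UNIV :: 'x set))"
        by (rule mult_left_mono[OF lipschitz_h_bound[OF vL z z0]]) (use \<beta> in simp)
      finally have "\<bar>(1 - \<beta>) * (v k z - v k z0)\<bar> \<le> (1 - \<beta>) * (Lip * diameter (UNIV :: 'x set))" .
      then show ?thesis using bD by linarith
    qed
    ultimately show "\<bar>opt h z - (h z + (1 - \<beta>) * v k z0)\<bar> \<le> e"
      using diff[OF z, of k] k by argo
  qed
qed

text \<open>The approximate solutions share a Lipschitz constant and vanish at \<open>z0\<close>, so
  they are bounded. Convergence along a dense sequence spreads to all beliefs by the Lipschitz bound
  and is uniform by total boundedness. Uniformity lets \<open>opt\<close> pass to the limit.\<close>

lemma acoe_exists:
  obtains h \<rho> where "lipschitz_h Lip h" "\<And>z. z \<in> beliefs \<Longrightarrow> opt h z = h z + \<rho>"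
proof -
  define z0 :: "'x measure" where "z0 = return borel undefined"
  have z0: "z0 \<in> beliefs" unfolding z0_def by (rule return_in_beliefs[OF compactX])
  have "\<forall>n::nat. \<exists>h \<rho>. lipschitz_h Lip h \<and> h z0 = 0 \<and> (\<forall>z\<in>beliefs. \<bar>opt h z - (h z + \<rho>)\<bar> \<le> 1 / Suc n)"
  proof
    fix n :: nat
    show "\<exists>h \<rho>. lipschitz_h Lip h \<and> h z0 = 0 \<and> (\<forall>z\<in>beliefs. \<bar>opt h z - (h z + \<rho>)\<bar> \<le> 1 / Suc n)"
      using approximate_acoe[of "1 / Suc n", OF _ z0] by (metis of_nat_0_less_iff zero_less_Suc zero_less_divide_1_iff)
  qed
  then obtain h where "\<forall>n::nat. \<exists>\<rho>. lipschitz_h Lip (h n) \<and> h n z0 = 0 \<and> (\<forall>z\<in>beliefs. \<bar>opt (h n) z - (h n z + \<rho>)\<bar> \<le> 1 / Suc n)"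
    unfolding choice_iff by blast
  then have hL: "lipschitz_h Lip (h n)" and h0: "h n z0 = 0"
    and ex: "\<exists>\<rho>. \<forall>z\<in>beliefs. \<bar>opt (h n) z - (h n z + \<rho>)\<bar> \<le> 1 / Suc n" for n by auto
  \<comment> \<open>The constants \<rho> are eliminated: since \<open>h n z0 = 0\<close>, they are
    within 1/(n+1) of \<open>opt (h n) z0\<close>, whose convergence follows from that of the
    functions.\<close>
  have app: "\<bar>opt (h n) z - h n z - opt (h n) z0\<bar> \<le> 2 * (1 / Suc n)" if "z \<in> beliefs" for n z
  proof -
    obtain \<rho> where "\<And>z. z \<in> beliefs \<Longrightarrow> \<bar>opt (h n) z - (h n z + \<rho>)\<bar> \<le> 1 / Suc n" using ex by blast
    from this[OF that] this[OF z0] show ?thesis unfolding h0 by linarith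
  qed
  obtain d :: "nat \<Rightarrow> 'x measure" where d: "\<And>n. d n \<in> beliefs" "\<And>z e. z \<in> beliefs \<Longrightarrow> 0 < e \<Longrightarrow> \<exists>n. kant z (d n) < e"
    using kant_dense_sequence[OF compactX] by metis
  have "\<bar>h n (d i)\<bar> \<le> Lip * diameter (UNIV :: 'x set)" for n i
    using lipschitz_h_bound[OF hL d(1) z0, of n i] by (simp add: h0)
  then obtain s where s: "strict_mono s" "\<And>i. convergent (\<lambda>n. h (s n) (d i))"
    using bounded_sequences_convergent_subseq[of "\<lambda>n i. h n (d i)"] by metis
  have conv: "convergent (\<lambda>n. h (s n) z)" if z: "z \<in> beliefs" for z
  proof (rule Cauchy_convergent, rule metric_CauchyI)
    fix e :: real assume "0 < e"
    \<comment> \<open>\<open>Lip\<close> may be 0, hence the divisor \<open>Lip + 1\<close>.\<close>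
    then have "0 < e / (3 * (Lip + 1))" using Lip_nonneg by (intro divide_pos_pos) auto
    then obtain i where i: "kant z (d i) < e / (3 * (Lip + 1))" using d(2)[OF z] by blast
    have small: "Lip * kant z (d i) \<le> e / 3"
    proof -
      have "Lip * kant z (d i) \<le> (Lip + 1) * (e / (3 * (Lip + 1)))"
        using i Lip_nonneg kant_nonneg[OF compactX z d(1)] by (intro mult_mono) auto
      also have "\<dots> = e / 3" by (rule succ_mult_divide_cancel[OF Lip_nonneg])
      finally show ?thesis .
    qed
    have "Cauchy (\<lambda>n. h (s n) (d i))" using s(2) by (rule convergent_Cauchy)
    then obtain N where N: "\<And>m n. N \<le> m \<Longrightarrow> N \<le> n \<Longrightarrow> dist (h (s m) (d i)) (h (s n) (d i)) < e / 3"
      using \<open>0 < e\<close> unfolding Cauchy_def by (metis divide_pos_pos zero_less_numeral)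
    show "\<exists>M. \<forall>m\<ge>M. \<forall>n\<ge>M. dist (h (s m) z) (h (s n) z) < e"
    proof (intro exI allI impI)
      fix m n assume "N \<le> m" "N \<le> n"
      have "\<bar>h (s m) (d i) - h (s n) (d i)\<bar> < e / 3" using N[OF \<open>N \<le> m\<close> \<open>N \<le> n\<close>] by (simp add: dist_real_def)
      then show "dist (h (s m) z) (h (s n) z) < e"
        using lipschitz_hD[OF hL z d(1), of "s m" i] lipschitz_hD[OF hL z d(1), of "s n" i] small
        unfolding dist_real_def by argo
    qed
  qed
  define H where "H z = lim (\<lambda>n. h (s n) z)" for z
  have H: "(\<lambda>n. h (s n) z) \<longlonglongrightarrow> H z" if "z \<in> beliefs" for z
    using conv[OF that] by (simp add: H_def convergent_LIMSEQ_iff)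
  have HL: "lipschitz_h Lip H" unfolding lipschitz_h_def
  proof (intro conjI ballI Lip_nonneg)
    fix z z' :: "'x measure" assume z: "z \<in> beliefs" "z' \<in> beliefs"
    have "(\<lambda>n. \<bar>h (s n) z - h (s n) z'\<bar>) \<longlonglongrightarrow> \<bar>H z - H z'\<bar>" by (intro tendsto_intros H z)
    then show "\<bar>H z - H z'\<bar> \<le> Lip * kant z z'"
      by (rule LIMSEQ_le_const2) (use lipschitz_hD[OF hL z] in auto)
  qed
  have unif: "\<exists>n0. \<forall>n\<ge>n0. \<forall>z\<in>beliefs. \<bar>h (s n) z - H z\<bar> \<le> e" if "0 < e" for e
  proof -
    have "0 < e / (3 * (Lip + 1))" using Lip_nonneg \<open>0 < e\<close> by (intro divide_pos_pos) auto
    then obtain N :: "'x measure set" where N: "finite N" "N \<subseteq> beliefs"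
      "\<And>z. z \<in> beliefs \<Longrightarrow> \<exists>z'\<in>N. kant z z' \<le> e / (3 * (Lip + 1))"
      by (rule kant_totally_bounded[OF compactX]) blast
    have "\<forall>\<^sub>F n in sequentially. \<forall>z\<in>N. \<bar>h (s n) z - H z\<bar> < e / 3"
      unfolding eventually_ball_finite_distrib[OF N(1)]
    proof
      fix z assume "z \<in> N"
      then have "(\<lambda>n. h (s n) z) \<longlonglongrightarrow> H z" using H N(2) by auto
      then have "\<forall>\<^sub>F n in sequentially. dist (h (s n) z) (H z) < e / 3" using \<open>0 < e\<close> by (intro tendstoD) auto
      then show "\<forall>\<^sub>F n in sequentially. \<bar>h (s n) z - H z\<bar> < e / 3" by (simp add: dist_real_def)
    qed
    then obtain n0 where n0: "\<And>n z. n0 \<le> n \<Longrightarrow> z \<in> N \<Longrightarrow> \<bar>h (s n) z - H z\<bar> < e / 3"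
      by (auto simp: eventually_sequentially)
    have "\<bar>h (s n) z - H z\<bar> \<le> e" if "n0 \<le> n" and z: "z \<in> beliefs" for n z
    proof -
      obtain z' where z': "z' \<in> N" "kant z z' \<le> e / (3 * (Lip + 1))" using N(3)[OF z] by blast
      then have zb: "z' \<in> beliefs" using N(2) by auto
      have "Lip * kant z z' \<le> (Lip + 1) * (e / (3 * (Lip + 1)))"
        using z' Lip_nonneg kant_nonneg[OF compactX z zb] by (intro mult_mono) auto
      also have "\<dots> = e / 3" by (rule succ_mult_divide_cancel[OF Lip_nonneg])
      finally have "Lip * kant z z' \<le> e / 3" .
      then show ?thesis
        using lipschitz_hD[OF hL z zb, of "s n"] lipschitz_hD[OF HL z zb] n0[OF \<open>n0 \<le> n\<close> z'(1)] by argo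
    qed
    then show ?thesis by blast
  qed
  have opt_conv: "(\<lambda>n. opt (h (s n)) z) \<longlonglongrightarrow> opt H z" if z: "z \<in> beliefs" for z
  proof (rule metric_LIMSEQ_I)
    fix e :: real assume "0 < e"
    then obtain n0 where n0: "\<And>n z. n0 \<le> n \<Longrightarrow> z \<in> beliefs \<Longrightarrow> \<bar>h (s n) z - H z\<bar> \<le> e / 2"
      using unif[of "e / 2"] by auto
    have "dist (opt (h (s n)) z) (opt H z) < e" if "n0 \<le> n" for n
      using opt_nonexpansive[OF hL HL z, of "s n" 0 "e / 2"] n0[OF that] \<open>0 < e\<close> by (simp add: dist_real_def)
    then show "\<exists>n0. \<forall>n\<ge>n0. dist (opt (h (s n)) z) (opt H z) < e" by blast
  qed
  show ?thesis
  proof (rule that[OF HL])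
    fix z :: "'x measure" assume z: "z \<in> beliefs"
    have lim: "(\<lambda>n. \<bar>opt (h (s n)) z - h (s n) z - opt (h (s n)) z0\<bar>) \<longlonglongrightarrow> \<bar>opt H z - H z - opt H z0\<bar>"
      by (intro tendsto_intros opt_conv H z z0)
    have "(\<lambda>n. 2 * (1 / Suc (s n))) \<longlonglongrightarrow> (2 * 0 :: real)"
      using LIMSEQ_subseq_LIMSEQ[OF LIMSEQ_Suc[OF lim_inverse_n'] s(1)]
      by (intro tendsto_mult tendsto_const) (simp add: comp_def)
    from LIMSEQ_le[OF lim this] have "\<bar>opt H z - H z - opt H z0\<bar> \<le> 2 * 0" using app[OF z] by blast
    then show "opt H z = H z + opt H z0" by simp
  qed
qed

lemma acoe_with_selector:
  obtains h \<rho> g where "lipschitz_h Lip h" "g \<in> prob_algebra borel \<rightarrow>\<^sub>M borel"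
    "\<And>z u. z \<in> beliefs \<Longrightarrow> h z + \<rho> \<le> belief_cost c z u + eta h z u"
    "\<And>z. z \<in> beliefs \<Longrightarrow> h z + \<rho> = belief_cost c z (g z) + eta h z (g z)"
proof -
  obtain h \<rho> where h: "lipschitz_h Lip h" and eq: "\<And>z. z \<in> beliefs \<Longrightarrow> opt h z = h z + \<rho>"
    using acoe_exists by metis
  have "lipschitz_h (K\<^sub>1 + Lip * K\<^sub>2) (\<lambda>z. G h z u)" for u
    using G_lipschitz[OF h, of _ _ u] opt_lipschitz[OF h] by (auto simp: lipschitz_h_def)
  from lipschitz_h_measurable[OF this]
  obtain g where g: "g \<in> prob_algebra borel \<rightarrow>\<^sub>M borel" "\<And>z u. z \<in> space (prob_algebra borel) \<Longrightarrow> G h z (g z) \<le> G h z u"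
    using measurable_argmin[OF compactU, of "G h" "prob_algebra borel"] G_continuous[OF h] unfolding beliefs_eq by blast
  show ?thesis
  proof (rule that[OF h g(1)])
    show "h z + \<rho> \<le> belief_cost c z u + eta h z u" if "z \<in> beliefs" for z u
      using opt_le[OF h that, of u] eq[OF that] by (simp add: G_def)
    fix z :: "'x measure" assume z: "z \<in> beliefs"
    obtain u where "opt h z = G h z u" by (rule opt_attained[OF h z])
    then show "h z + \<rho> = belief_cost c z (g z) + eta h z (g z)"
      using opt_le[OF h z, of "g z"] g(2)[of z u] z eq[OF z] by (simp add: G_def beliefs_eq)
  qed
qed

lemma acoe_solutionI:
  assumes h: "lipschitz_h L h" and g: "g \<in> prob_algebra borel \<rightarrow>\<^sub>M borel"
    and le: "\<And>z u. z \<in> beliefs \<Longrightarrow> h z + \<rho> \<le> belief_cost c z u + eta h z u"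
    and eq: "\<And>z. z \<in> beliefs \<Longrightarrow> h z + \<rho> = belief_cost c z (g z) + eta h z (g z)"
  shows "acoe_solution Y T Q c h g \<rho>"
  unfolding acoe_solution_def
proof (intro conjI ballI allI)
  show "h \<in> belief_algebra \<rightarrow>\<^sub>M borel" "g \<in> belief_algebra \<rightarrow>\<^sub>M borel"
    using lipschitz_h_measurable[OF h] g by (auto simp: measurable_cong_sets[OF sets_belief_alg refl])
  fix z :: "'x measure" assume z: "z \<in> beliefs"
  show "integrable (belief_kernel Y T Q z u) h" for u by (rule integrable_kernel[OF h z])
  show "h z + \<rho> = belief_cost c z (g z) + (\<integral>z'. h z' \<partial>belief_kernel Y T Q z (g z))"
    using eq[OF z] by (simp add: eta_def)
  show "ereal (h z + \<rho>) = (INF u. ereal (belief_cost c z u + (\<integral>z'. h z' \<partial>belief_kernel Y T Q z u)))"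
  proof (rule antisym)
    show "ereal (h z + \<rho>) \<le> (INF u. ereal (belief_cost c z u + (\<integral>z'. h z' \<partial>belief_kernel Y T Q z u)))"
      using le[OF z] by (intro INF_greatest) (simp add: eta_def)
    show "(INF u. ereal (belief_cost c z u + (\<integral>z'. h z' \<partial>belief_kernel Y T Q z u))) \<le> ereal (h z + \<rho>)"
      unfolding eq[OF z] eta_def by (rule INF_lower) simp
  qed
qed

end

section \<open>Filtering along a controlled path\<close>

lemma nn_integral_bind_return:
  assumes M: "M \<in> space (prob_algebra A)" and k: "k \<in> A \<rightarrow>\<^sub>M prob_algebra B"
    and t: "(\<lambda>(x, y). t x y) \<in> A \<Otimes>\<^sub>M B \<rightarrow>\<^sub>M N" and f: "f \<in> borel_measurable N"
  shows "(\<integral>\<^sup>+w. f w \<partial>(M \<bind> (\<lambda>x. k x \<bind> (\<lambda>y. return N (t x y))))) = (\<integral>\<^sup>+x. \<integral>\<^sup>+y. f (t x y) \<partial>k x \<partial>M)"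
proof -
  have sM: "sets M = sets A" using M by (simp add: space_prob_algebra)
  have t'[measurable]: "(\<lambda>w. t (fst w) (snd w)) \<in> A \<Otimes>\<^sub>M B \<rightarrow>\<^sub>M N" using t by (simp add: split_beta')
  note [measurable] = k
  have inner: "(\<lambda>x. k x \<bind> (\<lambda>y. return N (t x y))) \<in> A \<rightarrow>\<^sub>M prob_algebra N"
    by measurable
  have "(\<integral>\<^sup>+w. f w \<partial>(M \<bind> (\<lambda>x. k x \<bind> (\<lambda>y. return N (t x y))))) =
      (\<integral>\<^sup>+x. \<integral>\<^sup>+w. f w \<partial>(k x \<bind> (\<lambda>y. return N (t x y))) \<partial>M)"
    by (rule nn_integral_bind[OF f]) (use measurable_prob_algebraD[OF inner] in \<open>simp add: measurable_cong_sets[OF sM refl]\<close>)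
  also have "\<dots> = (\<integral>\<^sup>+x. \<integral>\<^sup>+y. f (t x y) \<partial>k x \<partial>M)"
  proof (rule nn_integral_cong)
    fix x assume "x \<in> space M"
    then have x: "x \<in> space A" using sets_eq_imp_space_eq[OF sM] by simp
    have kx: "sets (k x) = sets B" using measurable_space[OF k x] by (simp add: space_prob_algebra)
    have tx: "t x \<in> B \<rightarrow>\<^sub>M N" using measurable_compose[OF measurable_Pair1'[OF x] t] by simp
    have "(\<integral>\<^sup>+w. f w \<partial>(k x \<bind> (\<lambda>y. return N (t x y)))) = (\<integral>\<^sup>+y. \<integral>\<^sup>+w. f w \<partial>return N (t x y) \<partial>k x)"
      by (rule nn_integral_bind[OF f])
         (use measurable_compose[OF tx return_measurable] in \<open>simp add: measurable_cong_sets[OF kx refl]\<close>)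
    also have "\<dots> = (\<integral>\<^sup>+y. f (t x y) \<partial>k x)"
      using measurable_space[OF tx] f sets_eq_imp_space_eq[OF kx] by (intro nn_integral_cong nn_integral_return) auto
    finally show "(\<integral>\<^sup>+w. f w \<partial>(k x \<bind> (\<lambda>y. return N (t x y)))) = (\<integral>\<^sup>+y. f (t x y) \<partial>k x)" .
  qed
  finally show ?thesis .
qed

text \<open>Each side integrates against a joint law on the product, built from one marginal and a
  kernel for the other coordinate. Agreement on rectangles makes the two laws equal. Conditional
  laws enter the path computations in this form.\<close>

lemma nn_integral_swap_kernels:
  assumes M1: "M1 \<in> space (prob_algebra A)" and k1[measurable]: "k1 \<in> A \<rightarrow>\<^sub>M prob_algebra B"
    and M2: "M2 \<in> space (prob_algebra B)" and k2[measurable]: "k2 \<in> B \<rightarrow>\<^sub>M prob_algebra A"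
    and rect: "\<And>a b. a \<in> sets A \<Longrightarrow> b \<in> sets B \<Longrightarrow>
      (\<integral>\<^sup>+x. emeasure (k1 x) b * indicator a x \<partial>M1) = (\<integral>\<^sup>+y. emeasure (k2 y) a * indicator b y \<partial>M2)"
    and g: "(\<lambda>(x, y). g x y) \<in> borel_measurable (A \<Otimes>\<^sub>M B)"
  shows "(\<integral>\<^sup>+x. \<integral>\<^sup>+y. g x y \<partial>k1 x \<partial>M1) = (\<integral>\<^sup>+y. \<integral>\<^sup>+x. g x y \<partial>k2 y \<partial>M2)"
proof -
  let ?N = "A \<Otimes>\<^sub>M B"
  define J1 where "J1 = M1 \<bind> (\<lambda>x. k1 x \<bind> (\<lambda>y. return ?N (x, y)))"
  define J2 where "J2 = M2 \<bind> (\<lambda>y. k2 y \<bind> (\<lambda>x. return ?N (x, y)))"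
  have e1: "(\<integral>\<^sup>+w. f w \<partial>J1) = (\<integral>\<^sup>+x. \<integral>\<^sup>+y. f (x, y) \<partial>k1 x \<partial>M1)" if "f \<in> borel_measurable ?N" for f
    unfolding J1_def by (rule nn_integral_bind_return[OF M1 k1 _ that]) measurable
  have e2: "(\<integral>\<^sup>+w. f w \<partial>J2) = (\<integral>\<^sup>+y. \<integral>\<^sup>+x. f (x, y) \<partial>k2 y \<partial>M2)" if "f \<in> borel_measurable ?N" for f
    unfolding J2_def by (rule nn_integral_bind_return[OF M2 k2 _ that]) measurable
  have i1: "(\<lambda>x. k1 x \<bind> (\<lambda>y. return ?N (x, y))) \<in> A \<rightarrow>\<^sub>M prob_algebra ?N" by measurable
  have i2: "(\<lambda>y. k2 y \<bind> (\<lambda>x. return ?N (x, y))) \<in> B \<rightarrow>\<^sub>M prob_algebra ?N" by measurable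
  have J: "sets J1 = sets ?N" "sets J2 = sets ?N" "prob_space J1"
    unfolding J1_def J2_def using sets_bind'[OF M1 i1] sets_bind'[OF M2 i2] prob_space_bind'[OF M1 i1] by auto
  have "J1 = J2"
  proof (rule measure_eqI_generator_eq[OF Int_stable_pair_measure_generator[of A B], where \<Omega>="space A \<times> space B" and A="\<lambda>_. space A \<times> space B"])
    fix X assume "X \<in> {a \<times> b |a b. a \<in> sets A \<and> b \<in> sets B}"
    then obtain a b where ab[measurable]: "a \<in> sets A" "b \<in> sets B" and X: "X = a \<times> b" by auto
    have X': "X \<in> sets ?N" unfolding X by measurable
    have s1: "sets (k1 x) = sets B" if "x \<in> space M1" for x
      using measurable_space[OF k1, of x] that M1 sets_eq_imp_space_eq[of M1 A] by (auto simp: space_prob_algebra)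
    have s2: "sets (k2 y) = sets A" if "y \<in> space M2" for y
      using measurable_space[OF k2, of y] that M2 sets_eq_imp_space_eq[of M2 B] by (auto simp: space_prob_algebra)
    have "emeasure J1 X = (\<integral>\<^sup>+x. \<integral>\<^sup>+y. indicator X (x, y) \<partial>k1 x \<partial>M1)"
      using e1[of "indicator X"] X' J by simp
    also have "\<dots> = (\<integral>\<^sup>+x. emeasure (k1 x) b * indicator a x \<partial>M1)"
    proof (rule nn_integral_cong)
      fix x assume "x \<in> space M1"
      then have "b \<in> sets (k1 x)" using s1 ab by simp
      then show "(\<integral>\<^sup>+y. indicator X (x, y) \<partial>k1 x) = emeasure (k1 x) b * indicator a x"
        unfolding X indicator_times by (cases "x \<in> a") (auto simp: nn_integral_cmult)
    qed
    also have "\<dots> = (\<integral>\<^sup>+y. emeasure (k2 y) a * indicator b y \<partial>M2)" by (rule rect[OF ab])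
    also have "\<dots> = (\<integral>\<^sup>+y. \<integral>\<^sup>+x. indicator X (x, y) \<partial>k2 y \<partial>M2)"
    proof (rule nn_integral_cong)
      fix y assume "y \<in> space M2"
      then have "a \<in> sets (k2 y)" using s2 ab by simp
      then show "emeasure (k2 y) a * indicator b y = (\<integral>\<^sup>+x. indicator X (x, y) \<partial>k2 y)"
        unfolding X indicator_times by (cases "y \<in> b") (auto simp: nn_integral_cmult)
    qed
    also have "\<dots> = emeasure J2 X" using e2[of "indicator X"] X' J by simp
    finally show "emeasure J1 X = emeasure J2 X" .
  next
    show "emeasure J1 (space A \<times> space B) \<noteq> \<infinity>"
      using prob_space.finite_measure[OF J(3)] finite_measure.emeasure_finite by (simp add: top.not_eq_extremum less_top)
  qed (use J in \<open>auto simp: sets_pair_measure pair_measure_closed\<close>)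
  then show ?thesis using e1[OF g] e2[OF g] by simp
qed

lemma measurable_nn_integral_kernel:
  assumes "(\<lambda>(w, x). f w x) \<in> borel_measurable (N \<Otimes>\<^sub>M M)" "L \<in> N \<rightarrow>\<^sub>M prob_algebra M"
  shows "(\<lambda>w. \<integral>\<^sup>+x. f w x \<partial>L w) \<in> borel_measurable N"
  by (rule nn_integral_measurable_subprob_algebra2[OF assms(1) measurable_prob_algebraD[OF assms(2)]])

text \<open>The filter identities are proved for nonnegative integrands, where integrability is no
  issue. Adding a bound \<open>C\<close> carries them over to bounded functions.\<close>

lemma integral_eq_of_nn_integral_shift:
  fixes f g :: "'a \<Rightarrow> real"
  assumes "prob_space M" and f: "f \<in> borel_measurable M" "\<And>x. x \<in> space M \<Longrightarrow> \<bar>f x\<bar> \<le> C"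
    and g: "g \<in> borel_measurable M" "\<And>x. x \<in> space M \<Longrightarrow> \<bar>g x\<bar> \<le> C"
    and eq: "(\<integral>\<^sup>+x. ennreal (f x + C) \<partial>M) = (\<integral>\<^sup>+x. ennreal (g x + C) \<partial>M)"
  shows "(\<integral>x. f x \<partial>M) = (\<integral>x. g x \<partial>M)"
proof -
  interpret prob_space M by fact
  have *: "ennreal ((\<integral>x. k x \<partial>M) + C) = (\<integral>\<^sup>+x. ennreal (k x + C) \<partial>M)" "0 \<le> (\<integral>x. k x \<partial>M) + C"
    if k: "k \<in> borel_measurable M" "\<And>x. x \<in> space M \<Longrightarrow> \<bar>k x\<bar> \<le> C" for k
  proof -
    have i: "integrable M k" by (rule integrable_const_bound[of _ C]) (use k in auto)
    have nn: "0 \<le> k x + C" if "x \<in> space M" for x using k(2)[OF that] by linarith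
    have "(\<integral>\<^sup>+x. ennreal (k x + C) \<partial>M) = ennreal (\<integral>x. k x + C \<partial>M)"
      using i nn by (intro nn_integral_eq_integral) auto
    then show "ennreal ((\<integral>x. k x \<partial>M) + C) = (\<integral>\<^sup>+x. ennreal (k x + C) \<partial>M)"
      using i by (simp add: prob_space)
    have "0 \<le> (\<integral>x. k x + C \<partial>M)" using nn by (intro integral_nonneg_AE) auto
    then show "0 \<le> (\<integral>x. k x \<partial>M) + C" using i by (simp add: prob_space)
  qed
  have "ennreal ((\<integral>x. f x \<partial>M) + C) = ennreal ((\<integral>x. g x \<partial>M) + C)"
    by (rule trans[OF *(1)[OF f] trans[OF eq *(1)[OF g, symmetric]]])
  then show ?thesis using *(2)[OF f] *(2)[OF g] by (simp add: ennreal_inj)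
qed

section \<open>The filter as a function of the information\<close>

context pomdp_density
begin

abbreviation Info :: "nat \<Rightarrow> ((nat \<Rightarrow> 'y) \<times> (nat \<Rightarrow> 'u)) measure" where
  "Info t \<equiv> PiM {..t} (\<lambda>_. Y) \<Otimes>\<^sub>M PiM {..<t} (\<lambda>_. borel)"

text \<open>The belief given the information, when \<open>k\<close> is the posterior kernel of the
  initial distribution. No policy enters, so a policy can be defined through it.\<close>

primrec filter_path :: "('y \<Rightarrow> 'x measure) \<Rightarrow> nat \<Rightarrow> (nat \<Rightarrow> 'y) \<times> (nat \<Rightarrow> 'u) \<Rightarrow> 'x measure" where
  "filter_path k 0 I = k (fst I 0)"
| "filter_path k (Suc t) I = F (filter_path k t I) (snd I t) (fst I (Suc t))"

lemma filter_path_cong: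
  "(\<And>i. i \<le> t \<Longrightarrow> fst I i = fst I' i) \<Longrightarrow> (\<And>i. i < t \<Longrightarrow> snd I i = snd I' i) \<Longrightarrow>
    filter_path k t I = filter_path k t I'"
  by (induction t) auto

lemma filter_path_measurable:
  assumes k: "k \<in> Y \<rightarrow>\<^sub>M prob_algebra borel"
  shows "filter_path k t \<in> Info t \<rightarrow>\<^sub>M prob_algebra borel"
proof (induction t)
  case 0
  have "(\<lambda>I. fst I 0) \<in> Info 0 \<rightarrow>\<^sub>M Y"
    by (rule measurable_compose[OF measurable_fst measurable_component_singleton]) auto
  from measurable_compose[OF this k] show ?case by simp
next
  case (Suc t)
  \<comment> \<open>\<open>Info t\<close> and \<open>Info (Suc t)\<close> are different product
    spaces, so the induction hypothesis is applied after cutting the information back to time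
    t.\<close>
  let ?r = "\<lambda>I. (\<lambda>i\<in>{..t}. fst I i, \<lambda>i\<in>{..<t}. snd I i)"
  have "?r \<in> Info (Suc t) \<rightarrow>\<^sub>M Info t"
    by (intro measurable_Pair measurable_restrict
        measurable_compose[OF measurable_fst measurable_component_singleton]
        measurable_compose[OF measurable_snd measurable_component_singleton]) auto
  moreover have "filter_path k t (?r I) = filter_path k t I" for I by (rule filter_path_cong) auto
  ultimately have b: "filter_path k t \<in> Info (Suc t) \<rightarrow>\<^sub>M prob_algebra borel"
    using measurable_compose[OF _ Suc, of ?r "Info (Suc t)"] by simp
  have "(\<lambda>I. (filter_path k t I, snd I t, fst I (Suc t))) \<in> Info (Suc t) \<rightarrow>\<^sub>M prob_algebra borel \<Otimes>\<^sub>M borel \<Otimes>\<^sub>M Y"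
    by (intro measurable_Pair b measurable_compose[OF measurable_fst measurable_component_singleton]
        measurable_compose[OF measurable_snd measurable_component_singleton]) auto
  from measurable_compose[OF this F_measurable] show ?case by simp
qed

end

section \<open>The path measure under an admissible policy\<close>

locale controlled = pomdp_density Y T Q c \<alpha> K\<^sub>1 lam \<kappa> p
  for Y :: "'y measure" and T :: "'x::polish_space \<times> 'u::polish_space \<Rightarrow> 'x measure"
    and Q :: "'x \<Rightarrow> 'y measure" and c :: "'x \<Rightarrow> 'u \<Rightarrow> real" and \<alpha> K\<^sub>1 :: real
    and lam :: "'x measure" and \<kappa> :: "'y \<Rightarrow> 'x measure" and p +
  fixes \<mu> :: "'x measure" and \<kappa>\<^sub>0 :: "'y \<Rightarrow> 'x measure" and \<gamma> :: "('y, 'u) policy"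
  assumes initial: "bayes_kernel \<mu> Q Y \<kappa>\<^sub>0" and admissible: "\<gamma> \<in> admissible Y"
begin

sublocale init: bayes_kernel \<mu> Q Y \<kappa>\<^sub>0 by (rule initial)

abbreviation "St \<equiv> (stage_algebra Y :: ('x \<times> 'y \<times> 'u) measure)"

abbreviation "Hist t \<equiv> PiM {0..<t} (\<lambda>_::nat. St)"

lemma \<gamma>_measurable[measurable]: "\<gamma> t \<in> Info t \<rightarrow>\<^sub>M borel"
  using admissible by (simp add: admissible_def)

lemma St_fst[measurable]: "fst \<in> St \<rightarrow>\<^sub>M borel"
  and St_fst_snd: "(\<lambda>s. fst (snd s)) \<in> St \<rightarrow>\<^sub>M Y"
  and St_snd_snd: "(\<lambda>s. snd (snd s)) \<in> St \<rightarrow>\<^sub>M borel"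
  unfolding stage_algebra_def by measurable

lemma St_triple:
  assumes [measurable]: "a \<in> N \<rightarrow>\<^sub>M borel" "b \<in> N \<rightarrow>\<^sub>M Y" "d \<in> N \<rightarrow>\<^sub>M borel"
  shows "(\<lambda>w. (a w, b w, d w)) \<in> N \<rightarrow>\<^sub>M St"
  unfolding stage_algebra_def by measurable

lemma coord_measurable:
  assumes "i < t"
  shows "state_at i \<in> Hist t \<rightarrow>\<^sub>M borel" "obs_at i \<in> Hist t \<rightarrow>\<^sub>M Y" "action_at i \<in> Hist t \<rightarrow>\<^sub>M borel"
proof -
  have i: "(\<lambda>\<omega>. \<omega> i) \<in> Hist t \<rightarrow>\<^sub>M St" using assms by (intro measurable_component_singleton) auto
  show "state_at i \<in> Hist t \<rightarrow>\<^sub>M borel" "obs_at i \<in> Hist t \<rightarrow>\<^sub>M Y" "action_at i \<in> Hist t \<rightarrow>\<^sub>M borel"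
    unfolding state_at_def[abs_def] obs_at_def[abs_def] action_at_def[abs_def]
    by (rule measurable_compose[OF i St_fst] measurable_compose[OF i St_fst_snd] measurable_compose[OF i St_snd_snd])+
qed

lemma information_measurable[measurable]:
  "(\<lambda>w. information t (fst w) (snd w)) \<in> Hist t \<Otimes>\<^sub>M Y \<rightarrow>\<^sub>M Info t"
  unfolding information_def
proof (intro measurable_Pair measurable_restrict)
  fix i assume "i \<in> {..t}"
  show "(\<lambda>w. if i < t then obs_at i (fst w) else snd w) \<in> Hist t \<Otimes>\<^sub>M Y \<rightarrow>\<^sub>M Y"
    by (cases "i < t") (auto intro: measurable_compose[OF measurable_fst coord_measurable(2)])
next
  fix i assume "i \<in> {..<t}"
  then show "(\<lambda>w. action_at i (fst w)) \<in> Hist t \<Otimes>\<^sub>M Y \<rightarrow>\<^sub>M borel"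
    by (auto intro: measurable_compose[OF measurable_fst coord_measurable(3)])
qed

text \<open>The law of the state at time t given the past path, before the observation at time t.
  Unlike the filter it uses the unobserved previous state.\<close>

definition prior :: "nat \<Rightarrow> ('x, 'y, 'u) path \<Rightarrow> 'x measure" where
  "prior t \<omega> = (if t = 0 then \<mu> else T (state_at (t - 1) \<omega>, action_at (t - 1) \<omega>))"

lemma prior_measurable[measurable]: "prior t \<in> Hist t \<rightarrow>\<^sub>M prob_algebra borel"
proof (cases t)
  case 0
  then show ?thesis using init.lam by (simp add: prior_def[abs_def])
next
  case (Suc n)
  have [measurable]: "state_at n \<in> Hist t \<rightarrow>\<^sub>M borel" "action_at n \<in> Hist t \<rightarrow>\<^sub>M borel"
    using coord_measurable[of n t] Suc by auto
  have "(\<lambda>\<omega>. T (state_at n \<omega>, action_at n \<omega>)) \<in> Hist t \<rightarrow>\<^sub>M prob_algebra borel" by measurable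
  then show ?thesis using Suc by (simp add: prior_def[abs_def])
qed

lemma prior_space: "\<omega> \<in> space (Hist t) \<Longrightarrow> prior t \<omega> \<in> space (prob_algebra borel)"
  by (rule measurable_space[OF prior_measurable])

lemma stage_law_eq:
  "stage_law Y T Q \<mu> \<gamma> t \<omega> = prior t \<omega> \<bind> (\<lambda>x. Q x \<bind> (\<lambda>y. return St (x, y, \<gamma> t (information t \<omega> y))))"
  by (simp add: stage_law_def prior_def)

lemma stage_law_measurable: "stage_law Y T Q \<mu> \<gamma> t \<in> Hist t \<rightarrow>\<^sub>M prob_algebra St"
proof -
  have triple: "(\<lambda>w. (snd (fst w), snd w, \<gamma> t (information t (fst (fst w)) (snd w)))) \<in>
      (Hist t \<Otimes>\<^sub>M borel) \<Otimes>\<^sub>M Y \<rightarrow>\<^sub>M St"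
  proof -
    have "(\<lambda>w. (fst (fst w), snd w)) \<in> (Hist t \<Otimes>\<^sub>M (borel :: 'x measure)) \<Otimes>\<^sub>M Y \<rightarrow>\<^sub>M Hist t \<Otimes>\<^sub>M Y" by measurable
    from measurable_compose[OF measurable_compose[OF this information_measurable] \<gamma>_measurable]
    have [measurable]: "(\<lambda>w. \<gamma> t (information t (fst (fst w)) (snd w))) \<in> (Hist t \<Otimes>\<^sub>M (borel :: 'x measure)) \<Otimes>\<^sub>M Y \<rightarrow>\<^sub>M borel"
      by simp
    show ?thesis by (rule St_triple) measurable
  qed
  have "(\<lambda>\<omega>. prior t \<omega> \<bind> (\<lambda>x. Q x \<bind> (\<lambda>y. return St (x, y, \<gamma> t (information t \<omega> y))))) \<in> Hist t \<rightarrow>\<^sub>M prob_algebra St"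
  proof (rule measurable_bind_prob_space2[OF prior_measurable], unfold split_beta',
      rule measurable_bind_prob_space2[where N=Y])
    show "(\<lambda>w. Q (snd w)) \<in> Hist t \<Otimes>\<^sub>M borel \<rightarrow>\<^sub>M prob_algebra Y" by measurable
    show "(\<lambda>(w, y). return St (snd w, y, \<gamma> t (information t (fst w) y))) \<in> (Hist t \<Otimes>\<^sub>M borel) \<Otimes>\<^sub>M Y \<rightarrow>\<^sub>M prob_algebra St"
      using measurable_compose[OF triple measurable_return_prob_space] by (simp add: split_beta')
  qed
  then show ?thesis by (simp add: stage_law_eq[abs_def])
qed

sublocale IT: Ionescu_Tulcea "stage_law Y T Q \<mu> \<gamma>" "\<lambda>_. St"
proof (rule Ionescu_Tulcea.intro)
  show "stage_law Y T Q \<mu> \<gamma> i \<in> Hist i \<rightarrow>\<^sub>M subprob_algebra St" for i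
    by (rule measurable_prob_algebraD[OF stage_law_measurable])
  fix i and x :: "('x, 'y, 'u) path" assume "x \<in> space (Hist i)"
  from measurable_space[OF stage_law_measurable this]
  show "prob_space (stage_law Y T Q \<mu> \<gamma> i x)" by (simp add: space_prob_algebra)
qed

abbreviation "pathM \<equiv> path_measure Y T Q \<mu> \<gamma>"

lemma path_eq: "pathM = IT.PF.lim"
  by (simp add: path_measure_def)

text \<open>The law of the first t stages; the constant function \<open>undefined\<close> is the
  empty history.\<close>

abbreviation "hist t \<equiv> IT.C 0 t (\<lambda>_. undefined)"

lemma hist_space: "(\<lambda>_. undefined) \<in> space (Hist 0)" by (simp add: space_PiM)

lemma sets_hist[measurable_cong, simp]: "sets (hist t) = sets (Hist t)"
  using IT.sets_C[OF hist_space, of t] by simp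

lemma space_hist[simp]: "space (hist t) = space (Hist t)"
  by (rule sets_eq_imp_space_eq[OF sets_hist])

lemma sets_path[measurable_cong]: "sets pathM = sets (PiM UNIV (\<lambda>_. St))"
  by (simp add: path_eq)

text \<open>The total mass is read off the marginal on the empty set of stages.\<close>

lemma prob_path: "prob_space pathM"
proof -
  have "prob_space (distr pathM (Hist 0) (\<lambda>x. restrict x {0..<0}))"
    using IT.distr_lim[of "{0..<0}"] IT.PF.prob_space_P[of "{0..<0}"] by (simp add: path_eq)
  then show ?thesis
    by (rule prob_space_distrD[rotated]) (simp add: path_eq measurable_cong_sets[OF IT.PF.sets_lim refl] measurable_restrict_subset)
qed

lemma nn_integral_path:
  assumes f: "f \<in> borel_measurable (Hist t)"
  shows "(\<integral>\<^sup>+\<omega>. f (restrict \<omega> {0..<t}) \<partial>pathM) = (\<integral>\<^sup>+\<omega>. f \<omega> \<partial>hist t)"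
proof -
  have r: "(\<lambda>\<omega>. restrict \<omega> {0..<t}) \<in> pathM \<rightarrow>\<^sub>M Hist t"
    by (simp add: measurable_cong_sets[OF sets_path refl] measurable_restrict_subset)
  have "distr pathM (Hist t) (\<lambda>\<omega>. restrict \<omega> {0..<t}) = hist t"
    unfolding path_eq
  proof (subst IT.distr_lim)
    show "IT.CI {0..<t} = hist t"
    proof (rule measure_eqI)
      show "sets (IT.CI {0..<t}) = sets (hist t)" using IT.PF.sets_P[of "{0..<t}"] by simp
      fix X assume "X \<in> sets (IT.CI {0..<t})"
      then have "X \<in> sets (Hist t)" using IT.PF.sets_P[of "{0..<t}"] by simp
      moreover from this have "IT.PF.emb {0..<t} {0..<t} X = X"
        using sets.sets_into_space[of X "Hist t"] by (intro prod_emb_id) (simp add: space_PiM)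
      ultimately show "emeasure (IT.CI {0..<t}) X = emeasure (hist t) X"
        by (subst IT.emeasure_CI[of _ t]) auto
    qed
  qed simp
  then have "(\<integral>\<^sup>+\<omega>. f \<omega> \<partial>hist t) = (\<integral>\<^sup>+\<omega>. f \<omega> \<partial>distr pathM (Hist t) (\<lambda>\<omega>. restrict \<omega> {0..<t}))" by simp
  also have "\<dots> = (\<integral>\<^sup>+\<omega>. f (restrict \<omega> {0..<t}) \<partial>pathM)" by (rule nn_integral_distr[OF r]) (simp add: f)
  finally show ?thesis by simp
qed

lemma nn_integral_stage_law:
  assumes \<omega>: "\<omega> \<in> space (Hist t)" and f: "f \<in> borel_measurable St"
  shows "(\<integral>\<^sup>+s. f s \<partial>stage_law Y T Q \<mu> \<gamma> t \<omega>) = (\<integral>\<^sup>+x. \<integral>\<^sup>+y. f (x, y, \<gamma> t (information t \<omega> y)) \<partial>Q x \<partial>prior t \<omega>)"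
  unfolding stage_law_eq
proof (rule nn_integral_bind_return[OF prior_space[OF \<omega>] Q _ f])
  have "(\<lambda>y. (\<omega>, y)) \<in> Y \<rightarrow>\<^sub>M Hist t \<Otimes>\<^sub>M Y" using \<omega> by measurable
  from measurable_compose[OF measurable_compose[OF this information_measurable] \<gamma>_measurable]
  have [measurable]: "(\<lambda>y. \<gamma> t (information t \<omega> y)) \<in> Y \<rightarrow>\<^sub>M borel" by simp
  show "(\<lambda>(x, y). (x, y, \<gamma> t (information t \<omega> y))) \<in> borel \<Otimes>\<^sub>M Y \<rightarrow>\<^sub>M St"
    unfolding stage_algebra_def by measurable
qed

lemma nn_integral_hist_Suc:
  assumes f: "f \<in> borel_measurable (Hist (Suc t))"
  shows "(\<integral>\<^sup>+\<omega>. f \<omega> \<partial>hist (Suc t)) =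
    (\<integral>\<^sup>+\<omega>. \<integral>\<^sup>+x. \<integral>\<^sup>+y. f (fun_upd \<omega> t (x, y, \<gamma> t (information t \<omega> y))) \<partial>Q x \<partial>prior t \<omega> \<partial>hist t)"
proof -
  have "(\<integral>\<^sup>+\<omega>. f \<omega> \<partial>hist (Suc t)) = (\<integral>\<^sup>+\<omega>. \<integral>\<^sup>+\<omega>'. f \<omega>' \<partial>IT.eP t \<omega> \<partial>hist t)"
    using nn_integral_bind[OF f, of "IT.eP t" "hist t"] IT.measurable_eP[of t]
    by (simp add: measurable_cong_sets[OF sets_hist refl])
  also have "\<dots> = (\<integral>\<^sup>+\<omega>. \<integral>\<^sup>+x. \<integral>\<^sup>+y. f (fun_upd \<omega> t (x, y, \<gamma> t (information t \<omega> y))) \<partial>Q x \<partial>prior t \<omega> \<partial>hist t)"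
  proof (rule nn_integral_cong)
    fix \<omega> assume "\<omega> \<in> space (hist t)"
    then have \<omega>: "\<omega> \<in> space (Hist t)" by simp
    have upd: "fun_upd \<omega> t \<in> St \<rightarrow>\<^sub>M Hist (Suc t)"
      by (rule measurable_fun_upd[where J="{0..<t}"]) (use \<omega> in auto)
    show "(\<integral>\<^sup>+\<omega>'. f \<omega>' \<partial>IT.eP t \<omega>) = (\<integral>\<^sup>+x. \<integral>\<^sup>+y. f (fun_upd \<omega> t (x, y, \<gamma> t (information t \<omega> y))) \<partial>Q x \<partial>prior t \<omega>)"
      unfolding IT.nn_integral_eP[OF \<omega> f] by (rule nn_integral_stage_law[OF \<omega> measurable_compose[OF upd f]])
  qed
  finally show ?thesis .
qed

text \<open>The expectation of \<open>\<phi>(I\<^sub>t, X\<^sub>t)\<close>.\<close>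

definition E :: "nat \<Rightarrow> ((nat \<Rightarrow> 'y) \<times> (nat \<Rightarrow> 'u) \<Rightarrow> 'x \<Rightarrow> ennreal) \<Rightarrow> ennreal" where
  "E t \<phi> = (\<integral>\<^sup>+\<omega>. \<integral>\<^sup>+x. \<integral>\<^sup>+y. \<phi> (information t \<omega> y) x \<partial>Q x \<partial>prior t \<omega> \<partial>hist t)"

section \<open>Expectations of the information and the current state\<close>

definition extend_info :: "nat \<Rightarrow> (nat \<Rightarrow> 'y) \<times> (nat \<Rightarrow> 'u) \<Rightarrow> 'u \<Rightarrow> 'y \<Rightarrow> (nat \<Rightarrow> 'y) \<times> (nat \<Rightarrow> 'u)" where
  "extend_info t I u y =
    (\<lambda>i\<in>{..Suc t}. if i \<le> t then fst I i else y, \<lambda>i\<in>{..<Suc t}. if i < t then snd I i else u)"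

lemma extend_info_measurable:
  "(\<lambda>w. extend_info t (fst w) (fst (snd w)) (snd (snd w))) \<in> Info t \<Otimes>\<^sub>M borel \<Otimes>\<^sub>M Y \<rightarrow>\<^sub>M Info (Suc t)"
  unfolding extend_info_def
proof (intro measurable_Pair measurable_restrict)
  fix i assume "i \<in> {..Suc t}"
  show "(\<lambda>w. if i \<le> t then fst (fst w) i else snd (snd w)) \<in> Info t \<Otimes>\<^sub>M (borel :: 'u measure) \<Otimes>\<^sub>M Y \<rightarrow>\<^sub>M Y"
  proof (cases "i \<le> t")
    case True
    then have "(\<lambda>w. fst w i) \<in> Info t \<rightarrow>\<^sub>M Y"
      by (intro measurable_compose[OF measurable_fst measurable_component_singleton]) auto
    from measurable_compose[OF measurable_fst this] True show ?thesis by simp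
  qed simp
next
  fix i assume "i \<in> {..<Suc t}"
  show "(\<lambda>w. if i < t then snd (fst w) i else fst (snd w)) \<in> Info t \<Otimes>\<^sub>M (borel :: 'u measure) \<Otimes>\<^sub>M Y \<rightarrow>\<^sub>M borel"
  proof (cases "i < t")
    case True
    then have "(\<lambda>w. snd w i) \<in> Info t \<rightarrow>\<^sub>M (borel :: 'u measure)"
      by (intro measurable_compose[OF measurable_snd measurable_component_singleton]) auto
    from measurable_compose[OF measurable_fst this] True show ?thesis by simp
  qed simp
qed

lemma information_Suc:
  "information (Suc t) (fun_upd \<omega> t (x, y, u)) y' = extend_info t (information t \<omega> y) u y'"
  by (auto simp: information_def extend_info_def obs_at_def action_at_def fun_eq_iff)

lemma information_upd: "information t (fun_upd \<omega> t s) y = information t \<omega> y"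
  by (auto simp: information_def obs_at_def action_at_def fun_eq_iff)

lemma E_cong:
  assumes "\<And>I x. I \<in> space (Info t) \<Longrightarrow> \<phi> I x = \<psi> I x"
  shows "E t \<phi> = E t \<psi>"
  unfolding E_def
proof (intro nn_integral_cong)
  fix \<omega> x y assume "\<omega> \<in> space (hist t)" "x \<in> space (prior t \<omega>)" "y \<in> space (Q x)"
  then have "(\<omega>, y) \<in> space (Hist t \<Otimes>\<^sub>M Y)"
    using sets_eq_imp_space_eq[OF QD(2)] by (auto simp: space_pair_measure)
  from measurable_space[OF information_measurable this]
  show "\<phi> (information t \<omega> y) x = \<psi> (information t \<omega> y) x" by (intro assms) simp
qed

text \<open>Given the information the action is determined by the policy, so an expectation that
  involves the action reduces to \<open>E\<close>.\<close>

lemma E_path: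
  assumes \<phi>: "(\<lambda>(I, x, u). \<phi> I x u) \<in> borel_measurable (Info t \<Otimes>\<^sub>M borel \<Otimes>\<^sub>M borel)"
  shows "(\<integral>\<^sup>+\<omega>. \<phi> (information t \<omega> (obs_at t \<omega>)) (state_at t \<omega>) (action_at t \<omega>) \<partial>pathM) = E t (\<lambda>I x. \<phi> I x (\<gamma> t I))"
proof -
  let ?f = "\<lambda>\<omega>. \<phi> (information t \<omega> (obs_at t \<omega>)) (state_at t \<omega>) (action_at t \<omega>)"
  have f: "?f \<in> borel_measurable (Hist (Suc t))"
  proof -
    have [measurable]: "obs_at t \<in> Hist (Suc t) \<rightarrow>\<^sub>M Y" "state_at t \<in> Hist (Suc t) \<rightarrow>\<^sub>M borel" "action_at t \<in> Hist (Suc t) \<rightarrow>\<^sub>M borel"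
      by (rule coord_measurable; simp)+
    have r[measurable]: "(\<lambda>\<omega>. restrict \<omega> {0..<t}) \<in> Hist (Suc t) \<rightarrow>\<^sub>M Hist t"
      by (rule measurable_restrict_subset) auto
    have "(\<lambda>\<omega>. (restrict \<omega> {0..<t}, obs_at t \<omega>)) \<in> Hist (Suc t) \<rightarrow>\<^sub>M Hist t \<Otimes>\<^sub>M Y" by measurable
    from measurable_compose[OF this information_measurable]
    have "(\<lambda>\<omega>. information t (restrict \<omega> {0..<t}) (obs_at t \<omega>)) \<in> Hist (Suc t) \<rightarrow>\<^sub>M Info t" by simp
    moreover have "information t (restrict \<omega> {0..<t}) y = information t \<omega> y" for \<omega> :: "('x, 'y, 'u) path" and y
      by (auto simp: information_def obs_at_def action_at_def fun_eq_iff)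
    ultimately have [measurable]: "(\<lambda>\<omega>. information t \<omega> (obs_at t \<omega>)) \<in> Hist (Suc t) \<rightarrow>\<^sub>M Info t" by simp
    have "(\<lambda>\<omega>. (information t \<omega> (obs_at t \<omega>), state_at t \<omega>, action_at t \<omega>)) \<in> Hist (Suc t) \<rightarrow>\<^sub>M Info t \<Otimes>\<^sub>M borel \<Otimes>\<^sub>M borel"
      by measurable
    from measurable_compose[OF this \<phi>] show ?thesis by simp
  qed
  have "?f (restrict \<omega> {0..<Suc t}) = ?f \<omega>" for \<omega> :: "('x, 'y, 'u) path"
  proof -
    have "information t (restrict \<omega> {0..<Suc t}) y = information t \<omega> y" for y
      by (auto simp: information_def obs_at_def action_at_def fun_eq_iff)
    then show ?thesis by (simp add: obs_at_def action_at_def state_at_def)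
  qed
  then have "(\<integral>\<^sup>+\<omega>. ?f \<omega> \<partial>pathM) = (\<integral>\<^sup>+\<omega>. ?f \<omega> \<partial>hist (Suc t))"
    using nn_integral_path[OF f] by simp
  also have "\<dots> = E t (\<lambda>I x. \<phi> I x (\<gamma> t I))"
    unfolding nn_integral_hist_Suc[OF f] E_def information_upd by (simp add: obs_at_def state_at_def action_at_def)
  finally show ?thesis .
qed

lemma E_Suc:
  assumes \<phi>: "(\<lambda>(I, x). \<phi> I x) \<in> borel_measurable (Info (Suc t) \<Otimes>\<^sub>M borel)"
  shows "E (Suc t) \<phi> = E t (\<lambda>I x. \<integral>\<^sup>+x'. \<integral>\<^sup>+y'. \<phi> (extend_info t I (\<gamma> t I) y') x' \<partial>Q x' \<partial>T (x, \<gamma> t I))"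
proof -
  let ?f = "\<lambda>\<omega>. \<integral>\<^sup>+x'. \<integral>\<^sup>+y'. \<phi> (information (Suc t) \<omega> y') x' \<partial>Q x' \<partial>prior (Suc t) \<omega>"
  have f: "?f \<in> borel_measurable (Hist (Suc t))"
  proof (rule measurable_nn_integral_kernel[OF _ prior_measurable])
    have "(\<lambda>w. \<integral>\<^sup>+y'. \<phi> (information (Suc t) (fst w) y') (snd w) \<partial>Q (snd w)) \<in> borel_measurable (Hist (Suc t) \<Otimes>\<^sub>M borel)"
    proof (rule measurable_nn_integral_kernel[where M=Y])
      have "(\<lambda>w. (fst (fst w), snd w)) \<in> (Hist (Suc t) \<Otimes>\<^sub>M (borel :: 'x measure)) \<Otimes>\<^sub>M Y \<rightarrow>\<^sub>M Hist (Suc t) \<Otimes>\<^sub>M Y" by measurable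
      from measurable_compose[OF this information_measurable]
      have "(\<lambda>w. (information (Suc t) (fst (fst w)) (snd w), snd (fst w))) \<in> (Hist (Suc t) \<Otimes>\<^sub>M (borel :: 'x measure)) \<Otimes>\<^sub>M Y \<rightarrow>\<^sub>M Info (Suc t) \<Otimes>\<^sub>M borel"
        by (intro measurable_Pair) (auto intro: measurable_compose[OF measurable_fst measurable_snd])
      from measurable_compose[OF this \<phi>]
      show "(\<lambda>(w, y'). \<phi> (information (Suc t) (fst w) y') (snd w)) \<in> borel_measurable ((Hist (Suc t) \<Otimes>\<^sub>M borel) \<Otimes>\<^sub>M Y)"
        by (simp add: split_beta')
    qed measurable
    then show "(\<lambda>(\<omega>, x'). \<integral>\<^sup>+y'. \<phi> (information (Suc t) \<omega> y') x' \<partial>Q x') \<in> borel_measurable (Hist (Suc t) \<Otimes>\<^sub>M borel)"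
      by (simp add: split_beta')
  qed
  have "E (Suc t) \<phi> = (\<integral>\<^sup>+\<omega>. ?f \<omega> \<partial>hist (Suc t))" by (simp only: E_def)
  also have "\<dots> = E t (\<lambda>I x. \<integral>\<^sup>+x'. \<integral>\<^sup>+y'. \<phi> (extend_info t I (\<gamma> t I) y') x' \<partial>Q x' \<partial>T (x, \<gamma> t I))"
    unfolding nn_integral_hist_Suc[OF f] E_def information_Suc
    by (simp add: prior_def state_at_def action_at_def)
  finally show ?thesis .
qed

text \<open>The defining property of a filter version, extended from rectangles: drawing the next
  state and then its observation amounts to drawing the observation and then the state from the
  updated belief.\<close>

lemma filter_swap:
  assumes z: "z \<in> beliefs" and g: "(\<lambda>(x, y). g x y) \<in> borel_measurable (borel \<Otimes>\<^sub>M Y)"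
  shows "(\<integral>\<^sup>+x. \<integral>\<^sup>+x'. \<integral>\<^sup>+y. g x' y \<partial>Q x' \<partial>T (x, u) \<partial>z) = (\<integral>\<^sup>+y. \<integral>\<^sup>+x. g x y \<partial>F z u y \<partial>next_obs_law T Q z u)"
proof -
  have "(\<integral>\<^sup>+x. \<integral>\<^sup>+x'. \<integral>\<^sup>+y. g x' y \<partial>Q x' \<partial>T (x, u) \<partial>z) = (\<integral>\<^sup>+x'. \<integral>\<^sup>+y. g x' y \<partial>Q x' \<partial>next_state_law T z u)"
    unfolding next_state_law_def
    by (rule nn_integral_bind[symmetric, OF measurable_nn_integral_kernel[OF g Q]])
       (rule measurable_belief[OF z measurable_prob_algebraD[OF T_meas_u]])
  also have "\<dots> = (\<integral>\<^sup>+y. \<integral>\<^sup>+x. g x y \<partial>F z u y \<partial>next_obs_law T Q z u)"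
  proof (rule nn_integral_swap_kernels[OF _ Q _ F_measurable_y[OF z] _ g])
    show "next_state_law T z u \<in> space (prob_algebra borel)"
      using next_state_belief[OF z] by (simp add: beliefs_eq)
    show "next_obs_law T Q z u \<in> space (prob_algebra Y)"
      using next_obs_prob[OF z] sets_next_obs[OF z] by (simp add: space_prob_algebra)
    fix a :: "'x set" and b assume ab: "a \<in> sets borel" "b \<in> sets Y"
    then show "(\<integral>\<^sup>+x. emeasure (Q x) b * indicator a x \<partial>next_state_law T z u) =
        (\<integral>\<^sup>+y. emeasure (F z u y) a * indicator b y \<partial>next_obs_law T Q z u)"
      using filter_version_F z unfolding filter_version_def next_joint_law_rectangle[OF z ab, symmetric] by blast
  qed
  finally show ?thesis .
qed

abbreviation "bel \<equiv> filter_path \<kappa>\<^sub>0"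

lemma bel_extend: "bel (Suc t) (extend_info t I u y) = F (bel t I) u y"
proof -
  have "bel t (extend_info t I u y) = bel t I" by (rule filter_path_cong) (auto simp: extend_info_def)
  then show ?thesis by (simp add: extend_info_def)
qed

lemma bel_measurable: "bel t \<in> Info t \<rightarrow>\<^sub>M prob_algebra borel"
  by (rule filter_path_measurable[OF init.\<kappa>])

lemma bel_belief: "I \<in> space (Info t) \<Longrightarrow> bel t I \<in> beliefs"
  using measurable_space[OF bel_measurable] by (simp add: beliefs_eq)

lemma extend_info_u:
  assumes "I \<in> space (Info t)"
  shows "(\<lambda>y. extend_info t I u y) \<in> Y \<rightarrow>\<^sub>M Info (Suc t)"
proof -
  have "(\<lambda>y. (I, u, y)) \<in> Y \<rightarrow>\<^sub>M Info t \<Otimes>\<^sub>M borel \<Otimes>\<^sub>M Y" using assms by measurable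
  from measurable_compose[OF this extend_info_measurable] show ?thesis by simp
qed

text \<open>The identity for time t replaces the state by a draw from the belief, and
  \<open>filter_swap\<close> does the same for the next state. That identity is a premise because
  the step serves in the induction for \<open>E_filter\<close> and, together with
  \<open>E_filter\<close> itself, in \<open>stage_value_Suc\<close>.\<close>

lemma E_Suc_filter:
  assumes \<psi>: "(\<lambda>(I, x). \<psi> I x) \<in> borel_measurable (Info (Suc t) \<Otimes>\<^sub>M borel)"
    and IH: "\<And>\<phi>. (\<lambda>(I, x). \<phi> I x) \<in> borel_measurable (Info t \<Otimes>\<^sub>M borel) \<Longrightarrow>
      E t \<phi> = E t (\<lambda>I _. \<integral>\<^sup>+x'. \<phi> I x' \<partial>bel t I)"
  shows "E (Suc t) \<psi> = E t (\<lambda>I _. \<integral>\<^sup>+y'. \<integral>\<^sup>+x'. \<psi> (extend_info t I (\<gamma> t I) y') x' \<partial>F (bel t I) (\<gamma> t I) y' \<partial>next_obs_law T Q (bel t I) (\<gamma> t I))"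
proof -
  let ?\<psi>' = "\<lambda>I x. \<integral>\<^sup>+x'. \<integral>\<^sup>+y'. \<psi> (extend_info t I (\<gamma> t I) y') x' \<partial>Q x' \<partial>T (x, \<gamma> t I)"
  have "(\<lambda>(I, x). ?\<psi>' I x) \<in> borel_measurable (Info t \<Otimes>\<^sub>M borel)"
    unfolding split_beta'
  proof (rule measurable_nn_integral_kernel[where M=borel])
    have \<gamma>1[measurable]: "(\<lambda>w. \<gamma> t (fst w)) \<in> Info t \<Otimes>\<^sub>M (borel :: 'x measure) \<rightarrow>\<^sub>M borel"
      by (rule measurable_compose[OF measurable_fst \<gamma>_measurable])
    show "(\<lambda>w. T (snd w, \<gamma> t (fst w))) \<in> Info t \<Otimes>\<^sub>M borel \<rightarrow>\<^sub>M prob_algebra borel"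
      by (rule measurable_compose[OF _ T_meas]) measurable
    have "(\<lambda>w. \<integral>\<^sup>+y'. \<psi> (extend_info t (fst (fst w)) (\<gamma> t (fst (fst w))) y') (snd w) \<partial>Q (snd w))
        \<in> borel_measurable ((Info t \<Otimes>\<^sub>M (borel :: 'x measure)) \<Otimes>\<^sub>M (borel :: 'x measure))"
    proof (rule measurable_nn_integral_kernel[where M=Y])
      let ?N = "((Info t \<Otimes>\<^sub>M (borel :: 'x measure)) \<Otimes>\<^sub>M (borel :: 'x measure)) \<Otimes>\<^sub>M Y"
      have a: "(\<lambda>v. fst (fst (fst v))) \<in> ?N \<rightarrow>\<^sub>M Info t" by measurable
      have "(\<lambda>v. (fst (fst (fst v)), \<gamma> t (fst (fst (fst v))), snd v)) \<in> ?N \<rightarrow>\<^sub>M Info t \<Otimes>\<^sub>M borel \<Otimes>\<^sub>M Y"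
        by (intro measurable_Pair a measurable_compose[OF a \<gamma>_measurable] measurable_snd)
      from measurable_compose[OF this extend_info_measurable]
      have "(\<lambda>v. (extend_info t (fst (fst (fst v))) (\<gamma> t (fst (fst (fst v)))) (snd v), snd (fst v))) \<in> ?N \<rightarrow>\<^sub>M Info (Suc t) \<Otimes>\<^sub>M borel"
        by (intro measurable_Pair) (auto intro: measurable_compose[OF measurable_fst measurable_snd])
      from measurable_compose[OF this \<psi>]
      show "(\<lambda>(w, y'). \<psi> (extend_info t (fst (fst w)) (\<gamma> t (fst (fst w))) y') (snd w)) \<in> borel_measurable ?N"
        by (simp add: split_beta')
    qed measurable
    then show "(\<lambda>(w, x'). \<integral>\<^sup>+y'. \<psi> (extend_info t (fst w) (\<gamma> t (fst w)) y') x' \<partial>Q x')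
        \<in> borel_measurable ((Info t \<Otimes>\<^sub>M (borel :: 'x measure)) \<Otimes>\<^sub>M (borel :: 'x measure))"
      by (simp add: split_beta')
  qed
  from IH[OF this] have "E (Suc t) \<psi> = E t (\<lambda>I _. \<integral>\<^sup>+x. ?\<psi>' I x \<partial>bel t I)" by (simp only: E_Suc[OF \<psi>])
  also have "\<dots> = E t (\<lambda>I _. \<integral>\<^sup>+y'. \<integral>\<^sup>+x'. \<psi> (extend_info t I (\<gamma> t I) y') x' \<partial>F (bel t I) (\<gamma> t I) y' \<partial>next_obs_law T Q (bel t I) (\<gamma> t I))"
  proof (rule E_cong, rule filter_swap[OF bel_belief])
    fix I assume I: "I \<in> space (Info t)"
    then show "I \<in> space (Info t)" .
    have "(\<lambda>w. (extend_info t I (\<gamma> t I) (snd w), fst w)) \<in> (borel :: 'x measure) \<Otimes>\<^sub>M Y \<rightarrow>\<^sub>M Info (Suc t) \<Otimes>\<^sub>M borel"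
      by (intro measurable_Pair measurable_compose[OF measurable_snd extend_info_u[OF I]] measurable_fst)
    from measurable_compose[OF this \<psi>]
    show "(\<lambda>(x', y'). \<psi> (extend_info t I (\<gamma> t I) y') x') \<in> borel_measurable (borel \<Otimes>\<^sub>M Y)" by (simp add: split_beta')
  qed
  finally show ?thesis .
qed

text \<open>The policy sees the past only through \<open>I\<^sub>t\<close>, so given \<open>I\<^sub>t\<close> the state is distributed
  according to the filter.\<close>

lemma E_filter:
  assumes "(\<lambda>(I, x). \<phi> I x) \<in> borel_measurable (Info t \<Otimes>\<^sub>M borel)"
  shows "E t \<phi> = E t (\<lambda>I _. \<integral>\<^sup>+x'. \<phi> I x' \<partial>bel t I)"
  using assms
proof (induction t arbitrary: \<phi>)
  case 0
  have swap: "E 0 \<psi> = (\<integral>\<^sup>+\<omega>. \<integral>\<^sup>+y. \<integral>\<^sup>+x. \<psi> (information 0 \<omega> y) x \<partial>\<kappa>\<^sub>0 y \<partial>(\<mu> \<bind> Q) \<partial>hist 0)"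
    if \<psi>: "(\<lambda>(I, x). \<psi> I x) \<in> borel_measurable (Info 0 \<Otimes>\<^sub>M borel)" for \<psi>
    unfolding E_def prior_def
  proof (rule nn_integral_cong, simp only: if_True refl, rule nn_integral_swap_kernels[OF init.lam Q _ init.\<kappa>])
    fix \<omega> assume "\<omega> \<in> space (hist 0)"
    then have \<omega>: "\<omega> \<in> space (Hist 0)" by simp
    show "\<mu> \<bind> Q \<in> space (prob_algebra Y)"
      using init.m.prob_space_axioms init.sets_m by (simp add: space_prob_algebra)
    show "(\<integral>\<^sup>+x. emeasure (Q x) b * indicator a x \<partial>\<mu>) = (\<integral>\<^sup>+y. emeasure (\<kappa>\<^sub>0 y) a * indicator b y \<partial>(\<mu> \<bind> Q))"
      if "a \<in> sets borel" "b \<in> sets Y" for a b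
      using init.disint[OF that] by (simp add: mult.commute)
    have "(\<lambda>w. (\<omega>, snd w)) \<in> (borel :: 'x measure) \<Otimes>\<^sub>M Y \<rightarrow>\<^sub>M Hist 0 \<Otimes>\<^sub>M Y" using \<omega> by measurable
    from measurable_compose[OF this information_measurable]
    have "(\<lambda>w. (information 0 \<omega> (snd w), fst w)) \<in> (borel :: 'x measure) \<Otimes>\<^sub>M Y \<rightarrow>\<^sub>M Info 0 \<Otimes>\<^sub>M borel"
      by (intro measurable_Pair) auto
    from measurable_compose[OF this \<psi>]
    show "(\<lambda>(x, y). \<psi> (information 0 \<omega> y) x) \<in> borel_measurable (borel \<Otimes>\<^sub>M Y)" by (simp add: split_beta')
  qed
  \<comment> \<open>\<open>swap\<close> is applied to the right-hand side as well. Its integrand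
    does not depend on the state, so the integral over the posterior only contributes the mass
    1.\<close>
  have m: "(\<lambda>(I, x). \<integral>\<^sup>+x'. \<phi> I x' \<partial>bel 0 I) \<in> borel_measurable (Info 0 \<Otimes>\<^sub>M (borel :: 'x measure))"
    using measurable_compose[OF measurable_fst measurable_nn_integral_kernel[OF 0 bel_measurable], of "borel :: 'x measure"]
    by (simp add: split_beta')
  show ?case unfolding swap[OF 0] swap[OF m]
  proof (rule nn_integral_cong, rule nn_integral_cong)
    fix \<omega> :: "('x, 'y, 'u) path" and y assume "y \<in> space (\<mu> \<bind> Q)"
    then have "prob_space (\<kappa>\<^sub>0 y)" using beliefsD(1)[OF init.\<kappa>D] by simp
    then show "(\<integral>\<^sup>+x. \<phi> (information 0 \<omega> y) x \<partial>\<kappa>\<^sub>0 y) = (\<integral>\<^sup>+x. \<integral>\<^sup>+x'. \<phi> (information 0 \<omega> y) x' \<partial>bel 0 (information 0 \<omega> y) \<partial>\<kappa>\<^sub>0 y)"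
      by (simp add: prob_space.emeasure_space_1 information_def)
  qed
next
  case (Suc t)
  have step: "E (Suc t) \<psi> = E t (\<lambda>I _. \<integral>\<^sup>+y'. \<integral>\<^sup>+x'. \<psi> (extend_info t I (\<gamma> t I) y') x' \<partial>F (bel t I) (\<gamma> t I) y' \<partial>next_obs_law T Q (bel t I) (\<gamma> t I))"
    if "(\<lambda>(I, x). \<psi> I x) \<in> borel_measurable (Info (Suc t) \<Otimes>\<^sub>M borel)" for \<psi>
    by (rule E_Suc_filter[OF that Suc.IH])
  have m: "(\<lambda>(I, x). \<integral>\<^sup>+x'. \<phi> I x' \<partial>bel (Suc t) I) \<in> borel_measurable (Info (Suc t) \<Otimes>\<^sub>M (borel :: 'x measure))"
    using measurable_compose[OF measurable_fst measurable_nn_integral_kernel[OF Suc.prems bel_measurable], of "borel :: 'x measure"]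
    by (simp add: split_beta')
  show ?case unfolding step[OF Suc.prems] step[OF m]
  proof (rule E_cong, rule nn_integral_cong)
    fix I y assume I: "I \<in> space (Info t)" and "y \<in> space (next_obs_law T Q (bel t I) (\<gamma> t I))"
    then have "y \<in> space Y" by (simp add: space_next_obs[OF bel_belief])
    then have "prob_space (F (bel t I) (\<gamma> t I) y)" by (rule beliefsD(1)[OF F_belief[OF bel_belief[OF I]]])
    then show "(\<integral>\<^sup>+x'. \<phi> (extend_info t I (\<gamma> t I) y) x' \<partial>F (bel t I) (\<gamma> t I) y) =
        (\<integral>\<^sup>+x'. \<integral>\<^sup>+x'. \<phi> (extend_info t I (\<gamma> t I) y) x' \<partial>bel (Suc t) (extend_info t I (\<gamma> t I) y) \<partial>F (bel t I) (\<gamma> t I) y)"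
      by (simp add: bel_extend prob_space.emeasure_space_1 del: filter_path.simps)
  qed
qed

end

section \<open>Verification of the optimality equation\<close>

context pomdp_density
begin

lemma lipschitz_h_bounded:
  assumes h: "lipschitz_h L h"
  obtains B where "\<And>z. z \<in> beliefs \<Longrightarrow> \<bar>h z\<bar> \<le> B"
proof -
  note z0 = return_in_beliefs[OF compactX, of undefined]
  have "\<bar>h z\<bar> \<le> \<bar>h (return borel undefined)\<bar> + L * diameter (UNIV :: 'x set)" if "z \<in> beliefs" for z
    using lipschitz_h_bound[OF h that z0] by linarith
  then show ?thesis using that by blast
qed

lemma nn_integral_cost:
  assumes C: "\<And>x u. \<bar>c x u\<bar> \<le> C" and z: "z \<in> beliefs"
  shows "(\<integral>\<^sup>+x. ennreal (c x u + C) \<partial>z) = ennreal (belief_cost c z u + C)"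
proof -
  interpret z: prob_space z by (rule beliefsD(1)[OF z])
  have nn: "0 \<le> c x u + C" for x using C[of x u] by linarith
  have "(\<integral>\<^sup>+x. ennreal (c x u + C) \<partial>z) = ennreal (\<integral>x. c x u + C \<partial>z)"
    using belief_cost_integrable[OF z] nn by (intro nn_integral_eq_integral) auto
  then show ?thesis using belief_cost_integrable[OF z] by (simp add: belief_cost_def z.prob_space)
qed

lemma eta_bound:
  assumes h: "lipschitz_h L h" and B: "\<And>z. z \<in> beliefs \<Longrightarrow> \<bar>h z\<bar> \<le> B" and z: "z \<in> beliefs"
  shows "\<bar>eta h z u\<bar> \<le> B"
  using eta_close[OF h lipschitz_h_const[of 0 0] z, of 0 B u] B by (simp add: eta_def)

lemma nn_integral_value:
  assumes h: "lipschitz_h L h" and B: "\<And>z. z \<in> beliefs \<Longrightarrow> \<bar>h z\<bar> \<le> B" and z: "z \<in> beliefs"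
  shows "(\<integral>\<^sup>+y. ennreal (h (F z u y) + B) \<partial>next_obs_law T Q z u) = ennreal (eta h z u + B)"
proof -
  interpret P: prob_space "next_obs_law T Q z u" by (rule next_obs_prob[OF z])
  have b: "\<bar>h (F z u y)\<bar> \<le> B" if "y \<in> space (next_obs_law T Q z u)" for y
    using that by (intro B F_belief[OF z]) (simp add: space_next_obs[OF z])
  have m: "(\<lambda>y. h (F z u y)) \<in> borel_measurable (next_obs_law T Q z u)"
    using measurable_compose[OF F_measurable_y[OF z] lipschitz_h_measurable[OF h]]
    by (simp add: measurable_cong_sets[OF sets_next_obs[OF z] refl])
  have i: "integrable (next_obs_law T Q z u) (\<lambda>y. h (F z u y))"
    by (rule P.integrable_const_bound[of _ B]) (use b m in auto)
  have nn: "0 \<le> h (F z u y) + B" if "y \<in> space (next_obs_law T Q z u)" for y using b[OF that] by linarith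
  have "(\<integral>\<^sup>+y. ennreal (h (F z u y) + B) \<partial>next_obs_law T Q z u) = ennreal (\<integral>y. h (F z u y) + B \<partial>next_obs_law T Q z u)"
    using i nn by (intro nn_integral_eq_integral) auto
  then show ?thesis
    using i by (simp add: P.prob_space eta_def belief_kernel_integral[OF z lipschitz_h_measurable[OF h]])
qed

lemma belief_cost_measurable:
  "(\<lambda>w. belief_cost c (fst w) (snd w)) \<in> borel_measurable (prob_algebra borel \<Otimes>\<^sub>M borel)"
proof -
  let ?N = "prob_algebra (borel :: 'x measure) \<Otimes>\<^sub>M (borel :: 'u measure)"
  obtain C where C: "0 \<le> C" "\<And>x u. \<bar>c x u\<bar> \<le> C" using c_bound by metis
  have "(\<lambda>w. \<integral>\<^sup>+x. ennreal (c x (snd w) + C) \<partial>fst w) \<in> borel_measurable ?N"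
  proof (rule measurable_nn_integral_kernel[where M=borel])
    have "(\<lambda>v. (snd v, snd (fst v))) \<in> ?N \<Otimes>\<^sub>M (borel :: 'x measure) \<rightarrow>\<^sub>M borel \<Otimes>\<^sub>M borel" by measurable
    from measurable_compose[OF this c_measurable]
    have "(\<lambda>v. c (snd v) (snd (fst v))) \<in> borel_measurable (?N \<Otimes>\<^sub>M (borel :: 'x measure))" by simp
    then show "(\<lambda>(w, x). ennreal (c x (snd w) + C)) \<in> borel_measurable (?N \<Otimes>\<^sub>M (borel :: 'x measure))"
      by (simp add: split_beta')
  qed measurable
  then have "(\<lambda>w. enn2real (\<integral>\<^sup>+x. ennreal (c x (snd w) + C) \<partial>fst w) - C) \<in> borel_measurable ?N" by measurable
  then show ?thesis
  proof (rule measurable_cong[THEN iffD1, rotated])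
    fix w assume "w \<in> space ?N"
    then have z: "fst w \<in> beliefs" by (auto simp: space_pair_measure beliefs_eq)
    show "enn2real (\<integral>\<^sup>+x. ennreal (c x (snd w) + C) \<partial>fst w) - C = belief_cost c (fst w) (snd w)"
      using nn_integral_cost[OF C(2) z] belief_cost_bound[OF C(2) z, of "snd w"] by simp
  qed
qed

lemma next_obs_measurable:
  "(\<lambda>w. next_obs_law T Q (fst w) (snd w)) \<in> prob_algebra borel \<Otimes>\<^sub>M borel \<rightarrow>\<^sub>M prob_algebra Y"
proof -
  let ?N = "prob_algebra (borel :: 'x measure) \<Otimes>\<^sub>M (borel :: 'u measure)"
  have "(\<lambda>v. T (snd v, snd (fst v))) \<in> ?N \<Otimes>\<^sub>M (borel :: 'x measure) \<rightarrow>\<^sub>M prob_algebra borel"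
    by (rule measurable_compose[OF _ T_meas]) measurable
  then have "(\<lambda>w. fst w \<bind> (\<lambda>x. T (x, snd w))) \<in> ?N \<rightarrow>\<^sub>M prob_algebra borel"
    by (intro measurable_bind_prob_space2[where N=borel]) (auto simp: split_beta')
  then show ?thesis unfolding next_obs_law_def next_state_law_def
    by (rule measurable_bind_prob_space) (rule Q)
qed

lemma eta_measurable:
  assumes h: "lipschitz_h L h" and B: "\<And>z. z \<in> beliefs \<Longrightarrow> \<bar>h z\<bar> \<le> B"
  shows "(\<lambda>w. eta h (fst w) (snd w)) \<in> borel_measurable (prob_algebra borel \<Otimes>\<^sub>M borel)"
proof -
  let ?N = "prob_algebra (borel :: 'x measure) \<Otimes>\<^sub>M (borel :: 'u measure)"
  have "(\<lambda>w. \<integral>\<^sup>+y. ennreal (h (F (fst w) (snd w) y) + B) \<partial>next_obs_law T Q (fst w) (snd w)) \<in> borel_measurable ?N"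
  proof (rule measurable_nn_integral_kernel[OF _ next_obs_measurable])
    have "(\<lambda>v. (fst (fst v), snd (fst v), snd v)) \<in> ?N \<Otimes>\<^sub>M Y \<rightarrow>\<^sub>M prob_algebra borel \<Otimes>\<^sub>M borel \<Otimes>\<^sub>M Y" by measurable
    from measurable_compose[OF measurable_compose[OF this F_measurable] lipschitz_h_measurable[OF h]]
    have "(\<lambda>v. h (F (fst (fst v)) (snd (fst v)) (snd v))) \<in> borel_measurable (?N \<Otimes>\<^sub>M Y)" by simp
    then show "(\<lambda>(w, y). ennreal (h (F (fst w) (snd w) y) + B)) \<in> borel_measurable (?N \<Otimes>\<^sub>M Y)"
      by (simp add: split_beta')
  qed
  then have "(\<lambda>w. enn2real (\<integral>\<^sup>+y. ennreal (h (F (fst w) (snd w) y) + B) \<partial>next_obs_law T Q (fst w) (snd w)) - B) \<in> borel_measurable ?N"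
    by measurable
  then show ?thesis
  proof (rule measurable_cong[THEN iffD1, rotated])
    fix w assume "w \<in> space ?N"
    then have z: "fst w \<in> beliefs" by (auto simp: space_pair_measure beliefs_eq)
    show "enn2real (\<integral>\<^sup>+y. ennreal (h (F (fst w) (snd w) y) + B) \<partial>next_obs_law T Q (fst w) (snd w)) - B = eta h (fst w) (snd w)"
      using nn_integral_value[OF h B z] eta_bound[OF h B z, of "snd w"] by simp
  qed
qed

end

section \<open>Costs and values along the path\<close>

context controlled
begin

definition info :: "nat \<Rightarrow> ('x, 'y, 'u) path \<Rightarrow> (nat \<Rightarrow> 'y) \<times> (nat \<Rightarrow> 'u)" where
  "info t \<omega> = information t \<omega> (obs_at t \<omega>)"

lemma coord_path_measurable[measurable]:
  "state_at i \<in> pathM \<rightarrow>\<^sub>M borel" "obs_at i \<in> pathM \<rightarrow>\<^sub>M Y" "action_at i \<in> pathM \<rightarrow>\<^sub>M borel"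
proof -
  have i: "(\<lambda>\<omega>. \<omega> i) \<in> pathM \<rightarrow>\<^sub>M St"
    unfolding measurable_cong_sets[OF sets_path refl] by (intro measurable_component_singleton) auto
  show "state_at i \<in> pathM \<rightarrow>\<^sub>M borel" "obs_at i \<in> pathM \<rightarrow>\<^sub>M Y" "action_at i \<in> pathM \<rightarrow>\<^sub>M borel"
    unfolding state_at_def[abs_def] obs_at_def[abs_def] action_at_def[abs_def]
    by (rule measurable_compose[OF i St_fst] measurable_compose[OF i St_fst_snd] measurable_compose[OF i St_snd_snd])+
qed

lemma info_measurable: "info t \<in> pathM \<rightarrow>\<^sub>M Info t"
proof -
  have "info t = (\<lambda>\<omega>. (\<lambda>i\<in>{..t}. obs_at i \<omega>, \<lambda>i\<in>{..<t}. action_at i \<omega>))"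
    by (auto simp: info_def information_def fun_eq_iff)
  also have "\<dots> \<in> pathM \<rightarrow>\<^sub>M Info t" by (intro measurable_Pair measurable_restrict coord_path_measurable)
  finally show ?thesis .
qed

lemma info_space: "\<omega> \<in> space pathM \<Longrightarrow> info t \<omega> \<in> space (Info t)"
  by (rule measurable_space[OF info_measurable])

lemma belief_action_measurable: "(\<lambda>I. (bel t I, \<gamma> t I)) \<in> Info t \<rightarrow>\<^sub>M prob_algebra borel \<Otimes>\<^sub>M borel"
  by (intro measurable_Pair bel_measurable \<gamma>_measurable)

definition stage_cost :: "nat \<Rightarrow> real" where
  "stage_cost t = (\<integral>\<omega>. c (state_at t \<omega>) (action_at t \<omega>) \<partial>pathM)"

lemma cost_path_measurable: "(\<lambda>\<omega>. c (state_at t \<omega>) (action_at t \<omega>)) \<in> borel_measurable pathM"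
proof -
  have "(\<lambda>\<omega>. (state_at t \<omega>, action_at t \<omega>)) \<in> pathM \<rightarrow>\<^sub>M borel \<Otimes>\<^sub>M borel" by measurable
  from measurable_compose[OF this c_measurable] show ?thesis by simp
qed

lemma cost_integrable: "integrable pathM (\<lambda>\<omega>. c (state_at t \<omega>) (action_at t \<omega>))"
proof -
  interpret prob_space pathM by (rule prob_path)
  obtain C where "\<And>x u. \<bar>c x u\<bar> \<le> C" using c_bound by metis
  then show ?thesis using cost_path_measurable by (intro integrable_const_bound[of _ C]) auto
qed

text \<open>The cost sees the hidden state, but by \<open>E_filter\<close> only the law of the state
  given the information matters in expectation.\<close>

lemma stage_cost_belief:
  "stage_cost t = (\<integral>\<omega>. belief_cost c (bel t (info t \<omega>)) (\<gamma> t (info t \<omega>)) \<partial>pathM)"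
proof -
  obtain C where C: "0 \<le> C" "\<And>x u. \<bar>c x u\<bar> \<le> C" using c_bound by metis
  have bc: "(\<lambda>I. belief_cost c (bel t I) (\<gamma> t I)) \<in> borel_measurable (Info t)"
    using measurable_compose[OF belief_action_measurable belief_cost_measurable] by simp
  show ?thesis unfolding stage_cost_def
  proof (rule integral_eq_of_nn_integral_shift[OF prob_path cost_path_measurable C(2)])
    show "(\<lambda>\<omega>. belief_cost c (bel t (info t \<omega>)) (\<gamma> t (info t \<omega>))) \<in> borel_measurable pathM"
      by (rule measurable_compose[OF info_measurable bc])
    show "\<bar>belief_cost c (bel t (info t \<omega>)) (\<gamma> t (info t \<omega>))\<bar> \<le> C" if "\<omega> \<in> space pathM" for \<omega>
      by (rule belief_cost_bound[OF C(2) bel_belief[OF info_space[OF that]]])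
    have m1: "(\<lambda>(I :: (nat \<Rightarrow> 'y) \<times> (nat \<Rightarrow> 'u), x, u). ennreal (c x u + C)) \<in> borel_measurable (Info t \<Otimes>\<^sub>M borel \<Otimes>\<^sub>M borel)"
    proof -
      have "(\<lambda>v. (fst (snd v), snd (snd v))) \<in> Info t \<Otimes>\<^sub>M (borel :: 'x measure) \<Otimes>\<^sub>M (borel :: 'u measure) \<rightarrow>\<^sub>M borel \<Otimes>\<^sub>M borel" by measurable
      from measurable_compose[OF this c_measurable]
      have "(\<lambda>v. c (fst (snd v)) (snd (snd v))) \<in> borel_measurable (Info t \<Otimes>\<^sub>M (borel :: 'x measure) \<Otimes>\<^sub>M (borel :: 'u measure))" by simp
      then show ?thesis by (simp add: split_beta')
    qed
    have m2: "(\<lambda>(I, x :: 'x, u :: 'u). ennreal (belief_cost c (bel t I) (\<gamma> t I) + C)) \<in> borel_measurable (Info t \<Otimes>\<^sub>M borel \<Otimes>\<^sub>M borel)"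
    proof -
      have "(\<lambda>v. belief_cost c (bel t (fst v)) (\<gamma> t (fst v))) \<in> borel_measurable (Info t \<Otimes>\<^sub>M (borel :: 'x measure) \<Otimes>\<^sub>M (borel :: 'u measure))"
        by (rule measurable_compose[OF measurable_fst bc])
      then have "(\<lambda>v. ennreal (belief_cost c (bel t (fst v)) (\<gamma> t (fst v)) + C)) \<in> borel_measurable (Info t \<Otimes>\<^sub>M (borel :: 'x measure) \<Otimes>\<^sub>M (borel :: 'u measure))"
        by measurable
      then show ?thesis by (simp add: split_beta')
    qed
    have m3: "(\<lambda>(I, x). ennreal (c x (\<gamma> t I) + C)) \<in> borel_measurable (Info t \<Otimes>\<^sub>M borel)"
    proof -
      have "(\<lambda>v. (snd v, \<gamma> t (fst v))) \<in> Info t \<Otimes>\<^sub>M (borel :: 'x measure) \<rightarrow>\<^sub>M borel \<Otimes>\<^sub>M borel"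
        by (intro measurable_Pair measurable_compose[OF measurable_fst \<gamma>_measurable] measurable_snd)
      from measurable_compose[OF this c_measurable]
      have "(\<lambda>v. c (snd v) (\<gamma> t (fst v))) \<in> borel_measurable (Info t \<Otimes>\<^sub>M (borel :: 'x measure))" by simp
      then show ?thesis by (simp add: split_beta')
    qed
    have "(\<integral>\<^sup>+\<omega>. ennreal (c (state_at t \<omega>) (action_at t \<omega>) + C) \<partial>pathM) = E t (\<lambda>I x. ennreal (c x (\<gamma> t I) + C))"
      by (rule E_path[OF m1])
    also have "\<dots> = E t (\<lambda>I _. \<integral>\<^sup>+x. ennreal (c x (\<gamma> t I) + C) \<partial>bel t I)" by (rule E_filter[OF m3])
    also have "\<dots> = E t (\<lambda>I _. ennreal (belief_cost c (bel t I) (\<gamma> t I) + C))"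
      by (rule E_cong) (rule nn_integral_cost[OF C(2) bel_belief])
    also have "\<dots> = (\<integral>\<^sup>+\<omega>. ennreal (belief_cost c (bel t (info t \<omega>)) (\<gamma> t (info t \<omega>)) + C) \<partial>pathM)"
      unfolding info_def by (rule E_path[OF m2, symmetric])
    finally show "(\<integral>\<^sup>+\<omega>. ennreal (c (state_at t \<omega>) (action_at t \<omega>) + C) \<partial>pathM) =
      (\<integral>\<^sup>+\<omega>. ennreal (belief_cost c (bel t (info t \<omega>)) (\<gamma> t (info t \<omega>)) + C) \<partial>pathM)" .
  qed
qed

definition stage_value :: "('x measure \<Rightarrow> real) \<Rightarrow> nat \<Rightarrow> real" where
  "stage_value h t = (\<integral>\<omega>. h (bel t (info t \<omega>)) \<partial>pathM)"

lemma value_path_measurable: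
  "lipschitz_h L h \<Longrightarrow> (\<lambda>\<omega>. h (bel t (info t \<omega>))) \<in> borel_measurable pathM"
  by (rule measurable_compose[OF measurable_compose[OF info_measurable bel_measurable] lipschitz_h_measurable])

lemma eta_info_measurable:
  assumes "lipschitz_h L h" "\<And>z. z \<in> beliefs \<Longrightarrow> \<bar>h z\<bar> \<le> B"
  shows "(\<lambda>I. eta h (bel t I) (\<gamma> t I)) \<in> borel_measurable (Info t)"
  using measurable_compose[OF belief_action_measurable eta_measurable[OF assms]] by simp

text \<open>The belief process is a controlled Markov chain with kernel
  \<open>belief_kernel\<close>: \<open>eta h\<close> is the expectation of \<open>h\<close> at the
  next belief given the current information.\<close>

lemma stage_value_Suc:
  assumes h: "lipschitz_h L h" and B: "\<And>z. z \<in> beliefs \<Longrightarrow> \<bar>h z\<bar> \<le> B"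
  shows "stage_value h (Suc t) = (\<integral>\<omega>. eta h (bel t (info t \<omega>)) (\<gamma> t (info t \<omega>)) \<partial>pathM)"
  unfolding stage_value_def
proof (rule integral_eq_of_nn_integral_shift[OF prob_path value_path_measurable[OF h]])
  show "\<bar>h (bel (Suc t) (info (Suc t) \<omega>))\<bar> \<le> B" if "\<omega> \<in> space pathM" for \<omega>
    by (rule B[OF bel_belief[OF info_space[OF that]]])
  show "(\<lambda>\<omega>. eta h (bel t (info t \<omega>)) (\<gamma> t (info t \<omega>))) \<in> borel_measurable pathM"
    by (rule measurable_compose[OF info_measurable eta_info_measurable[OF h B]])
  show "\<bar>eta h (bel t (info t \<omega>)) (\<gamma> t (info t \<omega>))\<bar> \<le> B" if "\<omega> \<in> space pathM" for \<omega>
    by (rule eta_bound[OF h B bel_belief[OF info_space[OF that]]])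
  have hb: "(\<lambda>I. h (bel (Suc t) I)) \<in> borel_measurable (Info (Suc t))"
    by (rule measurable_compose[OF bel_measurable lipschitz_h_measurable[OF h]])
  from hb have hb': "(\<lambda>I. ennreal (h (bel (Suc t) I) + B)) \<in> borel_measurable (Info (Suc t))" by measurable
  have m1: "(\<lambda>(I, x :: 'x, u :: 'u). ennreal (h (bel (Suc t) I) + B)) \<in> borel_measurable (Info (Suc t) \<Otimes>\<^sub>M borel \<Otimes>\<^sub>M borel)"
    using measurable_compose[OF measurable_fst hb'] by (simp add: split_beta' del: filter_path.simps)
  have m2: "(\<lambda>(I, x :: 'x). ennreal (h (bel (Suc t) I) + B)) \<in> borel_measurable (Info (Suc t) \<Otimes>\<^sub>M borel)"
    using measurable_compose[OF measurable_fst hb'] by (simp add: split_beta' del: filter_path.simps)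
  have eb: "(\<lambda>I. ennreal (eta h (bel t I) (\<gamma> t I) + B)) \<in> borel_measurable (Info t)"
    using eta_info_measurable[OF h B] by measurable
  have m3: "(\<lambda>(I, x :: 'x, u :: 'u). ennreal (eta h (bel t I) (\<gamma> t I) + B)) \<in> borel_measurable (Info t \<Otimes>\<^sub>M borel \<Otimes>\<^sub>M borel)"
    using measurable_compose[OF measurable_fst eb] by (simp add: split_beta')
  have "(\<integral>\<^sup>+\<omega>. ennreal (h (bel (Suc t) (info (Suc t) \<omega>)) + B) \<partial>pathM) = E (Suc t) (\<lambda>I _. ennreal (h (bel (Suc t) I) + B))"
    unfolding info_def by (rule E_path[OF m1])
  also have "\<dots> = E t (\<lambda>I _. \<integral>\<^sup>+y'. \<integral>\<^sup>+x'. ennreal (h (bel (Suc t) (extend_info t I (\<gamma> t I) y')) + B) \<partial>F (bel t I) (\<gamma> t I) y' \<partial>next_obs_law T Q (bel t I) (\<gamma> t I))"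
    by (rule E_Suc_filter[OF m2 E_filter])
  also have "\<dots> = E t (\<lambda>I _. ennreal (eta h (bel t I) (\<gamma> t I) + B))"
  proof (rule E_cong)
    fix I assume I: "I \<in> space (Info t)"
    note z = bel_belief[OF I]
    have "(\<integral>\<^sup>+y'. \<integral>\<^sup>+x'. ennreal (h (bel (Suc t) (extend_info t I (\<gamma> t I) y')) + B) \<partial>F (bel t I) (\<gamma> t I) y' \<partial>next_obs_law T Q (bel t I) (\<gamma> t I)) =
       (\<integral>\<^sup>+y'. ennreal (h (F (bel t I) (\<gamma> t I) y') + B) \<partial>next_obs_law T Q (bel t I) (\<gamma> t I))"
    proof (rule nn_integral_cong)
      fix y' assume "y' \<in> space (next_obs_law T Q (bel t I) (\<gamma> t I))"
      then have "prob_space (F (bel t I) (\<gamma> t I) y')"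
        by (intro beliefsD(1)[OF F_belief[OF z]]) (simp add: space_next_obs[OF z])
      then show "(\<integral>\<^sup>+x'. ennreal (h (bel (Suc t) (extend_info t I (\<gamma> t I) y')) + B) \<partial>F (bel t I) (\<gamma> t I) y') =
          ennreal (h (F (bel t I) (\<gamma> t I) y') + B)"
        by (simp add: bel_extend prob_space.emeasure_space_1 del: filter_path.simps)
    qed
    also have "\<dots> = ennreal (eta h (bel t I) (\<gamma> t I) + B)" by (rule nn_integral_value[OF h B z])
    finally show "(\<integral>\<^sup>+y'. \<integral>\<^sup>+x'. ennreal (h (bel (Suc t) (extend_info t I (\<gamma> t I) y')) + B) \<partial>F (bel t I) (\<gamma> t I) y' \<partial>next_obs_law T Q (bel t I) (\<gamma> t I)) =
      ennreal (eta h (bel t I) (\<gamma> t I) + B)" .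
  qed
  also have "\<dots> = (\<integral>\<^sup>+\<omega>. ennreal (eta h (bel t (info t \<omega>)) (\<gamma> t (info t \<omega>)) + B) \<partial>pathM)"
    unfolding info_def by (rule E_path[OF m3, symmetric])
  finally show "(\<integral>\<^sup>+\<omega>. ennreal (h (bel (Suc t) (info (Suc t) \<omega>)) + B) \<partial>pathM) =
    (\<integral>\<^sup>+\<omega>. ennreal (eta h (bel t (info t \<omega>)) (\<gamma> t (info t \<omega>)) + B) \<partial>pathM)" .
qed

lemma stage_value_bound:
  assumes h: "lipschitz_h L h" and B: "\<And>z. z \<in> beliefs \<Longrightarrow> \<bar>h z\<bar> \<le> B"
  shows "\<bar>stage_value h t\<bar> \<le> B"
proof -
  interpret prob_space pathM by (rule prob_path)
  have b: "\<bar>h (bel t (info t \<omega>))\<bar> \<le> B" if "\<omega> \<in> space pathM" for \<omega>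
    by (rule B[OF bel_belief[OF info_space[OF that]]])
  have i: "integrable pathM (\<lambda>\<omega>. h (bel t (info t \<omega>)))"
    by (rule integrable_const_bound[of _ B]) (use b value_path_measurable[OF h] in auto)
  have "\<bar>stage_value h t\<bar> \<le> (\<integral>\<omega>. \<bar>h (bel t (info t \<omega>))\<bar> \<partial>pathM)"
    unfolding stage_value_def by (rule integral_abs_bound)
  also have "\<dots> \<le> (\<integral>\<omega>. B \<partial>pathM)" by (rule integral_mono) (use i b in auto)
  finally show ?thesis by (simp add: prob_space)
qed

text \<open>When \<open>h\<close> and \<rho> solve the optimality equation, the integrand is the
  loss of the policy's action against the minimum: nonnegative for every policy and 0 for a
  minimizing selector.\<close>

lemma stage_cost_integrals:
  assumes h: "lipschitz_h L h" and B: "\<And>z. z \<in> beliefs \<Longrightarrow> \<bar>h z\<bar> \<le> B"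
  shows "stage_cost t + stage_value h (Suc t) - stage_value h t - \<rho> =
    (\<integral>\<omega>. belief_cost c (bel t (info t \<omega>)) (\<gamma> t (info t \<omega>)) + eta h (bel t (info t \<omega>)) (\<gamma> t (info t \<omega>)) - h (bel t (info t \<omega>)) - \<rho> \<partial>pathM)"
proof -
  interpret prob_space pathM by (rule prob_path)
  obtain C where C: "0 \<le> C" "\<And>x u. \<bar>c x u\<bar> \<le> C" using c_bound by metis
  have bc: "(\<lambda>I. belief_cost c (bel t I) (\<gamma> t I)) \<in> borel_measurable (Info t)"
    using measurable_compose[OF belief_action_measurable belief_cost_measurable] by simp
  have i1: "integrable pathM (\<lambda>\<omega>. belief_cost c (bel t (info t \<omega>)) (\<gamma> t (info t \<omega>)))"
    by (rule integrable_const_bound[of _ C])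
       (use measurable_compose[OF info_measurable bc] belief_cost_bound[OF C(2) bel_belief[OF info_space]] in auto)
  have i2: "integrable pathM (\<lambda>\<omega>. eta h (bel t (info t \<omega>)) (\<gamma> t (info t \<omega>)))"
    by (rule integrable_const_bound[of _ B])
       (use measurable_compose[OF info_measurable eta_info_measurable[OF h B]] eta_bound[OF h B bel_belief[OF info_space]] in auto)
  have i3: "integrable pathM (\<lambda>\<omega>. h (bel t (info t \<omega>)))"
    by (rule integrable_const_bound[of _ B]) (use B[OF bel_belief[OF info_space]] value_path_measurable[OF h] in auto)
  have sv: "stage_value h (Suc t) = (\<integral>\<omega>. eta h (bel t (info t \<omega>)) (\<gamma> t (info t \<omega>)) \<partial>pathM)"
    by (rule stage_value_Suc[OF h B])
  show ?thesis
    unfolding stage_cost_belief sv unfolding stage_value_def using i1 i2 i3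
    by (simp add: prob_space)
qed

section \<open>The average cost of a policy\<close>

lemma average_cost_eq:
  "average_cost Y T Q c \<mu> \<gamma> = limsup (\<lambda>n. ereal (1 / real n * (\<Sum>t<n. stage_cost t)))"
  unfolding average_cost_def stage_cost_def by (simp add: Bochner_Integration.integral_sum cost_integrable)

text \<open>The sum telescopes to \<open>n * \<rho>\<close> plus a boundary term bounded uniformly
  in n, which disappears in the average.\<close>

lemma telescoped_cost_limit:
  assumes h: "lipschitz_h L h"
  shows "(\<lambda>n. 1 / real n * (\<Sum>t<n. stage_value h t + \<rho> - stage_value h (Suc t))) \<longlonglongrightarrow> \<rho>"
proof -
  obtain B where B: "\<And>z. z \<in> beliefs \<Longrightarrow> \<bar>h z\<bar> \<le> B" by (rule lipschitz_h_bounded[OF h]) blast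
  have sum: "(\<Sum>t<n. stage_value h t + \<rho> - stage_value h (Suc t)) = real n * \<rho> + (stage_value h 0 - stage_value h n)" for n
    by (induction n) (auto simp: algebra_simps)
  have "(\<lambda>n. \<rho> + (stage_value h 0 - stage_value h n) / real n) \<longlonglongrightarrow> \<rho> + 0"
  proof (intro tendsto_add tendsto_const)
    have b: "\<bar>(stage_value h 0 - stage_value h n) / real n\<bar> \<le> 2 * B / real n" for n
    proof -
      have "\<bar>stage_value h 0 - stage_value h n\<bar> \<le> 2 * B"
        using stage_value_bound[OF h B, of 0] stage_value_bound[OF h B, of n] by linarith
      then show ?thesis by (simp add: abs_divide divide_right_mono)
    qed
    have "(\<lambda>n. 2 * B / real n) \<longlonglongrightarrow> 0" by (rule lim_const_over_n)
    then show "(\<lambda>n. (stage_value h 0 - stage_value h n) / real n) \<longlonglongrightarrow> 0"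
      by (rule Lim_null_comparison[rotated]) (use b in simp)
  qed
  moreover have "\<forall>\<^sub>F n in sequentially. \<rho> + (stage_value h 0 - stage_value h n) / real n =
      1 / real n * (\<Sum>t<n. stage_value h t + \<rho> - stage_value h (Suc t))"
    \<comment> \<open>Only from n = 1 on, because division by 0 gives 0.\<close>
    unfolding sum by (rule eventually_sequentiallyI[of 1]) (simp add: field_simps)
  ultimately show ?thesis by (auto elim: Lim_transform_eventually)
qed

lemma average_cost_ge:
  assumes h: "lipschitz_h L h"
    and le: "\<And>z u. z \<in> beliefs \<Longrightarrow> h z + \<rho> \<le> belief_cost c z u + eta h z u"
  shows "ereal \<rho> \<le> average_cost Y T Q c \<mu> \<gamma>"
proof -
  obtain B where B: "\<And>z. z \<in> beliefs \<Longrightarrow> \<bar>h z\<bar> \<le> B" by (rule lipschitz_h_bounded[OF h]) blast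
  have step: "stage_value h t + \<rho> - stage_value h (Suc t) \<le> stage_cost t" for t
  proof -
    have eq: "stage_cost t + stage_value h (Suc t) - stage_value h t - \<rho> =
      (\<integral>\<omega>. belief_cost c (bel t (info t \<omega>)) (\<gamma> t (info t \<omega>)) + eta h (bel t (info t \<omega>)) (\<gamma> t (info t \<omega>)) - h (bel t (info t \<omega>)) - \<rho> \<partial>pathM)"
      by (rule stage_cost_integrals[OF h B])
    have "0 \<le> stage_cost t + stage_value h (Suc t) - stage_value h t - \<rho>"
      unfolding eq
    proof (rule integral_nonneg_AE, rule AE_I2)
      fix \<omega> assume "\<omega> \<in> space pathM"
      from le[OF bel_belief[OF info_space[OF this]], of t "\<gamma> t (info t \<omega>)"]
      show "0 \<le> belief_cost c (bel t (info t \<omega>)) (\<gamma> t (info t \<omega>)) + eta h (bel t (info t \<omega>)) (\<gamma> t (info t \<omega>)) - h (bel t (info t \<omega>)) - \<rho>"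
        by linarith
    qed
    then show ?thesis by linarith
  qed
  have "ereal \<rho> = limsup (\<lambda>n. ereal (1 / real n * (\<Sum>t<n. stage_value h t + \<rho> - stage_value h (Suc t))))"
    using telescoped_cost_limit[OF h, of \<rho>] by (intro lim_imp_Limsup[symmetric]) auto
  also have "\<dots> \<le> average_cost Y T Q c \<mu> \<gamma>"
    unfolding average_cost_eq
    by (intro Limsup_mono always_eventually allI) (simp add: divide_right_mono sum_mono step)
  finally show ?thesis .
qed

lemma average_cost_selector:
  assumes h: "lipschitz_h L h"
    and eq: "\<And>z. z \<in> beliefs \<Longrightarrow> h z + \<rho> = belief_cost c z (g z) + eta h z (g z)"
    and \<gamma>: "\<And>t I. \<gamma> t I = g (bel t I)"
  shows "average_cost Y T Q c \<mu> \<gamma> = ereal \<rho>"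
proof -
  obtain B where B: "\<And>z. z \<in> beliefs \<Longrightarrow> \<bar>h z\<bar> \<le> B" by (rule lipschitz_h_bounded[OF h]) blast
  have step: "stage_cost t = stage_value h t + \<rho> - stage_value h (Suc t)" for t
  proof -
    have "stage_cost t + stage_value h (Suc t) - stage_value h t - \<rho> =
      (\<integral>\<omega>. belief_cost c (bel t (info t \<omega>)) (\<gamma> t (info t \<omega>)) + eta h (bel t (info t \<omega>)) (\<gamma> t (info t \<omega>)) - h (bel t (info t \<omega>)) - \<rho> \<partial>pathM)"
      by (rule stage_cost_integrals[OF h B])
    also have "\<dots> = (\<integral>\<omega>. 0 \<partial>pathM)"
    proof (rule Bochner_Integration.integral_cong[OF refl])
      fix \<omega> assume "\<omega> \<in> space pathM"
      from eq[OF bel_belief[OF info_space[OF this]], of t]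
      show "belief_cost c (bel t (info t \<omega>)) (\<gamma> t (info t \<omega>)) + eta h (bel t (info t \<omega>)) (\<gamma> t (info t \<omega>)) - h (bel t (info t \<omega>)) - \<rho> = 0"
        by (simp add: \<gamma>)
    qed
    finally show ?thesis by simp
  qed
  show ?thesis unfolding average_cost_eq step
    using telescoped_cost_limit[OF h, of \<rho>] by (intro lim_imp_Limsup) auto
qed

end

theorem theorem1p1:
  fixes Y :: "'y measure"
    and T :: "'x::polish_space \<times> 'u::polish_space \<Rightarrow> 'x measure"
    and Q :: "'x \<Rightarrow> 'y measure"
    and c :: "'x \<Rightarrow> 'u \<Rightarrow> real"
    and \<alpha> K\<^sub>1 :: real
  assumes "standard_borel Y"
    and "T \<in> borel \<Otimes>\<^sub>M borel \<rightarrow>\<^sub>M prob_algebra borel"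
    and "Q \<in> borel \<rightarrow>\<^sub>M prob_algebra Y"
    and "compact (UNIV :: 'u set)"
    and "compact (UNIV :: 'x set)"
    and "\<And>xs us x u. xs \<longlonglongrightarrow> x \<Longrightarrow> us \<longlonglongrightarrow> u \<Longrightarrow>
           (\<lambda>n. tv_norm_diff (T (xs n, us n)) (T (x, u))) \<longlonglongrightarrow> 0"
    and "0 \<le> \<alpha>"
    and "\<And>x x' u. tv_norm_diff (T (x, u)) (T (x', u)) \<le> \<alpha> * dist x x'"
    and "0 \<le> K\<^sub>1"
    and "\<And>x x' u. \<bar>c x u - c x' u\<bar> \<le> K\<^sub>1 * dist x x'"
    and "continuous_on UNIV (\<lambda>(x, u). c x u)"
    and "\<alpha> * diameter (UNIV :: 'x set) * (3 - 2 * dobrushin Y Q) / 2 < 1"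
  shows "(\<exists>h g \<rho>. acoe_solution Y T Q c h g \<rho>) \<and>
    (\<forall>\<mu>\<in>beliefs. \<exists>\<gamma>. optimal_policy Y T Q c \<mu> \<gamma>) \<and>
    (\<exists>J :: real. \<forall>\<mu>\<in>beliefs. optimal_average_cost Y T Q c \<mu> = ereal J)"
proof -
  interpret pomdp Y T Q c \<alpha> K\<^sub>1
    by (rule pomdp.intro) (fact assms)+
  obtain lam p where lam: "lam \<in> space (prob_algebra borel)"
    and p: "p \<in> borel_measurable ((borel \<Otimes>\<^sub>M borel) \<Otimes>\<^sub>M borel)" "\<And>w. 0 \<le> p w"
      "\<And>a. T a = density lam (\<lambda>x. ennreal (p (a, x)))"
    using ex_dominating_density by metis
  \<comment> \<open>Applied to \<open>lam\<close> and to each initial distribution, which may be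
    singular to \<open>lam\<close>.\<close>
  have ex_bayes: "\<exists>\<kappa>. bayes_kernel \<nu> Q Y \<kappa>" if "\<nu> \<in> beliefs" for \<nu>
  proof -
    have \<nu>: "\<nu> \<in> space (prob_algebra borel)" using that by (simp add: beliefs_eq)
    show ?thesis
    proof (rule disintegration[OF \<nu> Q_meas])
      fix \<kappa> assume "\<kappa> \<in> Y \<rightarrow>\<^sub>M prob_algebra borel"
        and "\<And>A B. A \<in> sets borel \<Longrightarrow> B \<in> sets Y \<Longrightarrow>
          (\<integral>\<^sup>+x. indicator A x * emeasure (Q x) B \<partial>\<nu>) = (\<integral>\<^sup>+y. emeasure (\<kappa> y) A * indicator B y \<partial>(\<nu> \<bind> Q))"
      then have "bayes_kernel \<nu> Q Y \<kappa>" using compX \<nu> Q_meas by (intro bayes_kernel.intro)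
      then show "\<exists>\<kappa>. bayes_kernel \<nu> Q Y \<kappa>" by (rule exI[of _ \<kappa>])
    qed
  qed
  obtain \<kappa> where \<kappa>: "bayes_kernel lam Q Y \<kappa>" using ex_bayes[of lam] lam by (auto simp: beliefs_eq)
  interpret pomdp_density Y T Q c \<alpha> K\<^sub>1 lam \<kappa> p
    by (intro pomdp_density.intro pomdp_axioms \<kappa> pomdp_density_axioms.intro p)
  obtain h \<rho> g where h: "lipschitz_h Lip h" and g: "g \<in> prob_algebra borel \<rightarrow>\<^sub>M borel"
    and le: "\<And>z u. z \<in> beliefs \<Longrightarrow> h z + \<rho> \<le> belief_cost c z u + eta h z u"
    and eq: "\<And>z. z \<in> beliefs \<Longrightarrow> h z + \<rho> = belief_cost c z (g z) + eta h z (g z)"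
    using acoe_with_selector by metis
  have opt: "\<exists>\<gamma>. optimal_policy Y T Q c \<mu> \<gamma> \<and> optimal_average_cost Y T Q c \<mu> = ereal \<rho>" if \<mu>: "\<mu> \<in> beliefs" for \<mu>
  proof -
    obtain \<kappa>\<^sub>0 where \<kappa>0: "bayes_kernel \<mu> Q Y \<kappa>\<^sub>0" using ex_bayes[OF \<mu>] by blast
    have ctrl: "controlled Y T Q c \<alpha> K\<^sub>1 lam \<kappa> p \<mu> \<kappa>\<^sub>0 \<gamma>" if "\<gamma> \<in> admissible Y" for \<gamma>
      by (intro controlled.intro pomdp_density_axioms controlled_axioms.intro \<kappa>0 that)
    \<comment> \<open>The selector is applied to the filter started from the posterior kernel of
      \<mu>, so the optimal policy depends on \<mu> while its cost does not.\<close>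
    define \<gamma> where "\<gamma> = (\<lambda>t I. g (filter_path \<kappa>\<^sub>0 t I))"
    have adm: "\<gamma> \<in> admissible Y"
      unfolding admissible_def \<gamma>_def
      using measurable_compose[OF filter_path_measurable[OF bayes_kernel.\<kappa>[OF \<kappa>0]] g] by simp
    have lower: "ereal \<rho> \<le> average_cost Y T Q c \<mu> \<gamma>'" if "\<gamma>' \<in> admissible Y" for \<gamma>'
      by (rule controlled.average_cost_ge[OF ctrl[OF that] h le])
    have attained: "average_cost Y T Q c \<mu> \<gamma> = ereal \<rho>"
      by (rule controlled.average_cost_selector[OF ctrl[OF adm] h eq]) (simp_all add: \<gamma>_def)
    have "optimal_average_cost Y T Q c \<mu> = ereal \<rho>"
      unfolding optimal_average_cost_def
    proof (rule antisym)
      show "(INF \<gamma>\<in>admissible Y. average_cost Y T Q c \<mu> \<gamma>) \<le> ereal \<rho>"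
        using INF_lower[OF adm, of "average_cost Y T Q c \<mu>"] by (simp add: attained)
    qed (rule INF_greatest, rule lower)
    then show ?thesis using adm attained by (auto simp: optimal_policy_def)
  qed
  show ?thesis
    using acoe_solutionI[OF h g le eq] opt by blast
qed

end
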